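(* Let $d\ge 2$ and suppose that there exist $\beta_1,\beta_2,\alpha>0$ and $r\in(0,1]$ such that for all $t\ge 0$, $$\beta_1 e^{-\alpha t^r}\le \mathbb{P}(\tau_e>t)\le \beta_2 e^{-\alpha t^r}.$$ Then for all $\xi>0$ and $x\in\mathbb{R}^d\setminus\{0\}$, $$\lim_{n\to\infty}\frac{1}{n^r}\log \mathbb{P}\big(\mathrm{T}(0,nx)>n(\mu(x)+\xi)\big)=-2d\,\alpha\,\xi^r.$$
   Context: First-passage percolation on $\mathbb{Z}^d$. Let $E(\mathbb{Z}^d)$ be the set of undirected nearest-neighbor edges $\langle v,w\rangle=\{v,w\}$, $|v-w|_1=1$. To each edge $e\in E(\mathbb{Z}^d)$ is attached a non-negative random variable $\tau_e$; the family $(\tau_e)_{e\in E(\mathbb{Z}^d)}$ is independent and identically distributed. A path is a finite sequence of vertices whose successive elements are nearest neighbors; it is also viewed as its set of edges. The passage time of a path $\gamma$ is $\mathrm{T}(\gamma)=\sum_{e\in\gamma}\tau_e$. For $x\in\mathbb{R}^d$ let $\lfloor x\rfloor=(\lfloor x_1\rfloor,\dots,\lfloor x_d\rfloor)$. For $x,y\in\mathbb{R}^d$, the first passage time is $\mathrm{T}(x,y)=\inf_\gamma \mathrm{T}(\gamma)$, the infimum being over all finite paths from $\lfloor x\rfloor$ to $\lfloor y\rfloor$. When $\mathbb{E}\tau_e<\infty$, the time constant $\mu(x)\in[0,\infty)$ is the non-random limit $\mu(x)=\lim_{t\to\infty}t^{-1}\mathrm{T}(0,tx)=\lim_{t\to\infty}t^{-1}\mathbb{E}[\mathrm{T}(0,tx)]$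 a.s. (it exists by Kingman's theorem). *)

theory Defs
  imports "HOL-Probability.Probability"
begin

definition nearest_neighbors :: "int ^ 'n \<Rightarrow> int ^ 'n \<Rightarrow> bool" where
  "nearest_neighbors v w \<longleftrightarrow> (\<Sum>i\<in>UNIV. \<bar>v $ i - w $ i\<bar>) = 1"

definition lattice_edges :: "(int ^ 'n) set set" where
  "lattice_edges = {{v, w} | v w. nearest_neighbors v w}"

definition floor_vec :: "real ^ 'n \<Rightarrow> int ^ 'n" where
  "floor_vec x = (\<chi> i. \<lfloor>x $ i\<rfloor>)"

definition lattice_paths :: "int ^ 'n \<Rightarrow> int ^ 'n \<Rightarrow> (int ^ 'n) list set" where
  "lattice_paths v w =
     {\<gamma>. \<gamma> \<noteq> [] \<and> successively nearest_neighbors \<gamma> \<and> hd \<gamma> = v \<and> last \<gamma> = w}"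

definition path_edges :: "(int ^ 'n) list \<Rightarrow> (int ^ 'n) set set" where
  "path_edges \<gamma> = {{\<gamma> ! i, \<gamma> ! Suc i} | i. Suc i < length \<gamma>}"

text \<open>In the next two definitions, \<open>\<tau>\<close> is a single realization of the edge weights. A path
  is summed over as a set of edges, so an edge crossed several times is counted once.\<close>

definition passage_time :: "((int ^ 'n) set \<Rightarrow> real) \<Rightarrow> (int ^ 'n) list \<Rightarrow> real" where
  "passage_time \<tau> \<gamma> = (\<Sum>e\<in>path_edges \<gamma>. \<tau> e)"

definition first_passage_time ::
    "((int ^ 'n) set \<Rightarrow> real) \<Rightarrow> real ^ 'n \<Rightarrow> real ^ 'n \<Rightarrow> real" where
  "first_passage_time \<tau> x y =
     (INF \<gamma>\<in>lattice_paths (floor_vec x) (floor_vec y). passage_time \<tau> \<gamma>)"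

text \<open>By Kingman's theorem the time constant is both the limit of \<open>E[T(0,tx)] / t\<close> and the
  almost sure limit of \<open>T(0,tx) / t\<close>, as the real parameter \<open>t\<close> tends to infinity. The first
  expression is the one used here.\<close>

definition time_constant ::
    "'a measure \<Rightarrow> ((int ^ 'n) set \<Rightarrow> 'a \<Rightarrow> real) \<Rightarrow> real ^ 'n \<Rightarrow> real" where
  "time_constant M \<tau> x =
     Lim at_top (\<lambda>t::real.
       (\<integral>\<omega>. first_passage_time (\<lambda>e. \<tau> e \<omega>) 0 (t *\<^sub>R x) \<partial>M) / t)"

end

theory Submission
  imports Defs "HOL-Real_Asymp.Real_Asymp"
begin

text \<open>
  The tail comes from the weights near the two endpoints.

  Lower bound: let all edges at the origin exceed \<open>n(\<xi> + \<epsilon>)\<close>. Every path to \<open>nx\<close> pays this amount once,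
  and independently the remaining passage time exceeds \<open>n(\<mu> - \<epsilon>)\<close> with probability bounded below, by a
  second moment argument. There are \<open>2d\<close> such edges.

  Upper bound: take of order \<open>n\<^sup>r\<close> parallel tubes of bounded width, with starting points at distance
  \<open>O(\<delta> n\<^sup>r)\<close> from the origin. They are independent, and by Chebyshev each has a crossing time above
  \<open>n(\<mu> + \<epsilon>)\<close> with probability tending to \<open>0\<close>, so all of them are slow only with probability
  \<open>exp(-\<omega>(n\<^sup>r))\<close>. If some tube is fast, one of the starting points is connected to its endpoint so badly
  that the two connections together cost more than \<open>n(\<xi> - \<epsilon>)\<close>. But each connection can be made along \<open>2d\<close>
  edge-disjoint paths with \<open>O(\<delta> n\<^sup>r)\<close> edges, so by subadditivity of \<open>t\<^sup>r\<close> the sum of \<open>\<tau>\<^sub>e\<^sup>r\<close> over these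
  edges is at least \<open>2d(n(\<xi> - \<epsilon>))\<^sup>r\<close>, and Markov's inequality for \<open>exp(a \<tau>\<^sub>e\<^sup>r)\<close> with \<open>a\<close> close to \<open>\<alpha>\<close>
  gives the rate.
\<close>

section \<open>Lattice paths\<close>

text \<open>The constant is 2d although both endpoints contribute 2d routes each. If the connections
  at the two ends cost U and V, the routes carry at least 2d (U^r + V^r), and U^r + V^r >= (U + V)^r
  since r <= 1. Sharing the excess between the ends is therefore never cheaper than loading one of
  them. The obstacle in the upper bound is the bulk: Chebyshev gives a single tube a failure
  probability of order 1/n, far above exp(-n^r). Repetition cures this. With K of order \<delta> n^r
  independent tubes and q_n -> 0, the exponent K log(1/q_n) outgrows n^r for every fixed \<delta>.
  So \<delta> may be chosen small, which keeps the exponential moments collected along the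
  connections, a factor C^(O(\<delta> n^r)), below any prescribed part of the rate. Independence of
  the tubes has to be exact. A tube is therefore a chain of minima over finite families of paths,
  and these families are indexed by finitely many displacements, so that the width of a tube and the
  second moments of its pieces are uniform.\<close>

lemma nearest_neighbors_sym: "nearest_neighbors u v \<longleftrightarrow> nearest_neighbors v u"
  unfolding nearest_neighbors_def by (simp add: abs_minus_commute)

lemma nearest_neighbors_add [simp]:
  "nearest_neighbors (u + z) (v + z) \<longleftrightarrow> nearest_neighbors u v"
  unfolding nearest_neighbors_def by simp

lemma nearest_neighbors_axis:
  assumes "\<bar>s\<bar> = 1"
  shows "nearest_neighbors u (u + axis b s)"
proof -
  have "(\<Sum>i\<in>UNIV. \<bar>u $ i - (u + axis b s) $ i\<bar>) = (\<Sum>i\<in>UNIV. if i = b then 1 else 0)"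
    using assms by (intro sum.cong) (auto simp: axis_def)
  then show ?thesis unfolding nearest_neighbors_def by simp
qed

lemma nearest_neighbors_imp_axis:
  assumes "nearest_neighbors u v"
  shows "\<exists>b s. \<bar>s\<bar> = 1 \<and> v = u + axis b s"
proof -
  have S: "(\<Sum>i\<in>UNIV. \<bar>u $ i - v $ i\<bar>) = 1"
    using assms unfolding nearest_neighbors_def .
  obtain b where b: "u $ b \<noteq> v $ b"
  proof (rule ccontr)
    assume "\<not> thesis"
    then have "\<And>b. u $ b = v $ b" using that by blast
    then show False using S by simp
  qed
  have S': "\<bar>u $ b - v $ b\<bar> + (\<Sum>i\<in>UNIV - {b}. \<bar>u $ i - v $ i\<bar>) = 1"
    using S by (subst (asm) sum.remove[of _ b]) auto
  have nn: "(\<Sum>i\<in>UNIV - {b}. \<bar>u $ i - v $ i\<bar>) \<ge> 0" by (rule sum_nonneg) simp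
  have s1: "\<bar>u $ b - v $ b\<bar> = 1" using S' nn b by linarith
  with S' have "(\<Sum>i\<in>UNIV - {b}. \<bar>u $ i - v $ i\<bar>) = 0" by simp
  then have z: "\<And>i. i \<noteq> b \<Longrightarrow> v $ i = u $ i"
    by (subst (asm) sum_nonneg_eq_0_iff) auto
  have "v = u + axis b (v $ b - u $ b)"
    using z by (auto simp: vec_eq_iff axis_def)
  then show ?thesis using s1 by (intro exI[of _ b] exI[of _ "v $ b - u $ b"]) (simp add: abs_minus_commute)
qed

lemma lattice_edgesI: "nearest_neighbors u v \<Longrightarrow> {u, v} \<in> lattice_edges"
  unfolding lattice_edges_def by auto

lemma path_edges_Nil [simp]: "path_edges [] = {}"
  and path_edges_single [simp]: "path_edges [x] = {}"
  unfolding path_edges_def by auto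

text \<open>Turns the indexed definition into a recursion, so that the facts on path edges follow by
  induction over lists of length 0, 1 and at least 2.\<close>

lemma path_edges_Cons2 [simp]:
  "path_edges (x # y # zs) = insert {x, y} (path_edges (y # zs))"
proof -
  have "i = 0 \<or> (\<exists>j. i = Suc j)" for i :: nat by (cases i) auto
  then have "{i. Suc i < length (x # y # zs)} = insert 0 (Suc ` {i. Suc i < length (y # zs)})"
    by force
  then have "path_edges (x # y # zs) =
      (\<lambda>i. {(x # y # zs) ! i, (x # y # zs) ! Suc i}) ` insert 0 (Suc ` {i. Suc i < length (y # zs)})"
    unfolding path_edges_def image_Collect[symmetric] by (simp add: setcompr_eq_image)
  also have "\<dots> = insert {x, y} (path_edges (y # zs))"
    unfolding path_edges_def image_insert image_image by (auto simp: setcompr_eq_image)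
  finally show ?thesis .
qed

lemma finite_path_edges [simp]: "finite (path_edges \<gamma>)"
  by (induction \<gamma> rule: induct_list012) auto

lemma path_edges_append:
  "xs \<noteq> [] \<Longrightarrow> ys \<noteq> [] \<Longrightarrow>
    path_edges (xs @ ys) = path_edges xs \<union> insert {last xs, hd ys} (path_edges ys)"
proof (induction xs rule: induct_list012)
  case (2 x)
  then show ?case by (cases ys) auto
qed auto

lemma path_edges_append_tl:
  "xs \<noteq> [] \<Longrightarrow> ys \<noteq> [] \<Longrightarrow> last xs = hd ys \<Longrightarrow>
    path_edges (xs @ tl ys) = path_edges xs \<union> path_edges ys"
proof (induction xs rule: induct_list012)
  case (2 x)
  then show ?case by (cases ys) auto
qed auto

lemma path_edges_rev [simp]: "path_edges (rev xs) = path_edges xs"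
proof (induction xs rule: induct_list012)
  case (3 x y zs)
  then show ?case
    using path_edges_append[of "rev (y # zs)" "[x]"] by (simp add: insert_commute last_rev)
qed auto

lemma path_edges_map: "path_edges (map g xs) = (`) g ` path_edges xs"
  by (induction xs rule: induct_list012) auto

lemma path_edges_subset_lattice:
  "successively nearest_neighbors xs \<Longrightarrow> path_edges xs \<subseteq> lattice_edges"
  by (induction xs rule: induct_list012) (auto intro: lattice_edgesI)

lemma lattice_path_edges:
  "\<gamma> \<in> lattice_paths u v \<Longrightarrow> path_edges \<gamma> \<subseteq> lattice_edges"
  unfolding lattice_paths_def using path_edges_subset_lattice by auto

lemma lattice_paths_append:
  assumes "\<gamma> \<in> lattice_paths u v" "\<gamma>' \<in> lattice_paths v w"
  shows "\<gamma> @ tl \<gamma>' \<in> lattice_paths u w" "path_edges (\<gamma> @ tl \<gamma>') = path_edges \<gamma> \<union> path_edges \<gamma>'"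
proof -
  have a: "\<gamma> \<noteq> []" "successively nearest_neighbors \<gamma>" "hd \<gamma> = u" "last \<gamma> = v"
    "\<gamma>' \<noteq> []" "successively nearest_neighbors \<gamma>'" "hd \<gamma>' = v" "last \<gamma>' = w"
    using assms unfolding lattice_paths_def by auto
  obtain zs where zs: "\<gamma>' = v # zs" using a by (cases \<gamma>') auto
  show "path_edges (\<gamma> @ tl \<gamma>') = path_edges \<gamma> \<union> path_edges \<gamma>'"
    using a by (intro path_edges_append_tl) auto
  show "\<gamma> @ tl \<gamma>' \<in> lattice_paths u w"
    using a zs unfolding lattice_paths_def by (auto simp: successively_append_iff successively_Cons)
qed

lemma lattice_paths_rev:
  assumes "\<gamma> \<in> lattice_paths u v" shows "rev \<gamma> \<in> lattice_paths v u"
proof -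
  have "successively (\<lambda>x y. nearest_neighbors y x) \<gamma>"
    using assms successively_mono[of nearest_neighbors \<gamma> "\<lambda>x y. nearest_neighbors y x"]
    by (simp add: lattice_paths_def nearest_neighbors_sym)
  then show ?thesis using assms unfolding lattice_paths_def by (auto simp: hd_rev last_rev)
qed

lemma lattice_paths_map_add:
  assumes "\<gamma> \<in> lattice_paths u v"
  shows "map (\<lambda>q. q + z) \<gamma> \<in> lattice_paths (u + z) (v + z)"
  using assms unfolding lattice_paths_def
  by (auto simp: successively_map hd_map last_map)

lemma lattice_paths_add_eq:
  "lattice_paths (u + z) (v + z) = map (\<lambda>q. q + z) ` lattice_paths u v"
proof (intro equalityI subsetI)
  fix \<gamma> assume "\<gamma> \<in> lattice_paths (u + z) (v + z)"
  then have "map (\<lambda>q. q + - z) \<gamma> \<in> lattice_paths u v"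
    using lattice_paths_map_add[of \<gamma> "u + z" "v + z" "- z"] by simp
  moreover have "\<gamma> = map (\<lambda>q. q + z) (map (\<lambda>q. q + - z) \<gamma>)" by (simp add: o_def)
  ultimately show "\<gamma> \<in> map (\<lambda>q. q + z) ` lattice_paths u v" by blast
qed (auto intro: lattice_paths_map_add)

section \<open>Translations, and connections inside a set of edges\<close>

definition edge_shift :: "int ^ 'n \<Rightarrow> (int ^ 'n) set \<Rightarrow> (int ^ 'n) set" where
  "edge_shift z e = (\<lambda>q. q + z) ` e"

lemma inj_edge_shift: "inj (edge_shift z)"
  unfolding edge_shift_def by (intro injI) (simp add: inj_image_eq_iff)

lemma edge_shift_lattice_edges: "e \<in> lattice_edges \<Longrightarrow> edge_shift z e \<in> lattice_edges"
proof -
  assume "e \<in> lattice_edges"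
  then obtain v w where "nearest_neighbors v w" "e = {v, w}" unfolding lattice_edges_def by auto
  then have "nearest_neighbors (v + z) (w + z)" "edge_shift z e = {v + z, w + z}"
    by (auto simp: edge_shift_def)
  then show ?thesis using lattice_edgesI[of "v + z" "w + z"] by simp
qed

lemma edge_shift_0 [simp]: "edge_shift 0 e = e"
  unfolding edge_shift_def by simp

lemma path_edges_shift: "path_edges (map (\<lambda>q. q + z) \<gamma>) = edge_shift z ` path_edges \<gamma>"
  by (simp add: path_edges_map edge_shift_def[abs_def])

lemma passage_time_shift:
  "passage_time \<sigma> (map (\<lambda>q. q + z) \<gamma>) = passage_time (\<lambda>e. \<sigma> (edge_shift z e)) \<gamma>"
  unfolding passage_time_def path_edges_shift
  by (subst sum.reindex) (auto intro: inj_on_subset[OF inj_edge_shift])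

text \<open>An upper bound on a passage time only has to know which edges some connecting path may
  use. Edge sets can be united and translated without handling vertex lists, and their cardinality
  bounds the number of weights paid.\<close>

definition joins :: "(int ^ 'n) set set \<Rightarrow> int ^ 'n \<Rightarrow> int ^ 'n \<Rightarrow> bool" where
  "joins F u v \<longleftrightarrow> (\<exists>\<gamma>\<in>lattice_paths u v. path_edges \<gamma> \<subseteq> F)"

lemma joins_refl: "joins F u u"
  unfolding joins_def lattice_paths_def by (intro bexI[of _ "[u]"]) auto

lemma joins_edge: "nearest_neighbors u v \<Longrightarrow> joins {{u, v}} u v"
  unfolding joins_def lattice_paths_def by (intro bexI[of _ "[u, v]"]) auto

lemma joins_trans: "joins F u v \<Longrightarrow> joins G v w \<Longrightarrow> joins (F \<union> G) u w"
  unfolding joins_def using lattice_paths_append by blast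

lemma joins_sym: "joins F u v \<Longrightarrow> joins F v u"
  unfolding joins_def using lattice_paths_rev path_edges_rev by metis

lemma joins_shift: "joins F u v \<Longrightarrow> joins (edge_shift z ` F) (u + z) (v + z)"
  unfolding joins_def
  by (metis lattice_paths_map_add path_edges_shift image_mono)

definition norm1 :: "int ^ 'n \<Rightarrow> nat" where
  "norm1 v = nat (\<Sum>i\<in>UNIV. \<bar>v $ i\<bar>)"

lemma joins_norm1:
  "\<exists>F. finite F \<and> F \<subseteq> lattice_edges \<and> card F \<le> norm1 (v - u) \<and> joins F u v"
proof (induction "norm1 (v - u)" arbitrary: v)
  case 0
  then have "(\<Sum>i\<in>UNIV. \<bar>(v - u) $ i\<bar>) \<le> 0" unfolding norm1_def by linarith
  then have "(\<Sum>i\<in>UNIV. \<bar>(v - u) $ i\<bar>) = 0" by (simp add: order_antisym sum_nonneg)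
  then have "v = u" by (subst (asm) sum_nonneg_eq_0_iff) (auto simp: vec_eq_iff)
  then show ?case by (intro exI[of _ "{}"]) (auto intro: joins_refl)
next
  case (Suc k)
  obtain b where b: "v $ b \<noteq> u $ b"
  proof (rule ccontr)
    assume "\<not> thesis"
    then have "\<And>b. v $ b = u $ b" using that by blast
    then show False using Suc(2) unfolding norm1_def by simp
  qed
  \<comment> \<open>Moves \<open>v\<close> one unit towards \<open>u\<close> in a coordinate where
    they differ, so the distance drops by exactly 1.\<close>
  define s where "s = sgn (u $ b - v $ b)"
  have s: "\<bar>s\<bar> = 1" using b unfolding s_def by (simp add: sgn_if)
  define v' where "v' = v + axis b s"
  have "(\<Sum>i\<in>UNIV. \<bar>(v - u) $ i\<bar>) = (\<Sum>i\<in>UNIV. \<bar>(v' - u) $ i\<bar> + (if i = b then 1 else 0))"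
    using b by (intro sum.cong) (auto simp: v'_def axis_def s_def sgn_if abs_if)
  also have "\<dots> = (\<Sum>i\<in>UNIV. \<bar>(v' - u) $ i\<bar>) + 1"
    by (simp add: sum.distrib)
  finally have "norm1 (v - u) = Suc (norm1 (v' - u))"
    unfolding norm1_def by (simp add: sum_nonneg nat_add_distrib del: vector_minus_component)
  with Suc have n: "k = norm1 (v' - u)" by simp
  from Suc(1)[OF n] obtain F where F: "finite F" "F \<subseteq> lattice_edges" "card F \<le> k" "joins F u v'"
    unfolding n by blast
  have nn: "nearest_neighbors v v'" using nearest_neighbors_axis[OF s] unfolding v'_def .
  have "joins {{v, v'}} v' v" using joins_edge[OF nn] by (rule joins_sym)
  then have "joins (F \<union> {{v, v'}}) u v" using F(4) joins_trans by blast
  moreover have "card (F \<union> {{v, v'}}) \<le> Suc k"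
    using card_insert_le_m1[of "Suc k" F "{v, v'}"] F by (simp add: card_insert_if)
  ultimately show ?case using F Suc(2) lattice_edgesI[OF nn]
    by (intro exI[of _ "F \<union> {{v, v'}}"]) auto
qed

lemma lattice_paths_nonempty: "lattice_paths u v \<noteq> {}"
  using joins_norm1[of v u] unfolding joins_def by blast

section \<open>Passage times between lattice points\<close>

definition ptime :: "((int ^ 'n) set \<Rightarrow> real) \<Rightarrow> int ^ 'n \<Rightarrow> int ^ 'n \<Rightarrow> real" where
  "ptime \<sigma> u v = (INF \<gamma>\<in>lattice_paths u v. passage_time \<sigma> \<gamma>)"

lemma first_passage_time_eq_ptime:
  "first_passage_time \<sigma> x y = ptime \<sigma> (floor_vec x) (floor_vec y)"
  unfolding first_passage_time_def ptime_def ..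

lemma ptime_shift: "ptime \<sigma> (u + z) (v + z) = ptime (\<lambda>e. \<sigma> (edge_shift z e)) u v"
  unfolding ptime_def lattice_paths_add_eq image_image passage_time_shift ..

definition nonneg_weights :: "((int ^ 'n) set \<Rightarrow> real) \<Rightarrow> bool" where
  "nonneg_weights \<sigma> \<longleftrightarrow> (\<forall>e\<in>lattice_edges. 0 \<le> \<sigma> e)"

lemma passage_time_nonneg:
  "nonneg_weights \<sigma> \<Longrightarrow> \<gamma> \<in> lattice_paths u v \<Longrightarrow> 0 \<le> passage_time \<sigma> \<gamma>"
  unfolding passage_time_def nonneg_weights_def using lattice_path_edges
  by (intro sum_nonneg) blast

lemma bdd_below_passage_time:
  "nonneg_weights \<sigma> \<Longrightarrow> bdd_below (passage_time \<sigma> ` lattice_paths u v)"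
  using passage_time_nonneg by (intro bdd_belowI2[of _ 0]) auto

lemma ptime_nonneg: "nonneg_weights \<sigma> \<Longrightarrow> 0 \<le> ptime \<sigma> u v"
  unfolding ptime_def using passage_time_nonneg
  by (intro cINF_greatest lattice_paths_nonempty) auto

lemma ptime_le_passage_time:
  "nonneg_weights \<sigma> \<Longrightarrow> \<gamma> \<in> lattice_paths u v \<Longrightarrow> ptime \<sigma> u v \<le> passage_time \<sigma> \<gamma>"
  unfolding ptime_def by (intro cINF_lower bdd_below_passage_time)

lemma ptime_le_sum:
  assumes "nonneg_weights \<sigma>" "joins F u v" "finite F" "F \<subseteq> lattice_edges"
  shows "ptime \<sigma> u v \<le> sum \<sigma> F"
proof -
  obtain \<gamma> where g: "\<gamma> \<in> lattice_paths u v" "path_edges \<gamma> \<subseteq> F"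
    using assms(2) unfolding joins_def by auto
  have "ptime \<sigma> u v \<le> passage_time \<sigma> \<gamma>" using ptime_le_passage_time assms(1) g(1) .
  also have "\<dots> \<le> sum \<sigma> F" unfolding passage_time_def
    using assms g by (intro sum_mono2) (auto simp: nonneg_weights_def)
  finally show ?thesis .
qed

lemma ptime_greatest:
  "(\<And>\<gamma>. \<gamma> \<in> lattice_paths u v \<Longrightarrow> c \<le> passage_time \<sigma> \<gamma>) \<Longrightarrow> c \<le> ptime \<sigma> u v"
  unfolding ptime_def by (intro cINF_greatest lattice_paths_nonempty) auto

text \<open>A concatenated path pays each common edge once, so it saves the weight of the overlap,
  which is nonnegative. The two infima are then taken one after the other.\<close>

lemma ptime_triangle:
  assumes "nonneg_weights \<sigma>"
  shows "ptime \<sigma> u w \<le> ptime \<sigma> u v + ptime \<sigma> v w"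
proof -
  have *: "ptime \<sigma> u w \<le> passage_time \<sigma> \<gamma> + passage_time \<sigma> \<gamma>'"
    if g: "\<gamma> \<in> lattice_paths u v" "\<gamma>' \<in> lattice_paths v w" for \<gamma> \<gamma>'
  proof -
    note ap = lattice_paths_append[OF g]
    have "ptime \<sigma> u w \<le> sum \<sigma> (path_edges \<gamma> \<union> path_edges \<gamma>')"
      using ptime_le_passage_time[OF assms ap(1)] by (simp add: passage_time_def ap(2))
    also have "\<dots> \<le> sum \<sigma> (path_edges \<gamma>) + sum \<sigma> (path_edges \<gamma>')"
    proof -
      have "sum \<sigma> (path_edges \<gamma> \<inter> path_edges \<gamma>') \<ge> 0"
        using lattice_path_edges[OF g(1)] assms unfolding nonneg_weights_def by (intro sum_nonneg) auto
      then show ?thesis using sum.union_inter[of "path_edges \<gamma>" "path_edges \<gamma>'" \<sigma>] by simp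
    qed
    finally show ?thesis by (simp add: passage_time_def)
  qed
  have "ptime \<sigma> u w - passage_time \<sigma> \<gamma> \<le> ptime \<sigma> v w" if "\<gamma> \<in> lattice_paths u v" for \<gamma>
    using *[OF that] by (intro ptime_greatest) (simp add: algebra_simps)
  then have "ptime \<sigma> u w - ptime \<sigma> v w \<le> ptime \<sigma> u v"
    by (intro ptime_greatest) (simp add: algebra_simps)
  then show ?thesis by simp
qed

text \<open>Allows a configuration to be replaced by its restriction to the lattice edges, which is
  the form in which product spaces supply it.\<close>

lemma ptime_cong:
  assumes "\<And>e. e \<in> lattice_edges \<Longrightarrow> \<sigma> e = \<sigma>' e"
  shows "ptime \<sigma> u v = ptime \<sigma>' u v"
  unfolding ptime_def passage_time_def using lattice_path_edges assms
  by (intro INF_cong refl sum.cong) blast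

section \<open>Moments and the time constant\<close>

text \<open>Fekete's lemma for a real parameter and a bounded defect. The defect disappears for
  \<open>g = f + C\<close>, which is subadditive; the linear bound controls \<open>g\<close> on the
  remainder of \<open>t\<close> modulo a nearly optimal step \<open>s\<close>.\<close>

lemma tendsto_subadditive_real:
  fixes f :: "real \<Rightarrow> real"
  assumes nonneg: "\<And>t. t \<ge> 0 \<Longrightarrow> 0 \<le> f t"
    and sub: "\<And>s t. s \<ge> 0 \<Longrightarrow> t \<ge> 0 \<Longrightarrow> f (s + t) \<le> f s + f t + C"
    and lin: "\<And>t. t \<ge> 0 \<Longrightarrow> f t \<le> A + B * t"
    and C: "C \<ge> 0" and B: "B \<ge> 0"
  shows "\<exists>L\<ge>0. ((\<lambda>t. f t / t) \<longlongrightarrow> L) at_top"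
proof -
  define g where "g t = f t + C" for t
  define L where "L = (INF t\<in>{1..}. g t / t)"
  have bdd: "bdd_below ((\<lambda>t. g t / t) ` {1..})"
    by (rule bdd_belowI2[of _ 0]) (auto simp: g_def nonneg C)
  have Lle: "L \<le> g t / t" if "t \<ge> 1" for t
    unfolding L_def using that by (intro cINF_lower[OF bdd]) auto
  have L0: "L \<ge> 0" unfolding L_def by (rule cINF_greatest) (auto simp: g_def nonneg C)
  have gq: "g (real q * s + u) \<le> real q * g s + g u" if "s \<ge> 0" "u \<ge> 0" for q s u
  proof (induction q)
    case (Suc q)
    have "g (real (Suc q) * s + u) = f (s + (real q * s + u)) + C"
      by (simp add: g_def algebra_simps)
    also have "\<dots> \<le> f s + f (real q * s + u) + C + C"
      using sub[of s "real q * s + u"] that by simp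
    also have "\<dots> = g s + g (real q * s + u)" by (simp add: g_def)
    also have "\<dots> \<le> real (Suc q) * g s + g u" using Suc by (simp add: algebra_simps)
    finally show ?case .
  qed simp
  have "((\<lambda>t. f t / t) \<longlongrightarrow> L) at_top"
  proof (rule tendstoI)
    fix e :: real assume e: "e > 0"
    have "\<exists>s\<in>{1..}. g s / s < L + e / 2"
      using cINF_less_iff[OF _ bdd, of "L + e / 2"] e unfolding L_def by auto
    then obtain s where s: "s \<ge> 1" "g s / s < L + e / 2" by auto
    \<comment> \<open>An upper bound for \<open>g\<close> on \<open>[0, s]\<close>, where the
      remainder \<open>u\<close> of \<open>t\<close> lies.\<close>
    define K where "K = A + B * s + C"
    have "\<forall>\<^sub>F t in at_top. t \<ge> max s 1 \<and> t > 2 * \<bar>K\<bar> / e \<and> t > C / e"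
      by (intro eventually_conj eventually_ge_at_top eventually_gt_at_top)
    then show "\<forall>\<^sub>F t in at_top. dist (f t / t) L < e"
    proof eventually_elim
      case (elim t)
      then have t: "t \<ge> s" "t \<ge> 1" "t > 2 * \<bar>K\<bar> / e" "t > C / e" by auto
      define q where "q = nat \<lfloor>t / s\<rfloor>"
      define u where "u = t - real q * s"
      have "t / s \<ge> 0" using t s by simp
      then have q: "real q \<le> t / s" "t / s < real q + 1" unfolding q_def by linarith+
      have u: "0 \<le> u" "u \<le> s" using q s unfolding u_def
        by (auto simp: field_simps)
      have "g t \<le> real q * g s + g u" using gq[of s u q] u s by (simp add: u_def)
      also have "\<dots> \<le> t / s * g s + K"
      proof -
        have "g s \<ge> 0" using nonneg[of s] C s by (simp add: g_def)
        then have "real q * g s \<le> t / s * g s" using q by (intro mult_right_mono) auto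
        moreover have "g u \<le> K" using lin[of u] u B mult_left_mono[OF u(2) B]
          by (simp add: g_def K_def)
        ultimately show ?thesis by simp
      qed
      finally have "g t / t \<le> (t / s * g s + K) / t" using t by (intro divide_right_mono) auto
      also have "\<dots> = g s / s + K / t" using t s by (simp add: field_simps)
      also have "K / t < e / 2" 
      proof -
        have "2 * \<bar>K\<bar> < t * e" using t(3) e by (simp add: field_simps)
        then have "2 * K < t * e" by linarith
        then show ?thesis using t by (simp add: field_simps)
      qed
      finally have up: "g t / t < L + e" using s by simp
      have "f t / t \<le> g t / t" using t C by (intro divide_right_mono) (auto simp: g_def)
      with up have 1: "f t / t < L + e" by simp
      have "f t / t = g t / t - C / t" by (simp add: g_def add_divide_distrib)
      moreover have "C / t < e" using t(2,4) e by (simp add: field_simps)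
      ultimately have "f t / t > L - e" using Lle[OF t(2)] by linarith
      with 1 show ?case by (simp add: dist_real_def abs_less_iff)
    qed
  qed
  with L0 show ?thesis by blast
qed

text \<open>In each coordinate the floor of a sum differs from the sum of the floors by at most 1.
  This rounding is the source of the defect in the subadditivity of the mean passage time.\<close>

lemma norm1_floor_vec_add:
  fixes x :: "real ^ 'n"
  shows "norm1 (floor_vec ((s + t) *\<^sub>R x) - (floor_vec (s *\<^sub>R x) + floor_vec (t *\<^sub>R x))) \<le> CARD('n)"
proof -
  have "(\<Sum>i\<in>UNIV. \<bar>(floor_vec ((s + t) *\<^sub>R x) - (floor_vec (s *\<^sub>R x) + floor_vec (t *\<^sub>R x))) $ i\<bar>)
      \<le> (\<Sum>i\<in>(UNIV::'n set). 1)"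
  proof (rule sum_mono)
    fix i
    have "\<bar>\<lfloor>s * x $ i + t * x $ i\<rfloor> - (\<lfloor>s * x $ i\<rfloor> + \<lfloor>t * x $ i\<rfloor>)\<bar> \<le> 1" by linarith
    then show "\<bar>(floor_vec ((s + t) *\<^sub>R x) - (floor_vec (s *\<^sub>R x) + floor_vec (t *\<^sub>R x))) $ i\<bar> \<le> 1"
      by (simp add: floor_vec_def algebra_simps)
  qed
  then show ?thesis unfolding norm1_def by simp
qed

lemma norm1_floor_vec:
  fixes x :: "real ^ 'n"
  assumes "t \<ge> 0"
  shows "real (norm1 (floor_vec (t *\<^sub>R x))) \<le> CARD('n) + (\<Sum>i\<in>UNIV. \<bar>x $ i\<bar>) * t"
proof -
  have "real (norm1 (floor_vec (t *\<^sub>R x))) = (\<Sum>i\<in>UNIV. \<bar>of_int \<lfloor>t * x $ i\<rfloor>\<bar>)"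
    unfolding norm1_def by (simp add: sum_nonneg floor_vec_def)
  also have "\<dots> \<le> (\<Sum>i\<in>UNIV. 1 + \<bar>x $ i\<bar> * t)"
  proof (rule sum_mono)
    fix i
    have "\<bar>of_int \<lfloor>t * x $ i\<rfloor>\<bar> \<le> 1 + \<bar>t * x $ i\<bar>" by linarith
    then show "\<bar>of_int \<lfloor>t * x $ i\<rfloor>\<bar> \<le> 1 + \<bar>x $ i\<bar> * t" using assms by (simp add: abs_mult mult.commute)
  qed
  also have "\<dots> = CARD('n) + (\<Sum>i\<in>UNIV. \<bar>x $ i\<bar>) * t"
    by (simp add: sum.distrib sum_distrib_right)
  finally show ?thesis .
qed

section \<open>Stretched exponential moments and measurability\<close>

lemma power_le_exp:
  fixes y :: real
  assumes "y \<ge> 0" "k > 0"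
  shows "y ^ k \<le> real k ^ k * exp y"
proof -
  have "y / k \<le> exp (y / k)" using exp_ge_add_one_self[of "y / k"] by linarith
  then have "(y / k) ^ k \<le> exp (y / k) ^ k" using assms by (intro power_mono) auto
  also have "\<dots> = exp y" using assms by (simp add: exp_of_nat_mult[symmetric])
  finally show ?thesis using assms by (simp add: power_divide field_simps)
qed

lemma power_le_exp_powr:
  fixes a r :: real
  assumes "a > 0" "r > 0"
  shows "\<exists>C>0. \<forall>t\<ge>0. t ^ j \<le> C * exp (a * t powr r)"
proof -
  \<comment> \<open>With \<open>r * k > j\<close> one has \<open>t ^ j \<le> (t powr r) ^ k\<close>
    for \<open>t > 1\<close>; smaller \<open>t\<close> are covered by the summand 1 in
    \<open>C\<close>.\<close>
  obtain k :: nat where k: "real k > real j / r" using reals_Archimedean2 by blast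
  then have "real k > 0" using assms by (meson divide_nonneg_pos le_less_trans of_nat_0_le_iff)
  then have k0: "k > 0" by simp
  define C where "C = 1 + (real k / a) ^ k"
  have "t ^ j \<le> C * exp (a * t powr r)" if t: "t \<ge> 0" for t
  proof (cases "t \<le> 1")
    case True
    have "t ^ j \<le> 1" using True t by (intro power_le_one) auto
    also have "\<dots> \<le> C * exp (a * t powr r)"
    proof -
      have "1 * 1 \<le> C * exp (a * t powr r)"
        using assms unfolding C_def by (intro mult_mono) auto
      then show ?thesis by simp
    qed
    finally show ?thesis .
  next
    case False
    then have t1: "t > 1" by simp
    have "t ^ j = t powr real j" using t1 by (simp add: powr_realpow)
    also have "\<dots> \<le> t powr (r * real k)" using t1 k assms by (intro powr_mono) (auto simp: field_simps)
    also have "\<dots> = (t powr r) ^ k" using t1 by (simp add: powr_powr[symmetric] powr_realpow)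
    also have "\<dots> = (a * t powr r) ^ k / a ^ k" using assms by (simp add: power_mult_distrib)
    also have "\<dots> \<le> real k ^ k * exp (a * t powr r) / a ^ k"
      using power_le_exp[of "a * t powr r" k] assms k0 by (intro divide_right_mono) auto
    also have "\<dots> \<le> C * exp (a * t powr r)"
      using assms by (simp add: C_def power_divide algebra_simps)
    finally show ?thesis .
  qed
  moreover have "C > 0" unfolding C_def using assms by (intro add_pos_nonneg) auto
  ultimately show ?thesis by blast
qed

lemma measurable_passage_time_PiM:
  assumes "path_edges \<gamma> \<subseteq> E"
  shows "(\<lambda>\<sigma>. passage_time \<sigma> \<gamma>) \<in> borel_measurable (PiM E (\<lambda>_. borel))"
  unfolding passage_time_def
  using assms by (intro borel_measurable_sum measurable_component_singleton) auto

text \<open>Paths are finite lists over a countable type, so the infimum is a countable one and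
  preserves measurability.\<close>

lemma measurable_ptime_PiM:
  "(\<lambda>\<sigma>. ptime \<sigma> u v) \<in> borel_measurable (PiM lattice_edges (\<lambda>_. borel))"
  unfolding ptime_def
  by (intro borel_measurable_cINF_real measurable_passage_time_PiM lattice_path_edges) auto

text \<open>The single summand at the integer part of \<open>s\<close> already dominates.
  Integrating the whole sum turns an exponential moment into a series of tail probabilities.\<close>

lemma exp_le_step_sum:
  fixes a s :: real
  assumes "s \<ge> 0" "a \<ge> 0"
  shows "ennreal (exp (a * s)) \<le> (\<Sum>k. ennreal (exp (a * (real k + 1))) * indicator {real k..} s)"
proof -
  define k where "k = nat \<lfloor>s\<rfloor>"
  have k: "real k \<le> s" "s \<le> real k + 1" using assms unfolding k_def by linarith+
  have "ennreal (exp (a * s)) \<le> ennreal (exp (a * (real k + 1))) * indicator {real k..} s"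
    using k assms by (auto intro!: ennreal_leI mult_left_mono)
  also have "\<dots> \<le> (\<Sum>k. ennreal (exp (a * (real k + 1))) * indicator {real k..} s)"
    by (rule order_trans[OF _ sum_le_suminf[of _ "{k}"]]) (simp_all only: sum.insert finite.intros sum.empty empty_iff simp_thms add_0_right order_refl zero_le summableI)
  finally show ?thesis .
qed

text \<open>Collects the upper tail bound only; the lower tail bound is passed as a premise to the
  estimates from below.\<close>

locale fpp = prob_space M for M :: "'a measure" +
  fixes \<tau> :: "(int ^ 'n) set \<Rightarrow> 'a \<Rightarrow> real" and \<beta> \<alpha> r :: real
  assumes nonneg: "\<And>e \<omega>. e \<in> lattice_edges \<Longrightarrow> \<omega> \<in> space M \<Longrightarrow> 0 \<le> \<tau> e \<omega>"
    and indep: "indep_vars (\<lambda>_. borel) \<tau> lattice_edges"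
    and ident: "\<And>e f. e \<in> lattice_edges \<Longrightarrow> f \<in> lattice_edges \<Longrightarrow>
      distr M borel (\<tau> e) = distr M borel (\<tau> f)"
    and pos: "\<beta> > 0" "\<alpha> > 0" "0 < r" "r \<le> 1"
    and upper: "\<And>e t. e \<in> lattice_edges \<Longrightarrow> t \<ge> 0 \<Longrightarrow>
      measure M {\<omega> \<in> space M. \<tau> e \<omega> > t} \<le> \<beta> * exp (- \<alpha> * t powr r)"
begin

lemma measurable_weight [measurable]: "e \<in> lattice_edges \<Longrightarrow> \<tau> e \<in> borel_measurable M"
  using indep unfolding indep_vars_def2 by auto

abbreviation T :: "'a \<Rightarrow> int ^ 'n \<Rightarrow> int ^ 'n \<Rightarrow> real" where
  "T \<omega> u v \<equiv> ptime (\<lambda>e. \<tau> e \<omega>) u v"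

lemma nonneg_weights [simp]: "\<omega> \<in> space M \<Longrightarrow> nonneg_weights (\<lambda>e. \<tau> e \<omega>)"
  unfolding nonneg_weights_def using nonneg by auto

lemma measurable_T [measurable]: "(\<lambda>\<omega>. T \<omega> u v) \<in> borel_measurable M"
  unfolding ptime_def passage_time_def
  using lattice_path_edges
  by (intro borel_measurable_cINF_real borel_measurable_sum measurable_weight) auto

lemma exp_moment:
  assumes a: "0 < a" "a < \<alpha>"
  shows "\<exists>C\<ge>1. \<forall>e\<in>lattice_edges. integrable M (\<lambda>\<omega>. exp (a * \<tau> e \<omega> powr r)) \<and>
    expectation (\<lambda>\<omega>. exp (a * \<tau> e \<omega> powr r)) \<le> C"
proof -
  \<comment> \<open>Bounds the integral of the summand at level \<open>k\<close>. For
    \<open>k > 0\<close> the tail is taken at level \<open>k - 1\<close>, which turns the weak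
    inequality \<open>k \<le> \<tau> powr r\<close> into the strict one of the tail bound; level 0
    gets the trivial probability 1. The series is dominated by a geometric one of ratio
    \<open>exp (a - \<alpha>)\<close>.\<close>
  define c where "c k = exp (a * (real k + 1)) * (if k = 0 then 1 else \<beta> * exp (- \<alpha> * (real k - 1)))" for k
  define D where "D = \<beta> * exp (a + \<alpha>)"
  have summ: "summable (\<lambda>k. D * exp (a - \<alpha>) ^ k)"
    using a by (intro summable_mult summable_geometric) auto
  have ck: "c k \<le> D * exp (a - \<alpha>) ^ k" if "k \<noteq> 0" for k
  proof -
    have "c k = \<beta> * exp (a * (real k + 1) + - \<alpha> * (real k - 1))"
      using that by (simp add: c_def exp_add[symmetric])
    also have "a * (real k + 1) + - \<alpha> * (real k - 1) = (a + \<alpha>) + real k * (a - \<alpha>)"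
      by (simp add: algebra_simps)
    also have "\<beta> * exp \<dots> = D * exp (a - \<alpha>) ^ k" by (simp add: D_def exp_add exp_of_nat_mult)
    finally show ?thesis by simp
  qed
  have c0: "c k \<ge> 0" for k using pos by (simp add: c_def)
  have sc: "summable c"
    by (rule summable_comparison_test_ev[OF _ summ])
       (use c0 ck in \<open>auto intro!: eventually_sequentiallyI[of 1]\<close>)
  \<comment> \<open>The maximum with 1 lets later powers of \<open>C\<close> be enlarged by
    enlarging the exponent.\<close>
  define C where "C = max 1 (suminf c)"
  have main: "integrable M (\<lambda>\<omega>. exp (a * \<tau> e \<omega> powr r)) \<and>
    expectation (\<lambda>\<omega>. exp (a * \<tau> e \<omega> powr r)) \<le> C" if e: "e \<in> lattice_edges" for e
  proof -
    have [measurable]: "\<tau> e \<in> borel_measurable M" using e by simp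
    have pk: "emeasure M {\<omega> \<in> space M. real k \<le> \<tau> e \<omega> powr r} \<le>
        ennreal (if k = 0 then 1 else \<beta> * exp (- \<alpha> * (real k - 1)))" for k :: nat
    proof (cases "k = 0")
      case False
      have "{\<omega> \<in> space M. real k \<le> \<tau> e \<omega> powr r} \<subseteq> {\<omega> \<in> space M. \<tau> e \<omega> > (real k - 1) powr (1 / r)}"
      proof safe
        fix \<omega> assume w: "\<omega> \<in> space M" "real k \<le> \<tau> e \<omega> powr r"
        show "(real k - 1) powr (1 / r) < \<tau> e \<omega>"
        proof (rule ccontr)
          assume "\<not> (real k - 1) powr (1 / r) < \<tau> e \<omega>"
          then have "\<tau> e \<omega> powr r \<le> ((real k - 1) powr (1 / r)) powr r"
            using pos nonneg[OF e w(1)] by (intro powr_mono2) auto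
          also have "\<dots> = real k - 1" using False pos by (simp add: powr_powr)
          finally show False using w by simp
        qed
      qed
      then have "measure M {\<omega> \<in> space M. real k \<le> \<tau> e \<omega> powr r}
          \<le> measure M {\<omega> \<in> space M. \<tau> e \<omega> > (real k - 1) powr (1 / r)}"
        by (intro finite_measure_mono) auto
      also have "\<dots> \<le> \<beta> * exp (- \<alpha> * ((real k - 1) powr (1 / r)) powr r)"
        by (rule upper[OF e]) simp
      also have "((real k - 1) powr (1 / r)) powr r = real k - 1"
        using False pos by (simp add: powr_powr)
      finally show ?thesis using False by (simp add: emeasure_eq_measure ennreal_leI)
    qed (simp add: emeasure_eq_measure)
    have "(\<integral>\<^sup>+\<omega>. ennreal (exp (a * \<tau> e \<omega> powr r)) \<partial>M)
        \<le> (\<integral>\<^sup>+\<omega>. (\<Sum>k. ennreal (exp (a * (real k + 1))) * indicator {real k..} (\<tau> e \<omega> powr r)) \<partial>M)"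
      using a by (intro nn_integral_mono exp_le_step_sum) auto
    also have "\<dots> = (\<Sum>k. \<integral>\<^sup>+\<omega>. ennreal (exp (a * (real k + 1))) * indicator {real k..} (\<tau> e \<omega> powr r) \<partial>M)"
      by (rule nn_integral_suminf) simp
    also have "\<dots> \<le> (\<Sum>k. ennreal (c k))"
    proof (intro suminf_le allI)
      fix k :: nat
      have "(\<integral>\<^sup>+\<omega>. ennreal (exp (a * (real k + 1))) * indicator {real k..} (\<tau> e \<omega> powr r) \<partial>M)
         = (\<integral>\<^sup>+\<omega>. ennreal (exp (a * (real k + 1))) * indicator {\<omega> \<in> space M. real k \<le> \<tau> e \<omega> powr r} \<omega> \<partial>M)"
        by (intro nn_integral_cong) (auto simp: indicator_def)
      also have "\<dots> = ennreal (exp (a * (real k + 1))) * emeasure M {\<omega> \<in> space M. real k \<le> \<tau> e \<omega> powr r}"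
        by (rule nn_integral_cmult_indicator) simp
      also have "\<dots> \<le> ennreal (exp (a * (real k + 1))) * ennreal (if k = 0 then 1 else \<beta> * exp (- \<alpha> * (real k - 1)))"
        by (intro mult_left_mono pk) simp
      also have "\<dots> = ennreal (c k)" unfolding c_def using pos by (intro ennreal_mult[symmetric]) auto
      finally show "(\<integral>\<^sup>+\<omega>. ennreal (exp (a * (real k + 1))) * indicator {real k..} (\<tau> e \<omega> powr r) \<partial>M) \<le> ennreal (c k)" .
    qed auto
    also have "\<dots> = ennreal (suminf c)" using sc c0 by (intro suminf_ennreal2) auto
    also have "\<dots> \<le> ennreal C" by (intro ennreal_leI) (simp add: C_def)
    finally have le: "(\<integral>\<^sup>+\<omega>. ennreal (exp (a * \<tau> e \<omega> powr r)) \<partial>M) \<le> ennreal C" .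
    have int: "integrable M (\<lambda>\<omega>. exp (a * \<tau> e \<omega> powr r))"
      by (rule integrableI_bounded) (use le_less_trans[OF le] in auto)
    have "ennreal (expectation (\<lambda>\<omega>. exp (a * \<tau> e \<omega> powr r))) \<le> ennreal C"
      using le nn_integral_eq_integral[OF int] by simp
    then have "expectation (\<lambda>\<omega>. exp (a * \<tau> e \<omega> powr r)) \<le> C"
      by (subst (asm) ennreal_le_iff) (auto simp: C_def)
    with int show ?thesis by simp
  qed
  then show ?thesis by (intro exI[of _ C]) (auto simp: C_def)
qed

lemma power_moment:
  "\<exists>C>0. \<forall>e\<in>lattice_edges. integrable M (\<lambda>\<omega>. \<tau> e \<omega> ^ j) \<and> expectation (\<lambda>\<omega>. \<tau> e \<omega> ^ j) \<le> C"
proof -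
  have a: "0 < \<alpha> / 2" "\<alpha> / 2 < \<alpha>" using pos by auto
  obtain C where C: "C \<ge> 1" "\<And>e. e \<in> lattice_edges \<Longrightarrow> integrable M (\<lambda>\<omega>. exp (\<alpha> / 2 * \<tau> e \<omega> powr r))"
    "\<And>e. e \<in> lattice_edges \<Longrightarrow> expectation (\<lambda>\<omega>. exp (\<alpha> / 2 * \<tau> e \<omega> powr r)) \<le> C"
    using exp_moment[OF a] by blast
  obtain D where D: "D > 0" "\<And>t. t \<ge> 0 \<Longrightarrow> t ^ j \<le> D * exp (\<alpha> / 2 * t powr r)"
    using power_le_exp_powr[OF a(1) pos(3), of j] by blast
  have "integrable M (\<lambda>\<omega>. \<tau> e \<omega> ^ j) \<and> expectation (\<lambda>\<omega>. \<tau> e \<omega> ^ j) \<le> D * C"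
    if e: "e \<in> lattice_edges" for e
  proof
    have [measurable]: "\<tau> e \<in> borel_measurable M" using e by simp
    show int: "integrable M (\<lambda>\<omega>. \<tau> e \<omega> ^ j)"
      by (rule Bochner_Integration.integrable_bound[OF integrable_mult_right[OF C(2)[OF e], of D]])
         (use D nonneg[OF e] in \<open>auto intro!: AE_I2\<close>)
    have "expectation (\<lambda>\<omega>. \<tau> e \<omega> ^ j) \<le> expectation (\<lambda>\<omega>. D * exp (\<alpha> / 2 * \<tau> e \<omega> powr r))"
      using int integrable_mult_right[OF C(2)[OF e], of D] D(2) nonneg[OF e]
      by (intro integral_mono) auto
    also have "\<dots> = D * expectation (\<lambda>\<omega>. exp (\<alpha> / 2 * \<tau> e \<omega> powr r))" by simp
    also have "\<dots> \<le> D * C" using D C(3)[OF e] by (intro mult_left_mono) auto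
    finally show "expectation (\<lambda>\<omega>. \<tau> e \<omega> ^ j) \<le> D * C" .
  qed
  then show ?thesis using D C by (intro exI[of _ "D * C"]) auto
qed

lemma T_bound:
  assumes "\<omega> \<in> space M" "joins F u v" "finite F" "F \<subseteq> lattice_edges"
  shows "0 \<le> T \<omega> u v" "T \<omega> u v \<le> (\<Sum>e\<in>F. \<tau> e \<omega>)"
  using assms ptime_le_sum[OF nonneg_weights] by (auto intro: ptime_nonneg)

text \<open>The second moment is bounded by Cauchy-Schwarz, hence quadratically in the number of
  edges. This is the right order for the second moment argument, which compares it with the square
  of a gap linear in n.\<close>

lemma sum_moments:
  "\<exists>C>0. \<forall>F. finite F \<longrightarrow> F \<subseteq> lattice_edges \<longrightarrow>
     integrable M (\<lambda>\<omega>. \<Sum>e\<in>F. \<tau> e \<omega>) \<and> integrable M (\<lambda>\<omega>. (\<Sum>e\<in>F. \<tau> e \<omega>)\<^sup>2) \<and>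
     expectation (\<lambda>\<omega>. \<Sum>e\<in>F. \<tau> e \<omega>) \<le> C * real (card F) \<and>
     expectation (\<lambda>\<omega>. (\<Sum>e\<in>F. \<tau> e \<omega>)\<^sup>2) \<le> C * (real (card F))\<^sup>2"
proof -
  obtain C1 where C1: "C1 > 0" "\<And>e. e \<in> lattice_edges \<Longrightarrow> integrable M (\<tau> e)"
    "\<And>e. e \<in> lattice_edges \<Longrightarrow> expectation (\<tau> e) \<le> C1"
    using power_moment[of 1] by auto
  obtain C2 where C2: "C2 > 0" "\<And>e. e \<in> lattice_edges \<Longrightarrow> integrable M (\<lambda>\<omega>. (\<tau> e \<omega>)\<^sup>2)"
    "\<And>e. e \<in> lattice_edges \<Longrightarrow> expectation (\<lambda>\<omega>. (\<tau> e \<omega>)\<^sup>2) \<le> C2"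
    using power_moment[of 2] by auto
  define C where "C = max C1 C2"
  have "integrable M (\<lambda>\<omega>. \<Sum>e\<in>F. \<tau> e \<omega>) \<and> integrable M (\<lambda>\<omega>. (\<Sum>e\<in>F. \<tau> e \<omega>)\<^sup>2) \<and>
     expectation (\<lambda>\<omega>. \<Sum>e\<in>F. \<tau> e \<omega>) \<le> C * real (card F) \<and>
     expectation (\<lambda>\<omega>. (\<Sum>e\<in>F. \<tau> e \<omega>)\<^sup>2) \<le> C * (real (card F))\<^sup>2"
    if F: "finite F" "F \<subseteq> lattice_edges" for F
  proof -
    have i1: "integrable M (\<lambda>\<omega>. \<Sum>e\<in>F. \<tau> e \<omega>)" using F C1 by auto
    have i2: "integrable M (\<lambda>\<omega>. real (card F) * (\<Sum>e\<in>F. (\<tau> e \<omega>)\<^sup>2))"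
      using F C2(2) by (intro integrable_mult_right Bochner_Integration.integrable_sum) auto
    have sq: "(\<Sum>e\<in>F. \<tau> e \<omega>)\<^sup>2 \<le> real (card F) * (\<Sum>e\<in>F. (\<tau> e \<omega>)\<^sup>2)" for \<omega>
      using sum_squared_le_sum_of_squares[of "\<lambda>e. \<tau> e \<omega>" F]
      by (cases "finite F \<and> F \<noteq> {}") (auto simp: mult.commute)
    have i2': "integrable M (\<lambda>\<omega>. (\<Sum>e\<in>F. \<tau> e \<omega>)\<^sup>2)"
    proof (rule Bochner_Integration.integrable_bound[OF i2])
      show "(\<lambda>\<omega>. (\<Sum>e\<in>F. \<tau> e \<omega>)\<^sup>2) \<in> borel_measurable M"
        using i1 by (intro borel_measurable_power) auto
    qed (use order_trans[OF sq abs_ge_self] in \<open>auto intro!: AE_I2\<close>)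
    have "expectation (\<lambda>\<omega>. \<Sum>e\<in>F. \<tau> e \<omega>) = (\<Sum>e\<in>F. expectation (\<tau> e))"
      using F C1 by (intro Bochner_Integration.integral_sum) auto
    also have "\<dots> \<le> (\<Sum>e\<in>F. C)" using F C1 unfolding C_def
      by (intro sum_mono) (auto intro: le_max_iff_disj[THEN iffD2])
    finally have e1: "expectation (\<lambda>\<omega>. \<Sum>e\<in>F. \<tau> e \<omega>) \<le> C * real (card F)" by (simp add: mult.commute)
    have "expectation (\<lambda>\<omega>. (\<Sum>e\<in>F. \<tau> e \<omega>)\<^sup>2) \<le> expectation (\<lambda>\<omega>. real (card F) * (\<Sum>e\<in>F. (\<tau> e \<omega>)\<^sup>2))"
      using i2 i2' sq by (intro integral_mono) auto
    also have "\<dots> = real (card F) * (\<Sum>e\<in>F. expectation (\<lambda>\<omega>. (\<tau> e \<omega>)\<^sup>2))"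
      using F C2 by (subst integral_mult_right_zero, subst Bochner_Integration.integral_sum) auto
    also have "\<dots> \<le> real (card F) * (\<Sum>e\<in>F. C)" using F C2 unfolding C_def
      by (intro mult_left_mono sum_mono) (auto intro: le_max_iff_disj[THEN iffD2])
    also have "\<dots> = C * (real (card F))\<^sup>2" by (simp add: power2_eq_square)
    finally show ?thesis using i1 i2' e1 by simp
  qed
  then show ?thesis using C1 by (intro exI[of _ C]) (auto simp: C_def)
qed

lemma T_moments:
  "\<exists>C>0. \<forall>u v. integrable M (\<lambda>\<omega>. T \<omega> u v) \<and> integrable M (\<lambda>\<omega>. (T \<omega> u v)\<^sup>2) \<and>
     expectation (\<lambda>\<omega>. T \<omega> u v) \<le> C * real (norm1 (v - u)) \<and>
     expectation (\<lambda>\<omega>. (T \<omega> u v)\<^sup>2) \<le> C * (real (norm1 (v - u)))\<^sup>2"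
proof -
  obtain C where C: "C > 0" and sums: "\<And>F. finite F \<Longrightarrow> F \<subseteq> lattice_edges \<Longrightarrow>
     integrable M (\<lambda>\<omega>. \<Sum>e\<in>F. \<tau> e \<omega>) \<and> integrable M (\<lambda>\<omega>. (\<Sum>e\<in>F. \<tau> e \<omega>)\<^sup>2) \<and>
     expectation (\<lambda>\<omega>. \<Sum>e\<in>F. \<tau> e \<omega>) \<le> C * real (card F) \<and>
     expectation (\<lambda>\<omega>. (\<Sum>e\<in>F. \<tau> e \<omega>)\<^sup>2) \<le> C * (real (card F))\<^sup>2"
    using sum_moments by blast
  have "integrable M (\<lambda>\<omega>. T \<omega> u v) \<and> integrable M (\<lambda>\<omega>. (T \<omega> u v)\<^sup>2) \<and>
     expectation (\<lambda>\<omega>. T \<omega> u v) \<le> C * real (norm1 (v - u)) \<and>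
     expectation (\<lambda>\<omega>. (T \<omega> u v)\<^sup>2) \<le> C * (real (norm1 (v - u)))\<^sup>2" for u v
  proof -
    obtain F where F: "finite F" "F \<subseteq> lattice_edges" "card F \<le> norm1 (v - u)" "joins F u v"
      using joins_norm1[of v u] by blast
    note bd = T_bound[OF _ F(4,1,2)] and m = sums[OF F(1,2)]
    have sq: "(T \<omega> u v)\<^sup>2 \<le> (\<Sum>e\<in>F. \<tau> e \<omega>)\<^sup>2" if "\<omega> \<in> space M" for \<omega>
      using bd[OF that] by (intro power_mono)
    have i1: "integrable M (\<lambda>\<omega>. T \<omega> u v)"
      by (rule Bochner_Integration.integrable_bound[OF m[THEN conjunct1]])
         (use bd order_trans[OF bd(2) abs_ge_self] in \<open>auto intro!: AE_I2\<close>)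
    have i2: "integrable M (\<lambda>\<omega>. (T \<omega> u v)\<^sup>2)"
      by (rule Bochner_Integration.integrable_bound[OF m[THEN conjunct2, THEN conjunct1]])
         (use sq in \<open>auto intro!: AE_I2\<close>)
    have "expectation (\<lambda>\<omega>. T \<omega> u v) \<le> expectation (\<lambda>\<omega>. \<Sum>e\<in>F. \<tau> e \<omega>)"
      using i1 m bd by (intro integral_mono) auto
    also have "\<dots> \<le> C * real (card F)" using m by blast
    also have "\<dots> \<le> C * real (norm1 (v - u))" using F(3) C by (intro mult_left_mono) auto
    finally have e1: "expectation (\<lambda>\<omega>. T \<omega> u v) \<le> C * real (norm1 (v - u))" .
    have "expectation (\<lambda>\<omega>. (T \<omega> u v)\<^sup>2) \<le> expectation (\<lambda>\<omega>. (\<Sum>e\<in>F. \<tau> e \<omega>)\<^sup>2)"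
      using i2 m sq by (intro integral_mono) auto
    also have "\<dots> \<le> C * (real (card F))\<^sup>2" using m by blast
    also have "\<dots> \<le> C * (real (norm1 (v - u)))\<^sup>2" using F(3) C by (intro mult_left_mono power_mono) auto
    finally show ?thesis using i1 i2 e1 by simp
  qed
  then show ?thesis using C by blast
qed

lemma integrable_T [simp]: "integrable M (\<lambda>\<omega>. T \<omega> u v)"
  using T_moments by blast

section \<open>Stationarity and the mean passage time\<close>

lemma lattice_edges_nonempty: "(lattice_edges :: (int ^ 'n) set set) \<noteq> {}"
  using lattice_edgesI[OF nearest_neighbors_axis[of 1 0 undefined]] by auto

text \<open>The joint law of the weights is a power of one measure, hence unchanged by an injective
  relabelling of the edges.\<close>

lemma distr_reindex:
  assumes \<phi>: "inj_on \<phi> lattice_edges" "\<And>e. e \<in> lattice_edges \<Longrightarrow> \<phi> e \<in> lattice_edges"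
  shows "distr M (PiM lattice_edges (\<lambda>_. borel)) (\<lambda>\<omega>. \<lambda>e\<in>lattice_edges. \<tau> (\<phi> e) \<omega>) =
    distr M (PiM lattice_edges (\<lambda>_. borel)) (\<lambda>\<omega>. \<lambda>e\<in>lattice_edges. \<tau> e \<omega>)"
proof -
  let ?E = "lattice_edges :: (int ^ 'n) set set"
  let ?P = "PiM ?E (\<lambda>_. borel :: real measure)"
  obtain e0 where e0: "e0 \<in> ?E" using lattice_edges_nonempty by auto
  define \<nu> where "\<nu> = distr M borel (\<tau> e0)"
  have \<nu>: "distr M borel (\<tau> e) = \<nu>" if "e \<in> ?E" for e unfolding \<nu>_def using ident e0 that by blast
  have ps: "prob_space \<nu>" unfolding \<nu>_def using e0 by (intro prob_space_distr) simp
  have D: "distr M ?P (\<lambda>\<omega>. \<lambda>e\<in>?E. \<tau> e \<omega>) = PiM ?E (\<lambda>_. \<nu>)"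
    using indep_vars_iff_distr_eq_PiM'[of ?E \<tau> "\<lambda>_. borel"] indep lattice_edges_nonempty
    by (simp add: \<nu> cong: PiM_cong)
  have sets: "sets (PiM ?E (\<lambda>_. \<nu>)) = sets ?P" by (intro sets_PiM_cong) (auto simp: \<nu>_def)
  have m1: "(\<lambda>\<omega>. \<lambda>e\<in>?E. \<tau> e \<omega>) \<in> measurable M ?P"
    by (intro measurable_restrict) simp
  have m2: "(\<lambda>\<sigma>. \<lambda>e\<in>?E. \<sigma> (\<phi> e)) \<in> measurable ?P ?P"
    using \<phi>(2) by (intro measurable_restrict measurable_component_singleton) auto
  have "PiM ?E (\<lambda>_. \<nu>) = distr (PiM ?E (\<lambda>_. \<nu>)) (PiM ?E (\<lambda>_. \<nu>)) (\<lambda>\<sigma>. \<lambda>e\<in>?E. \<sigma> (\<phi> e))"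
    using distr_PiM_reindex[of ?E "\<lambda>_. \<nu>" \<phi> ?E] ps \<phi> by auto
  also have "\<dots> = distr (PiM ?E (\<lambda>_. \<nu>)) ?P (\<lambda>\<sigma>. \<lambda>e\<in>?E. \<sigma> (\<phi> e))"
    by (rule distr_cong) (auto simp: sets)
  also have "\<dots> = distr (distr M ?P (\<lambda>\<omega>. \<lambda>e\<in>?E. \<tau> e \<omega>)) ?P (\<lambda>\<sigma>. \<lambda>e\<in>?E. \<sigma> (\<phi> e))"
    by (simp only: D)
  also have "\<dots> = distr M ?P ((\<lambda>\<sigma>. \<lambda>e\<in>?E. \<sigma> (\<phi> e)) \<circ> (\<lambda>\<omega>. \<lambda>e\<in>?E. \<tau> e \<omega>))"
    by (rule distr_distr[OF m2 m1])
  also have "((\<lambda>\<sigma>. \<lambda>e\<in>?E. \<sigma> (\<phi> e)) \<circ> (\<lambda>\<omega>. \<lambda>e\<in>?E. \<tau> e \<omega>)) = (\<lambda>\<omega>. \<lambda>e\<in>?E. \<tau> (\<phi> e) \<omega>)"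
    using \<phi>(2) by (auto simp: fun_eq_iff)
  finally show ?thesis unfolding D ..
qed

text \<open>The law on the product space only sees weights of lattice edges; \<open>cong\<close>
  says that \<open>f\<close> sees no more than that, so it may be evaluated on restricted
  configurations.\<close>

lemma expectation_shift:
  assumes f: "f \<in> borel_measurable (PiM lattice_edges (\<lambda>_. borel))"
    and cong: "\<And>\<sigma> \<sigma>'. (\<And>e. e \<in> lattice_edges \<Longrightarrow> \<sigma> e = \<sigma>' e) \<Longrightarrow> f \<sigma> = f \<sigma>'"
  shows "expectation (\<lambda>\<omega>. f (\<lambda>e. \<tau> (edge_shift z e) \<omega>)) = (expectation (\<lambda>\<omega>. f (\<lambda>e. \<tau> e \<omega>)) :: real)"
proof -
  let ?E = "lattice_edges :: (int ^ 'n) set set"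
  let ?P = "PiM ?E (\<lambda>_. borel :: real measure)"
  have m1: "(\<lambda>\<omega>. \<lambda>e\<in>?E. \<tau> e \<omega>) \<in> measurable M ?P"
    by (intro measurable_restrict) simp
  have m2: "(\<lambda>\<omega>. \<lambda>e\<in>?E. \<tau> (edge_shift z e) \<omega>) \<in> measurable M ?P"
    by (intro measurable_restrict measurable_weight edge_shift_lattice_edges)
  have "expectation (\<lambda>\<omega>. f (\<lambda>e. \<tau> (edge_shift z e) \<omega>)) =
      expectation (\<lambda>\<omega>. f (\<lambda>e\<in>?E. \<tau> (edge_shift z e) \<omega>))"
    by (intro Bochner_Integration.integral_cong refl cong) simp
  also have "\<dots> = integral\<^sup>L (distr M ?P (\<lambda>\<omega>. \<lambda>e\<in>?E. \<tau> (edge_shift z e) \<omega>)) f"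
    by (rule integral_distr[OF m2 f, symmetric])
  also have "\<dots> = integral\<^sup>L (distr M ?P (\<lambda>\<omega>. \<lambda>e\<in>?E. \<tau> e \<omega>)) f"
    by (subst distr_reindex) (auto intro: inj_on_subset[OF inj_edge_shift] edge_shift_lattice_edges)
  also have "\<dots> = expectation (\<lambda>\<omega>. f (\<lambda>e\<in>?E. \<tau> e \<omega>))"
    by (rule integral_distr[OF m1 f])
  also have "\<dots> = expectation (\<lambda>\<omega>. f (\<lambda>e. \<tau> e \<omega>))"
    by (intro Bochner_Integration.integral_cong refl cong) simp
  finally show ?thesis .
qed

lemma expectation_T_shift:
  "expectation (\<lambda>\<omega>. T \<omega> (u + z) (v + z)) = expectation (\<lambda>\<omega>. T \<omega> u v)"
  unfolding ptime_shift
  by (rule expectation_shift[OF measurable_ptime_PiM]) (rule ptime_cong)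

lemma expectation_T_triangle:
  "expectation (\<lambda>\<omega>. T \<omega> u w) \<le> expectation (\<lambda>\<omega>. T \<omega> u v) + expectation (\<lambda>\<omega>. T \<omega> v w)"
proof -
  have "expectation (\<lambda>\<omega>. T \<omega> u w) \<le> expectation (\<lambda>\<omega>. T \<omega> u v + T \<omega> v w)"
    by (intro integral_mono) (auto intro: ptime_triangle)
  then show ?thesis by simp
qed

abbreviation meanT :: "real ^ 'n \<Rightarrow> real \<Rightarrow> real" where
  "meanT x t \<equiv> expectation (\<lambda>\<omega>. T \<omega> 0 (floor_vec (t *\<^sub>R x)))"

text \<open>The route to \<open>p (s + t)\<close> goes through \<open>p s\<close>, then follows a
  translate of the route to \<open>p t\<close>, and finally corrects the rounding at bounded mean
  cost. The resulting limit shows that the \<open>Lim\<close> in \<open>time_constant\<close> is a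
  genuine one.\<close>

lemma mean_tendsto_time_constant:
  "((\<lambda>t. meanT x t / t) \<longlongrightarrow> time_constant M \<tau> x) at_top" "time_constant M \<tau> x \<ge> 0"
proof -
  obtain C where C: "C > 0" "\<And>u v. expectation (\<lambda>\<omega>. T \<omega> u v) \<le> C * real (norm1 (v - u))"
    using T_moments by blast
  define p where "p t = floor_vec (t *\<^sub>R x)" for t
  have sub: "meanT x (s + t) \<le> meanT x s + meanT x t + C * real CARD('n)" for s t
  proof -
    have "expectation (\<lambda>\<omega>. T \<omega> 0 (p (s + t))) \<le> expectation (\<lambda>\<omega>. T \<omega> 0 (p s)) +
       expectation (\<lambda>\<omega>. T \<omega> (0 + p s) (p t + p s)) + expectation (\<lambda>\<omega>. T \<omega> (p s + p t) (p (s + t)))"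
      using expectation_T_triangle[of 0 "p (s + t)" "p s"]
        expectation_T_triangle[of "p s" "p (s + t)" "p s + p t"] by (simp add: add.commute)
    also have "\<dots> = expectation (\<lambda>\<omega>. T \<omega> 0 (p s)) + expectation (\<lambda>\<omega>. T \<omega> 0 (p t))
        + expectation (\<lambda>\<omega>. T \<omega> (p s + p t) (p (s + t)))"
      by (simp only: expectation_T_shift)
    also have "expectation (\<lambda>\<omega>. T \<omega> (p s + p t) (p (s + t))) \<le> C * real CARD('n)"
    proof -
      have "C * real (norm1 (p (s + t) - (p s + p t))) \<le> C * real CARD('n)"
        using C(1) norm1_floor_vec_add[of s t x] unfolding p_def by (intro mult_left_mono) auto
      then show ?thesis using C(2)[of "p s + p t" "p (s + t)"] by linarith
    qed
    finally show ?thesis unfolding p_def by simp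
  qed
  have "\<exists>L\<ge>0. ((\<lambda>t. meanT x t / t) \<longlongrightarrow> L) at_top"
  proof (rule tendsto_subadditive_real[where C = "C * real CARD('n)" and A = "C * real CARD('n)"
        and B = "C * (\<Sum>i\<in>UNIV. \<bar>x $ i\<bar>)"])
    fix t :: real assume t: "t \<ge> 0"
    show "0 \<le> meanT x t" by (intro Bochner_Integration.integral_nonneg ptime_nonneg) simp
    have "meanT x t \<le> C * real (norm1 (p t))" using C(2)[of 0 "p t"] by (simp add: p_def)
    also have "\<dots> \<le> C * (real CARD('n) + (\<Sum>i\<in>UNIV. \<bar>x $ i\<bar>) * t)"
      using norm1_floor_vec[OF t, of x] C(1) unfolding p_def by (intro mult_left_mono) auto
    finally show "meanT x t \<le> C * real CARD('n) + C * (\<Sum>i\<in>UNIV. \<bar>x $ i\<bar>) * t" by (simp add: algebra_simps)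
  qed (use sub C in \<open>auto intro!: mult_nonneg_nonneg sum_nonneg\<close>)
  then obtain L where L: "L \<ge> 0" "((\<lambda>t. meanT x t / t) \<longlongrightarrow> L) at_top" by blast
  have f0: "floor_vec (0 :: real ^ 'n) = 0" by (simp add: floor_vec_def vec_eq_iff)
  have "time_constant M \<tau> x = L"
    unfolding time_constant_def first_passage_time_eq_ptime f0
    using L(2) by (intro tendsto_Lim) auto
  with L show "((\<lambda>t. meanT x t / t) \<longlongrightarrow> time_constant M \<tau> x) at_top" "time_constant M \<tau> x \<ge> 0" by auto
qed

end

section \<open>Lower bound\<close>

definition star :: "(int ^ 'n) set set" where
  "star = {e \<in> lattice_edges. 0 \<in> e}"

lemma finite_star: "finite (star :: (int ^ 'n) set set)"
  and card_star: "card (star :: (int ^ 'n) set set) \<le> 2 * CARD('n)"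
proof -
  let ?A = "(\<lambda>(b, s). {0, axis b s :: int ^ 'n}) ` (UNIV \<times> {1, - 1})"
  have sub: "star \<subseteq> ?A"
  proof
    fix e :: "(int ^ 'n) set" assume "e \<in> star"
    then obtain v w where vw: "nearest_neighbors v w" "e = {v, w}" "0 \<in> e"
      unfolding star_def lattice_edges_def by auto
    obtain u where u: "nearest_neighbors 0 u" "e = {0, u}"
    proof (cases "v = 0")
      case True then show ?thesis using that vw by auto
    next
      case False
      then have "w = 0" using vw by auto
      then show ?thesis using that[of v] vw nearest_neighbors_sym by auto
    qed
    obtain b s where "\<bar>s\<bar> = 1" "u = 0 + axis b s" using nearest_neighbors_imp_axis[OF u(1)] by blast
    then show "e \<in> ?A" using u(2) by (auto intro!: image_eqI[of _ _ "(b, s)"])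
  qed
  have fin: "finite ?A" by simp
  show "finite (star :: (int ^ 'n) set set)" using finite_subset[OF sub fin] .
  have "card (star :: (int ^ 'n) set set) \<le> card ?A" using card_mono[OF fin sub] .
  also have "\<dots> \<le> card ((UNIV :: 'n set) \<times> {1, - 1 :: int})" by (rule card_image_le) simp
  also have "\<dots> = 2 * CARD('n)" by (simp add: card_cartesian_product)
  finally show "card (star :: (int ^ 'n) set set) \<le> 2 * CARD('n)" .
qed

lemma star_nonempty: "(star :: (int ^ 'n) set set) \<noteq> {}"
  using lattice_edgesI[OF nearest_neighbors_axis[of 1 0 undefined]] unfolding star_def by auto

text \<open>Setting the weights at the origin to 0, rather than deleting the edges, leaves the set
  of paths unchanged and yields a functional of the remaining weights, hence one independent of the
  star.\<close>

definition unstar :: "((int ^ 'n) set \<Rightarrow> real) \<Rightarrow> (int ^ 'n) set \<Rightarrow> real" where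
  "unstar \<sigma> e = (if 0 \<in> e then 0 else \<sigma> e)"

lemma nonneg_unstar: "nonneg_weights \<sigma> \<Longrightarrow> nonneg_weights (unstar \<sigma>)"
  unfolding nonneg_weights_def unstar_def by auto

text \<open>As \<open>p\<close> is not the origin, a path has a first edge. It lies in the star,
  costs at least \<open>h\<close> under \<open>\<sigma>\<close>, and is free under
  \<open>unstar \<sigma>\<close>.\<close>

lemma ptime_ge_unstar:
  assumes "nonneg_weights \<sigma>" "p \<noteq> 0" "\<And>e. e \<in> star \<Longrightarrow> h \<le> \<sigma> e"
  shows "ptime (unstar \<sigma>) 0 p + h \<le> ptime \<sigma> 0 p"
proof (rule ptime_greatest)
  fix \<gamma> assume g: "\<gamma> \<in> lattice_paths 0 p"
  note sub = lattice_path_edges[OF g]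
  \<comment> \<open>\<open>remdups_adj.cases\<close> serves as the case split of a list into empty,
    singleton and longer.\<close>
  obtain y zs where \<gamma>: "\<gamma> = 0 # y # zs"
  proof (cases \<gamma> rule: remdups_adj.cases)
    case 1 then show ?thesis using g unfolding lattice_paths_def by auto
  next
    case (2 x) then show ?thesis using g assms(2) unfolding lattice_paths_def by auto
  next
    case (3 x y zs) then show ?thesis using that g unfolding lattice_paths_def by auto
  qed
  have e: "{0, y} \<in> path_edges \<gamma>" unfolding \<gamma> by simp
  then have "{0, y} \<in> star" using sub unfolding star_def by auto
  then have "h \<le> \<sigma> {0, y}" using assms by blast
  also have "\<dots> = \<sigma> {0, y} - unstar \<sigma> {0, y}" by (simp add: unstar_def)
  also have "\<dots> \<le> (\<Sum>e\<in>path_edges \<gamma>. \<sigma> e - unstar \<sigma> e)"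
    using e sub assms(1) by (intro member_le_sum) (auto simp: unstar_def nonneg_weights_def)
  also have "\<dots> = passage_time \<sigma> \<gamma> - passage_time (unstar \<sigma>) \<gamma>"
    by (simp add: passage_time_def sum_subtractf)
  also have "\<dots> \<le> passage_time \<sigma> \<gamma> - ptime (unstar \<sigma>) 0 p"
    using ptime_le_passage_time[OF nonneg_unstar[OF assms(1)] g] by simp
  finally show "ptime (unstar \<sigma>) 0 p + h \<le> passage_time \<sigma> \<gamma>" by simp
qed

text \<open>Clearing the star lowers a passage time by at most a sum with finite mean, so the mean
  grows at the same linear rate.\<close>

lemma ptime_le_unstar:
  assumes "nonneg_weights \<sigma>"
  shows "ptime \<sigma> u v \<le> ptime (unstar \<sigma>) u v + sum \<sigma> star"
proof -
  have "ptime \<sigma> u v - sum \<sigma> star \<le> ptime (unstar \<sigma>) u v"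
  proof (rule ptime_greatest)
    fix \<gamma> assume g: "\<gamma> \<in> lattice_paths u v"
    note sub = lattice_path_edges[OF g]
    have "ptime \<sigma> u v \<le> passage_time \<sigma> \<gamma>" using ptime_le_passage_time[OF assms g] .
    also have "\<dots> = (\<Sum>e\<in>path_edges \<gamma>. unstar \<sigma> e) + (\<Sum>e\<in>path_edges \<gamma>. \<sigma> e - unstar \<sigma> e)"
      by (simp add: passage_time_def sum_subtractf)
    also have "(\<Sum>e\<in>path_edges \<gamma>. \<sigma> e - unstar \<sigma> e) = (\<Sum>e\<in>path_edges \<gamma> \<inter> star. \<sigma> e)"
      using sub by (intro sum.mono_neutral_cong_right) (auto simp: unstar_def star_def)
    also have "\<dots> \<le> sum \<sigma> star"
      using assms finite_star by (intro sum_mono2) (auto simp: nonneg_weights_def star_def)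
    finally show "ptime \<sigma> u v - sum \<sigma> star \<le> passage_time (unstar \<sigma>) \<gamma>" by (simp add: passage_time_def)
  qed
  then show ?thesis by simp
qed

lemma ptime_unstar_le:
  assumes "nonneg_weights \<sigma>"
  shows "ptime (unstar \<sigma>) u v \<le> ptime \<sigma> u v"
proof (rule ptime_greatest)
  fix \<gamma> assume g: "\<gamma> \<in> lattice_paths u v"
  have "ptime (unstar \<sigma>) u v \<le> passage_time (unstar \<sigma>) \<gamma>"
    using ptime_le_passage_time[OF nonneg_unstar[OF assms] g] .
  also have "\<dots> \<le> passage_time \<sigma> \<gamma>" unfolding passage_time_def
    using lattice_path_edges[OF g] assms by (intro sum_mono) (auto simp: unstar_def nonneg_weights_def)
  finally show "ptime (unstar \<sigma>) u v \<le> passage_time \<sigma> \<gamma>" .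
qed

text \<open>Applied with \<open>k = 1\<close> to keep the endpoint away from the origin, and with
  \<open>k = 4\<close> to keep the routes around the two endpoints apart.\<close>

lemma eventually_floor_vec_nonzero:
  assumes "x $ a \<noteq> 0"
  shows "eventually (\<lambda>n::nat. \<bar>floor_vec (real n *\<^sub>R x) $ a\<bar> \<ge> k) sequentially"
proof -
  obtain N :: nat where N: "real N > (\<bar>real_of_int k\<bar> + 1) / \<bar>x $ a\<bar>" using reals_Archimedean2 by blast
  show ?thesis
  proof (rule eventually_sequentiallyI)
    fix n assume "n \<ge> N"
    then have "real n > (\<bar>real_of_int k\<bar> + 1) / \<bar>x $ a\<bar>" using N by linarith
    then have "\<bar>real n * x $ a\<bar> > \<bar>real_of_int k\<bar> + 1" using assms by (simp add: field_simps abs_mult)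
    then show "\<bar>floor_vec (real n *\<^sub>R x) $ a\<bar> \<ge> k" by (simp add: floor_vec_def) linarith
  qed
qed

text \<open>A variant of the Paley-Zygmund inequality. Above the threshold
  \<open>Y \<le> \<eta> * Y^2 + 1 / (4 * \<eta>)\<close> by the arithmetic-geometric mean
  inequality, below it \<open>Y \<le> \<theta>\<close>; taking expectations isolates the
  probability.\<close>

lemma (in prob_space) second_moment_lower_tail:
  assumes Y: "integrable M Y" "integrable M (\<lambda>\<omega>. (Y \<omega>)\<^sup>2)"
    and m: "\<theta> + \<delta> \<le> expectation Y" "0 \<le> \<theta>" "0 < \<delta>"
    and G: "expectation (\<lambda>\<omega>. (Y \<omega>)\<^sup>2) \<le> G" "0 < G"
  shows "\<delta>\<^sup>2 / G \<le> prob {\<omega> \<in> space M. Y \<omega> > \<theta>}"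
proof -
  let ?B = "{\<omega> \<in> space M. Y \<omega> > \<theta>}"
  have [measurable]: "Y \<in> borel_measurable M" using Y by auto
  have B: "?B \<in> events" by measurable
  \<comment> \<open>With this value the second moment uses up half of the gap
    \<open>\<delta>\<close>, and the event has to account for the other half.\<close>
  define \<eta> where "\<eta> = \<delta> / (2 * G)"
  have \<eta>: "\<eta> > 0" using m G by (simp add: \<eta>_def)
  have iB: "integrable M (\<lambda>\<omega>. indicator ?B \<omega> / (4 * \<eta>) :: real)" 
    using integrable_real_indicator[OF B] by (intro integrable_divide_zero) (simp add: less_top[symmetric])
  have "expectation Y \<le> expectation (\<lambda>\<omega>. \<theta> + (\<eta> * (Y \<omega>)\<^sup>2 + indicator ?B \<omega> / (4 * \<eta>)))"
  proof (rule integral_mono)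
    fix \<omega> assume w: "\<omega> \<in> space M"
    show "Y \<omega> \<le> \<theta> + (\<eta> * (Y \<omega>)\<^sup>2 + indicator ?B \<omega> / (4 * \<eta>))"
    proof (cases "Y \<omega> > \<theta>")
      case True
      have "0 \<le> (2 * \<eta> * Y \<omega> - 1)\<^sup>2 / (4 * \<eta>)" using \<eta> by simp
      also have "\<dots> = \<eta> * (Y \<omega>)\<^sup>2 + 1 / (4 * \<eta>) - Y \<omega>" using \<eta> by (simp add: power2_eq_square field_simps)
      finally show ?thesis using True w m by simp
    next
      case False
      have "0 \<le> \<eta> * (Y \<omega>)\<^sup>2" using \<eta> by simp
      then show ?thesis using False by simp
    qed
  qed (use Y iB in auto)
  also have "\<dots> = \<theta> + (\<eta> * expectation (\<lambda>\<omega>. (Y \<omega>)\<^sup>2) + prob ?B / (4 * \<eta>))"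
    using Y iB B by (simp add: prob_space)
  also have "\<dots> \<le> \<theta> + (\<eta> * G + prob ?B / (4 * \<eta>))" using G \<eta> by (intro add_left_mono add_right_mono mult_left_mono) auto
  finally have "\<delta> \<le> \<eta> * G + prob ?B / (4 * \<eta>)" using m by simp
  also have "\<eta> * G = \<delta> / 2" using G by (simp add: \<eta>_def)
  also have "prob ?B / (4 * \<eta>) = prob ?B * G / (2 * \<delta>)" using G m by (simp add: \<eta>_def field_simps)
  finally show ?thesis using G m by (simp add: field_simps power2_eq_square)
qed

section \<open>Independence of the star from the bulk\<close>

context fpp
begin

lemma prob_star_ge:
  assumes lower: "\<And>e. e \<in> lattice_edges \<Longrightarrow> b \<le> prob {\<omega> \<in> space M. \<tau> e \<omega> > h}"
    and b: "0 \<le> b"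
  shows "b ^ (2 * CARD('n)) \<le> prob {\<omega> \<in> space M. \<forall>e\<in>star. \<tau> e \<omega> > h}"
proof -
  have star: "star \<subseteq> lattice_edges" unfolding star_def by auto
  have b1: "b \<le> 1" using lower lattice_edges_nonempty prob_le_1 order_trans by blast
  have "{\<omega> \<in> space M. \<forall>e\<in>star. \<tau> e \<omega> > h} = (\<Inter>e\<in>star. \<tau> e -` {h<..} \<inter> space M)"
    using star_nonempty by auto
  also have "prob \<dots> = (\<Prod>e\<in>star. prob (\<tau> e -` {h<..} \<inter> space M))"
    using indep_vars_subset[OF indep star] star_nonempty finite_star
    by (intro indep_varsD_finite) auto
  also have "\<dots> \<ge> (\<Prod>e\<in>(star :: (int ^ 'n) set set). b)"
  proof (intro prod_mono conjI b)
    fix e :: "(int ^ 'n) set" assume "e \<in> star"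
    then show "b \<le> prob (\<tau> e -` {h<..} \<inter> space M)" 
      using lower[of e] star by (auto simp: vimage_def Int_def conj_commute)
  qed
  also have "(\<Prod>e\<in>(star :: (int ^ 'n) set set). b) = b ^ card (star :: (int ^ 'n) set set)" by simp
  \<comment> \<open>Since \<open>b \<le> 1\<close>, replacing the number of factors by its upper
    bound 2d only lowers the product.\<close>
  also have "\<dots> \<ge> b ^ (2 * CARD('n))" using b b1 card_star by (intro power_decreasing)
  finally show ?thesis .
qed

lemma measurable_unstar_PiM:
  "(\<lambda>\<sigma>. ptime (unstar \<sigma>) u v) \<in> borel_measurable (PiM (lattice_edges - star) (\<lambda>_. borel))"
  unfolding ptime_def passage_time_def
proof (intro borel_measurable_cINF_real borel_measurable_sum)
  fix \<gamma> e assume "\<gamma> \<in> lattice_paths u v" "e \<in> path_edges \<gamma>"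
  then have e: "e \<in> lattice_edges" using lattice_path_edges by blast
  show "(\<lambda>\<sigma>. unstar \<sigma> e) \<in> borel_measurable (PiM (lattice_edges - star) (\<lambda>_. borel))"
  proof (cases "0 \<in> e")
    case False
    then have "e \<in> lattice_edges - star" using e by (auto simp: star_def)
    then show ?thesis using False by (simp add: unstar_def measurable_component_singleton)
  qed (simp add: unstar_def)
qed simp

lemma measurable_unstar [measurable]: "(\<lambda>\<omega>. ptime (unstar (\<lambda>e. \<tau> e \<omega>)) u v) \<in> borel_measurable M"
  unfolding ptime_def passage_time_def
proof (intro borel_measurable_cINF_real borel_measurable_sum)
  fix \<gamma> e assume "\<gamma> \<in> lattice_paths u v" "e \<in> path_edges \<gamma>"
  then have "e \<in> lattice_edges" using lattice_path_edges by blast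
  then show "(\<lambda>\<omega>. unstar (\<lambda>e. \<tau> e \<omega>) e) \<in> borel_measurable M"
    by (cases "0 \<in> e") (simp_all add: unstar_def)
qed simp

text \<open>The two events read the star and its complement, two disjoint families of independent
  weights.\<close>

lemma prob_star_unstar:
  "prob {\<omega> \<in> space M. (\<forall>e\<in>star. \<tau> e \<omega> > h) \<and> ptime (unstar (\<lambda>e. \<tau> e \<omega>)) 0 p > c} =
   prob {\<omega> \<in> space M. \<forall>e\<in>star. \<tau> e \<omega> > h} * prob {\<omega> \<in> space M. ptime (unstar (\<lambda>e. \<tau> e \<omega>)) 0 p > c}"
proof -
  let ?E = "lattice_edges :: (int ^ 'n) set set"
  let ?S = "star :: (int ^ 'n) set set"
  let ?N = "\<lambda>_::(int ^ 'n) set. borel :: real measure"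
  have star: "?S \<subseteq> ?E" unfolding star_def by auto
  have iv: "indep_var (PiM ?S ?N) (\<lambda>\<omega>. \<lambda>e\<in>?S. \<tau> e \<omega>) (PiM (?E - ?S) ?N) (\<lambda>\<omega>. \<lambda>e\<in>?E - ?S. \<tau> e \<omega>)"
    using star by (intro indep_var_restrict[OF indep]) auto
  define Xa where "Xa = {\<sigma> \<in> space (PiM ?S ?N). \<forall>e\<in>?S. \<sigma> e > h}"
  define Xb where "Xb = {\<sigma> \<in> space (PiM (?E - ?S) ?N). ptime (unstar \<sigma>) 0 p > c}"
  have Xa: "Xa \<in> sets (PiM ?S ?N)"
  proof -
    have "Xa = {\<sigma> \<in> space (PiM ?S ?N). \<forall>e\<in>?S. \<sigma> e \<in> {h<..}}" unfolding Xa_def by auto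
    also have "\<dots> \<in> sets (PiM ?S ?N)"
      using finite_star by (intro sets.sets_Collect_finite_All' ) (auto intro!: star_nonempty)
    finally show ?thesis .
  qed
  have Xb: "Xb \<in> sets (PiM (?E - ?S) ?N)"
    unfolding Xb_def using measurable_unstar_PiM by (intro borel_measurable_less) auto
  \<comment> \<open>The restriction is \<open>undefined\<close> on the star, but
    \<open>unstar\<close> overwrites exactly those values by 0.\<close>
  have cong: "ptime (unstar (\<lambda>e\<in>?E - ?S. \<tau> e \<omega>)) 0 p = ptime (unstar (\<lambda>e. \<tau> e \<omega>)) 0 p" for \<omega>
    by (rule ptime_cong) (auto simp: unstar_def star_def)
  have a: "(\<lambda>\<omega>. \<lambda>e\<in>?S. \<tau> e \<omega>) -` Xa \<inter> space M = {\<omega> \<in> space M. \<forall>e\<in>?S. \<tau> e \<omega> > h}"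
    unfolding Xa_def by (auto simp: space_PiM)
  have b: "(\<lambda>\<omega>. \<lambda>e\<in>?E - ?S. \<tau> e \<omega>) -` Xb \<inter> space M = {\<omega> \<in> space M. ptime (unstar (\<lambda>e. \<tau> e \<omega>)) 0 p > c}"
    unfolding Xb_def using cong by (auto simp: space_PiM)
  have ab: "(\<lambda>\<omega>. (\<lambda>e\<in>?S. \<tau> e \<omega>, \<lambda>e\<in>?E - ?S. \<tau> e \<omega>)) -` (Xa \<times> Xb) \<inter> space M =
     {\<omega> \<in> space M. (\<forall>e\<in>?S. \<tau> e \<omega> > h) \<and> ptime (unstar (\<lambda>e. \<tau> e \<omega>)) 0 p > c}"
    using a b by (auto simp: set_eq_iff)
  show ?thesis using indep_varD[OF iv Xa Xb] unfolding a b ab .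
qed

text \<open>The mean exceeds the threshold by a gap of order n while the second moment is of order
  n^2, so the lower bound on the probability does not depend on n.\<close>

lemma unstar_bulk:
  assumes "\<epsilon> > 0"
  shows "\<exists>c>0. \<forall>\<^sub>F n in sequentially. c \<le> prob {\<omega> \<in> space M.
     ptime (unstar (\<lambda>e. \<tau> e \<omega>)) 0 (floor_vec (real n *\<^sub>R x)) > real n * (time_constant M \<tau> x - \<epsilon>)}"
proof -
  define \<mu> where "\<mu> = time_constant M \<tau> x"
  define p where "p n = floor_vec (real n *\<^sub>R x)" for n :: nat
  define Y where "Y n \<omega> = ptime (unstar (\<lambda>e. \<tau> e \<omega>)) 0 (p n)" for n \<omega>
  have [measurable]: "Y n \<in> borel_measurable M" for n unfolding Y_def by simp
  have Y0: "0 \<le> Y n \<omega>" and YT: "Y n \<omega> \<le> T \<omega> 0 (p n)" and TY: "T \<omega> 0 (p n) \<le> Y n \<omega> + (\<Sum>e\<in>star. \<tau> e \<omega>)"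
    if "\<omega> \<in> space M" for n \<omega>
    unfolding Y_def using nonneg_weights[OF that]
    by (auto intro: ptime_unstar_le ptime_nonneg[OF nonneg_unstar] ptime_le_unstar)
  show ?thesis
  \<comment> \<open>The second moment inequality asks for a nonnegative threshold. A negative one is
    exceeded surely.\<close>
  proof (cases "\<mu> < \<epsilon>")
    case True
    have "1 \<le> prob {\<omega> \<in> space M. Y n \<omega> > real n * (\<mu> - \<epsilon>)}" if "n \<ge> 1" for n
    proof -
      have "real n * (\<mu> - \<epsilon>) < 0" using True that by (intro mult_pos_neg) auto
      then have "{\<omega> \<in> space M. Y n \<omega> > real n * (\<mu> - \<epsilon>)} = space M"
        using Y0[of _ n] by (auto intro: less_le_trans)
      then show ?thesis by (simp add: prob_space)
    qed
    then show ?thesis unfolding Y_def p_def \<mu>_def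
      by (intro exI[of _ 1]) (auto intro!: eventually_sequentiallyI[of 1])
  next
    case False
    obtain C where C: "C > 0" "\<And>u v. integrable M (\<lambda>\<omega>. (T \<omega> u v)\<^sup>2)"
      "\<And>u v. expectation (\<lambda>\<omega>. (T \<omega> u v)\<^sup>2) \<le> C * (real (norm1 (v - u)))\<^sup>2"
      using T_moments by blast
    define D where "D = real CARD('n) + (\<Sum>i\<in>UNIV. \<bar>x $ i\<bar>)"
    have D: "D > 0" unfolding D_def by (intro add_pos_nonneg sum_nonneg) auto
    define G where "G = C * D\<^sup>2"
    have G: "G > 0" using C D by (simp add: G_def)
    define s0 where "s0 = expectation (\<lambda>\<omega>. \<Sum>e\<in>(star :: (int ^ 'n) set set). \<tau> e \<omega>)"
    have int\<tau>: "integrable M (\<tau> e)" if "e \<in> lattice_edges" for e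
      using power_moment[of 1] that by auto
    have is0: "integrable M (\<lambda>\<omega>. \<Sum>e\<in>(star :: (int ^ 'n) set set). \<tau> e \<omega>)"
      by (intro Bochner_Integration.integrable_sum int\<tau>) (auto simp: star_def)
    have iY: "integrable M (Y n)" for n
      by (rule Bochner_Integration.integrable_bound[OF integrable_T[of 0 "p n"]])
         (use Y0 YT order_trans[OF YT abs_ge_self] in \<open>auto intro!: AE_I2\<close>)
    have YT2: "(Y n \<omega>)\<^sup>2 \<le> (T \<omega> 0 (p n))\<^sup>2" if "\<omega> \<in> space M" for n \<omega>
      using Y0[OF that] YT[OF that] by (intro power_mono) auto
    have iY2: "integrable M (\<lambda>\<omega>. (Y n \<omega>)\<^sup>2)" for n
      by (rule Bochner_Integration.integrable_bound[OF C(2)[of 0 "p n"]])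
         (use YT2 in \<open>auto intro!: AE_I2\<close>)
    have EY: "expectation (\<lambda>\<omega>. T \<omega> 0 (p n)) - s0 \<le> expectation (Y n)" for n
    proof -
      have "expectation (\<lambda>\<omega>. T \<omega> 0 (p n)) \<le> expectation (\<lambda>\<omega>. Y n \<omega> + (\<Sum>e\<in>star. \<tau> e \<omega>))"
        using iY is0 TY by (intro integral_mono) auto
      also have "\<dots> = expectation (Y n) + s0" unfolding s0_def using iY is0 by simp
      finally show ?thesis by simp
    qed
    have lim: "(\<lambda>n. expectation (\<lambda>\<omega>. T \<omega> 0 (p n)) / real n) \<longlonglongrightarrow> \<mu>"
      using filterlim_compose[OF mean_tendsto_time_constant(1)[of x] filterlim_real_sequentially]
      unfolding p_def \<mu>_def .
    \<comment> \<open>Of the slack \<open>\<epsilon>\<close>, one quarter pays for the convergence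
      of the mean and one quarter for the weights cleared at the star; the remaining half is the
      gap.\<close>
    have ev: "\<forall>\<^sub>F n in sequentially. expectation (\<lambda>\<omega>. T \<omega> 0 (p n)) / real n > \<mu> - \<epsilon> / 4
       \<and> real n \<ge> max 1 (4 * s0 / \<epsilon>)"
      using assms order_tendstoD(1)[OF lim, of "\<mu> - \<epsilon> / 4"]
        filterlim_real_sequentially[unfolded filterlim_at_top, rule_format, of "max 1 (4 * s0 / \<epsilon>)"]
      by (intro eventually_conj) simp_all
    have "\<forall>\<^sub>F n in sequentially. (\<epsilon> / 2)\<^sup>2 / G \<le> prob {\<omega> \<in> space M. Y n \<omega> > real n * (\<mu> - \<epsilon>)}"
      using ev
    proof eventually_elim
      case (elim n)
      then have n: "real n \<ge> 1" "real n \<ge> 4 * s0 / \<epsilon>" by auto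
      have "(\<mu> - \<epsilon> / 4) * real n \<le> expectation (\<lambda>\<omega>. T \<omega> 0 (p n))"
        using elim n by (simp add: field_simps)
      moreover have "s0 \<le> \<epsilon> / 4 * real n" using n assms by (simp add: field_simps)
      ultimately have m: "real n * (\<mu> - \<epsilon>) + real n * (\<epsilon> / 2) \<le> expectation (Y n)"
        using EY[of n] by (simp add: algebra_simps)
      have "expectation (\<lambda>\<omega>. (Y n \<omega>)\<^sup>2) \<le> expectation (\<lambda>\<omega>. (T \<omega> 0 (p n))\<^sup>2)"
        using iY2 C(2) YT2 by (intro integral_mono) auto
      also have "\<dots> \<le> C * (real (norm1 (p n)))\<^sup>2" using C(3)[of 0 "p n"] by simp
      also have "\<dots> \<le> C * (D * real n)\<^sup>2"
      proof -
        have "real (norm1 (p n)) \<le> real CARD('n) + (\<Sum>i\<in>UNIV. \<bar>x $ i\<bar>) * real n"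
          unfolding p_def by (rule norm1_floor_vec) simp
        also have "\<dots> \<le> D * real n" using n(1) by (simp add: D_def algebra_simps)
        finally show ?thesis using C(1) by (intro mult_left_mono power_mono) auto
      qed
      also have "\<dots> = G * (real n)\<^sup>2" by (simp add: G_def power_mult_distrib)
      finally have m2: "expectation (\<lambda>\<omega>. (Y n \<omega>)\<^sup>2) \<le> G * (real n)\<^sup>2" .
      have "(real n * (\<epsilon> / 2))\<^sup>2 / (G * (real n)\<^sup>2) \<le> prob {\<omega> \<in> space M. Y n \<omega> > real n * (\<mu> - \<epsilon>)}"
        using False assms n G by (intro second_moment_lower_tail[OF iY iY2 m _ _ m2]) auto
      also have "(real n * (\<epsilon> / 2))\<^sup>2 / (G * (real n)\<^sup>2) = (\<epsilon> / 2)\<^sup>2 / G"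
        using n by (simp add: power_mult_distrib power_divide)
      finally show ?case .
    qed
    moreover have "(\<epsilon> / 2)\<^sup>2 / G > 0" using assms G by simp
    ultimately show ?thesis unfolding Y_def p_def \<mu>_def by blast
  qed
qed

lemma upper_tail_ge:
  assumes lower: "\<And>e t. e \<in> lattice_edges \<Longrightarrow> t \<ge> 0 \<Longrightarrow>
      \<beta>' * exp (- \<alpha> * t powr r) \<le> prob {\<omega> \<in> space M. \<tau> e \<omega> > t}"
    and "\<beta>' > 0" "x \<noteq> 0" "\<xi> > 0" "\<epsilon> > 0"
  shows "\<exists>c>0. \<forall>\<^sub>F n in sequentially.
     c * exp (- 2 * real CARD('n) * \<alpha> * (\<xi> + \<epsilon>) powr r * real n powr r) \<le>
     prob {\<omega> \<in> space M. T \<omega> 0 (floor_vec (real n *\<^sub>R x)) > real n * (time_constant M \<tau> x + \<xi>)}"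
proof -
  define \<mu> where "\<mu> = time_constant M \<tau> x"
  define p where "p n = floor_vec (real n *\<^sub>R x)" for n :: nat
  obtain c where c: "c > 0" "\<forall>\<^sub>F n in sequentially. c \<le> prob {\<omega> \<in> space M.
     ptime (unstar (\<lambda>e. \<tau> e \<omega>)) 0 (p n) > real n * (\<mu> - \<epsilon>)}"
    using unstar_bulk[OF assms(5), of x] unfolding p_def \<mu>_def by blast
  obtain a where a: "x $ a \<noteq> 0" using assms(3) by (auto simp: vec_eq_iff)
  have nz: "\<forall>\<^sub>F n in sequentially. p n \<noteq> 0"
    using eventually_floor_vec_nonzero[OF a, of 1] unfolding p_def
    by (rule eventually_mono) auto
  define c' where "c' = \<beta>' ^ (2 * CARD('n)) * c"
  have "\<forall>\<^sub>F n in sequentially. c' * exp (- 2 * real CARD('n) * \<alpha> * (\<xi> + \<epsilon>) powr r * real n powr r) \<le>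
     prob {\<omega> \<in> space M. T \<omega> 0 (p n) > real n * (\<mu> + \<xi>)}"
    using nz c(2)
  proof eventually_elim
    case (elim n)
    \<comment> \<open>The star has to supply \<open>\<epsilon> * n\<close> beyond the excess
      \<open>\<xi> * n\<close>, since the bulk is only known to exceed
      \<open>n * (\<mu> - \<epsilon>)\<close>.\<close>
    define h where "h = real n * (\<xi> + \<epsilon>)"
    have h: "h \<ge> 0" using assms by (simp add: h_def)
    let ?A = "{\<omega> \<in> space M. \<forall>e\<in>star. \<tau> e \<omega> > h}"
    let ?B = "{\<omega> \<in> space M. ptime (unstar (\<lambda>e. \<tau> e \<omega>)) 0 (p n) > real n * (\<mu> - \<epsilon>)}"
    have "(\<beta>' * exp (- \<alpha> * h powr r)) ^ (2 * CARD('n)) \<le> prob ?A"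
      using lower[OF _ h] assms by (intro prob_star_ge) auto
    moreover have hp: "h powr r = real n powr r * (\<xi> + \<epsilon>) powr r"
      using assms by (simp add: h_def powr_mult)
    have "(\<beta>' * exp (- \<alpha> * h powr r)) ^ (2 * CARD('n)) =
        \<beta>' ^ (2 * CARD('n)) * exp (- 2 * real CARD('n) * \<alpha> * (\<xi> + \<epsilon>) powr r * real n powr r)"
      using assms by (simp add: power_mult_distrib exp_of_nat_mult[symmetric] hp algebra_simps)
    ultimately have A: "\<beta>' ^ (2 * CARD('n)) * exp (- 2 * real CARD('n) * \<alpha> * (\<xi> + \<epsilon>) powr r * real n powr r) \<le> prob ?A"
      by simp
    have "c' * exp (- 2 * real CARD('n) * \<alpha> * (\<xi> + \<epsilon>) powr r * real n powr r)
        \<le> prob ?A * prob ?B"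
      using mult_mono[OF A elim(2)] c(1) by (simp add: c'_def algebra_simps)
    also have "\<dots> = prob {\<omega> \<in> space M. (\<forall>e\<in>star. \<tau> e \<omega> > h) \<and>
       ptime (unstar (\<lambda>e. \<tau> e \<omega>)) 0 (p n) > real n * (\<mu> - \<epsilon>)}"
      by (rule prob_star_unstar[symmetric])
    also have "\<dots> \<le> prob {\<omega> \<in> space M. T \<omega> 0 (p n) > real n * (\<mu> + \<xi>)}"
    proof (rule finite_measure_mono)
      show "{\<omega> \<in> space M. (\<forall>e\<in>star. \<tau> e \<omega> > h) \<and> ptime (unstar (\<lambda>e. \<tau> e \<omega>)) 0 (p n) > real n * (\<mu> - \<epsilon>)}
        \<subseteq> {\<omega> \<in> space M. T \<omega> 0 (p n) > real n * (\<mu> + \<xi>)}"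
      proof safe
        fix \<omega> assume w: "\<omega> \<in> space M" "\<forall>e\<in>star. \<tau> e \<omega> > h"
          "ptime (unstar (\<lambda>e. \<tau> e \<omega>)) 0 (p n) > real n * (\<mu> - \<epsilon>)"
        have "ptime (unstar (\<lambda>e. \<tau> e \<omega>)) 0 (p n) + h \<le> T \<omega> 0 (p n)"
          using w elim(1) by (intro ptime_ge_unstar) (auto intro: less_imp_le)
        moreover have "real n * (\<mu> - \<epsilon>) + h = real n * (\<mu> + \<xi>)" by (simp add: h_def algebra_simps)
        ultimately show "T \<omega> 0 (p n) > real n * (\<mu> + \<xi>)" using w(3) by linarith
      qed
    qed measurable
    finally show ?case .
  qed
  moreover have "c' > 0" using c assms by (simp add: c'_def)
  ultimately show ?thesis unfolding p_def \<mu>_def by blast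
qed

end

section \<open>Disjoint paths at the endpoints\<close>

text \<open>Segments run only in the positive direction; the symmetry of \<open>joins\<close> lets a
  route traverse them backwards.\<close>

definition seg :: "int ^ 'n \<Rightarrow> 'n \<Rightarrow> nat \<Rightarrow> (int ^ 'n) set set" where
  "seg u b N = (\<lambda>i. {u + axis b (int i), u + axis b (int i + 1)}) ` {..<N}"

lemma seg_Suc: "seg u b (Suc N) = insert {u + axis b (int N), u + axis b (int N + 1)} (seg u b N)"
  unfolding seg_def by (simp add: lessThan_Suc)

lemma axis_add: "axis b s + axis b t = (axis b (s + t) :: 'a::monoid_add ^ 'n)"
  by (simp add: vec_eq_iff axis_def)

lemma joins_seg: "joins (seg u b N) u (u + axis b (int N))"
proof (induction N)
  case 0
  have "axis b (0 :: int) = 0" by (simp add: vec_eq_iff axis_def)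
  then show ?case by (simp only: of_nat_0 add_0_right joins_refl)
next
  case (Suc N)
  have "nearest_neighbors (u + axis b (int N)) ((u + axis b (int N)) + axis b 1)"
    by (rule nearest_neighbors_axis) simp
  then have "joins {{u + axis b (int N), u + axis b (int N + 1)}} (u + axis b (int N)) (u + axis b (int N + 1))"
    by (intro joins_edge) (simp add: add.assoc axis_add)
  from joins_trans[OF Suc this] show ?case by (simp add: seg_Suc add.commute)
qed

lemma seg_subset: "seg u b N \<subseteq> lattice_edges"
proof -
  have "{u + axis b (int i), u + axis b (int i + 1)} \<in> lattice_edges" for i
    using lattice_edgesI[OF nearest_neighbors_axis[of 1 "u + axis b (int i)" b]]
    by (simp add: add.assoc axis_add)
  then show ?thesis unfolding seg_def by auto
qed

lemma finite_seg [simp]: "finite (seg u b N)" and card_seg: "card (seg u b N) \<le> N"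
  unfolding seg_def using card_image_le[of "{..<N}"] by auto

text \<open>Twice the midpoint of an edge; it separates the edges of the disjoint paths below.\<close>

definition mid :: "(int ^ 'n) set \<Rightarrow> int ^ 'n" where
  "mid e = \<Sum>e"

lemma mid_pair: "u \<noteq> v \<Longrightarrow> mid {u, v} = u + v"
  unfolding mid_def by simp

lemma mid_axis: "t \<noteq> 0 \<Longrightarrow> mid {v, v + axis b t} = 2 * v + axis b t"
  by (subst mid_pair) (auto simp: axis_eq_axis vec_eq_iff axis_def)

lemma mid_seg:
  assumes "e \<in> seg u b N"
  shows "\<exists>i<N. mid e = 2 * u + axis b (2 * int i + 1)"
proof -
  obtain i where i: "i < N" "e = {u + axis b (int i), (u + axis b (int i)) + axis b 1}"
    using assms unfolding seg_def by (auto simp: add.assoc axis_add)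
  have "mid e = 2 * u + axis b (2 * int i + 1)"
    unfolding i(2) by (subst mid_axis) (auto simp: vec_eq_iff axis_def)
  then show ?thesis using i by blast
qed

text \<open>Routes from \<open>0\<close> to \<open>N e\<^sub>c\<close>, indexed by the first step: sideways steps run parallel to the straight
  route, and the route leaving backwards returns through \<open>(N + 1) e\<^sub>c\<close> at distance \<open>2\<close> in direction \<open>a\<close>.
  All of them stay in the slab \<open>-1 \<le> v\<^sub>a \<le> 2\<close>, so a translate along \<open>a\<close> is disjoint from them.\<close>

definition detour :: "'n \<Rightarrow> 'n \<Rightarrow> nat \<Rightarrow> 'n \<times> bool \<Rightarrow> (int ^ 'n) set set" where
  "detour a c N j = (let b = fst j; t = (if snd j then 1 else - 1) in
     if b \<noteq> c then {{0, axis b t}} \<union> seg (axis b t) c N \<union> {{axis c (int N), axis c (int N) + axis b t}}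
     else if snd j then seg 0 c N
     else {{0, axis c (- 1)}} \<union> seg (axis c (- 1)) a 2 \<union> seg (axis c (- 1) + axis a 2) c (N + 2)
       \<union> seg (axis c (int N + 1)) a 2 \<union> {{axis c (int N), axis c (int N) + axis c 1}})"

lemma detour_side:
  assumes "b \<noteq> c" "t = (if s then 1 else - 1)"
  shows "detour a c N (b, s) =
    {{0, axis b t}} \<union> seg (axis b t) c N \<union> {{axis c (int N), axis c (int N) + axis b t}}"
  using assms by (simp add: detour_def Let_def)

lemma detour_straight: "detour a c N (c, True) = seg 0 c N"
  by (simp add: detour_def)

lemma detour_back: "detour a c N (c, False) =
    {{0, axis c (- 1)}} \<union> seg (axis c (- 1)) a 2 \<union> seg (axis c (- 1) + axis a 2) c (N + 2)
       \<union> seg (axis c (int N + 1)) a 2 \<union> {{axis c (int N), axis c (int N) + axis c 1}}"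
  by (simp add: detour_def Let_def)

lemma detour_cases:
  obtains (side) b :: 'n and s :: bool and t :: int where "j = (b, s)" "b \<noteq> c" "t = (if s then 1 else - 1)"
  | (straight) "j = (c, True)"
  | (rear) "j = (c, False)"
proof -
  obtain b s where j: "j = (b, s)" by (cases j)
  show ?thesis
    using that(1)[OF j _ refl] that(2,3) j by (cases "b = c"; cases s) auto
qed

lemma joins_detour: "joins (detour a c N j) 0 (axis c (int N))"
proof (cases j c rule: detour_cases)
  case (side b s t)
  then have t: "\<bar>t\<bar> = 1" by simp
  have i: "joins {{0, axis b t}} 0 (axis b t)"
    using joins_edge[OF nearest_neighbors_axis[OF t, of 0 b]] by simp
  have ii: "joins (seg (axis b t) c N) (axis b t) (axis b t + axis c (int N))" by (rule joins_seg)
  have iii: "joins {{axis c (int N), axis c (int N) + axis b t}} (axis b t + axis c (int N)) (axis c (int N))"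
    using joins_edge[OF nearest_neighbors_axis[OF t, of "axis c (int N)" b]]
    by (subst add.commute) (rule joins_sym)
  show ?thesis
    using joins_trans[OF joins_trans[OF i ii] iii] unfolding side(1) detour_side[OF side(2,3)] .
next
  case straight
  then show ?thesis using joins_seg[of 0 c N] by (simp add: detour_straight)
next
  case rear
  have 1: "joins {{0, axis c (- 1)}} 0 (axis c (- 1 :: int))"
    using joins_edge[OF nearest_neighbors_axis[of "- 1" 0 c]] by simp
  have 2: "joins (seg (axis c (- 1)) a 2) (axis c (- 1)) (axis c (- 1) + axis a 2)"
    using joins_seg[of "axis c (- 1)" a 2] by simp
  have 3: "joins (seg (axis c (- 1) + axis a 2) c (N + 2)) (axis c (- 1) + axis a 2) (axis c (int N + 1) + axis a 2)"
  proof -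
    have "axis c (- 1) + axis a 2 + axis c (int (N + 2)) = axis c (int N + 1) + axis a (2 :: int)"
      by (simp add: vec_eq_iff axis_def)
    then show ?thesis using joins_seg[of "axis c (- 1) + axis a 2" c "N + 2"] by metis
  qed
  have 4: "joins (seg (axis c (int N + 1)) a 2) (axis c (int N + 1) + axis a 2) (axis c (int N + 1))"
    by (rule joins_sym) (use joins_seg[of "axis c (int N + 1)" a 2] in simp)
  have 5: "joins {{axis c (int N), axis c (int N) + axis c 1}} (axis c (int N + 1)) (axis c (int N))"
    by (rule joins_sym) (use joins_edge[OF nearest_neighbors_axis[of 1 "axis c (int N)" c]] in \<open>simp add: axis_add\<close>)
  show ?thesis
    using joins_trans[OF joins_trans[OF joins_trans[OF joins_trans[OF 1 2] 3] 4] 5]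
    unfolding rear detour_back .
qed

lemma detour_subset: "detour a c N j \<subseteq> lattice_edges"
proof -
  have edge: "{v, v + axis b t} \<in> lattice_edges" if "\<bar>t\<bar> = 1" for v b t
    using lattice_edgesI[OF nearest_neighbors_axis[OF that]] .
  have edge0: "{0, axis b t} \<in> lattice_edges" if "\<bar>t\<bar> = 1" for b t
    using edge[OF that, of 0 b] by simp
  show ?thesis
  proof (cases j c rule: detour_cases)
    case (side b s t)
    then show ?thesis unfolding side(1) detour_side[OF side(2,3)]
      by (intro Un_least seg_subset) (simp_all add: edge edge0 del: insert_iff)
  next
    case straight
    then show ?thesis by (simp add: detour_straight seg_subset)
  next
    case rear
    then show ?thesis unfolding rear detour_back
      by (intro Un_least seg_subset) (simp_all add: edge edge0 del: insert_iff)
  qed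
qed

lemma finite_detour [simp]: "finite (detour a c N j)"
  unfolding detour_def Let_def by auto

lemma card_detour: "card (detour a c N j) \<le> N + 8"
proof -
  have un: "card (A \<union> B) \<le> k + l" if "card A \<le> k" "card B \<le> l" for A B :: "(int ^ 'n) set set" and k l
    using card_Un_le[of A B] that by linarith
  show ?thesis
  proof (cases j c rule: detour_cases)
    case (side b s t)
    have "card (detour a c N j) \<le> 1 + N + 1"
      unfolding side(1) detour_side[OF side(2,3)] by (intro un card_seg) auto
    then show ?thesis by simp
  next
    case straight
    then show ?thesis using card_seg[of 0 c N] by (simp add: detour_straight)
  next
    case rear
    have "card (detour a c N j) \<le> 1 + 2 + (N + 2) + 2 + 1"
      unfolding rear detour_back by (intro un card_seg) auto
    then show ?thesis by simp
  qed
qed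

text \<open>A signature of each route in terms of doubled midpoints. Side routes stay in the range
  of the straight route along \<open>c\<close> and are recognised by their nonzero coordinate
  \<open>b\<close>. The rear route either leaves that range or runs at doubled height 4 along
  \<open>a\<close>; a return at height 1 would collide with the side route starting in direction
  \<open>+a\<close>.\<close>

lemma detour_mid:
  assumes "a \<noteq> c" "e \<in> detour a c N (b, s)"
  defines "m \<equiv> mid e"
  shows "if b \<noteq> c then 0 \<le> m $ c \<and> m $ c \<le> 2 * int N \<and> m $ b \<in> (if s then {1, 2} else {- 1, - 2}) \<and> (\<forall>i. i \<noteq> b \<and> i \<noteq> c \<longrightarrow> m $ i = 0)
    else if s then 0 \<le> m $ c \<and> m $ c \<le> 2 * int N \<and> (\<forall>i. i \<noteq> c \<longrightarrow> m $ i = 0)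
    else m $ c < 0 \<or> m $ c > 2 * int N \<or> m $ a = 4"
proof -
  have m0: "mid {0, axis b' t'} = axis b' t'" if "t' \<noteq> 0" for b' t'
    using mid_axis[OF that, of 0 b'] by simp
  show ?thesis
  proof (cases "(b, s)" c rule: detour_cases)
    case (side b' s' t)
    have t: "t \<noteq> 0" using side by simp
    have "e = {0, axis b t} \<or> e \<in> seg (axis b t) c N \<or> e = {axis c (int N), axis c (int N) + axis b t}"
      using assms(2) side unfolding detour_side[OF side(2,3)] by (auto simp: detour_side)
    then have "m = axis b t \<or> (\<exists>i<N. m = 2 * axis b t + axis c (2 * int i + 1)) \<or> m = 2 * axis c (int N) + axis b t"
      unfolding m_def using m0[OF t] mid_axis[OF t] mid_seg by blast
    then show ?thesis using side by (auto simp: axis_def)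
  next
    case straight
    then have "e \<in> seg 0 c N" using assms(2) detour_straight by auto
    then have "\<exists>i<N. m = 2 * 0 + axis c (2 * int i + 1)" unfolding m_def by (rule mid_seg)
    then show ?thesis using straight by (auto simp: axis_def)
  next
    case rear
    then have "e = {0, axis c (- 1)} \<or> e \<in> seg (axis c (- 1)) a 2 \<or> e \<in> seg (axis c (- 1) + axis a 2) c (N + 2)
       \<or> e \<in> seg (axis c (int N + 1)) a 2 \<or> e = {axis c (int N), axis c (int N) + axis c 1}"
      using assms(2) by (auto simp: detour_back)
    then have "m = axis c (- 1) \<or> (\<exists>i<2. m = 2 * axis c (- 1) + axis a (2 * int i + 1)) \<or>
       (\<exists>i<N+2. m = 2 * (axis c (- 1) + axis a 2) + axis c (2 * int i + 1)) \<or>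
       (\<exists>i<2. m = 2 * axis c (int N + 1) + axis a (2 * int i + 1)) \<or> m = 2 * axis c (int N) + axis c 1"
      unfolding m_def using m0[of "- 1" c] mid_axis[of 1 "axis c (int N)" c]
        mid_seg[of e "axis c (- 1)" a 2] mid_seg[of e "axis c (- 1) + axis a 2" c "N + 2"]
        mid_seg[of e "axis c (int N + 1)" a 2] by auto
    then show ?thesis using rear assms(1) by (auto simp: axis_def)
  qed
qed

lemma detour_disjoint:
  assumes "a \<noteq> c"
  shows "disjoint_family (detour a c N)"
  unfolding disjoint_family_on_def
proof (intro ballI impI)
  fix j j' :: "'a \<times> bool" assume ne: "j \<noteq> j'"
  obtain b s b' s' where j: "j = (b, s)" "j' = (b', s')" by fastforce
  show "detour a c N j \<inter> detour a c N j' = {}"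
  proof (rule ccontr)
    assume "\<not> ?thesis"
    then obtain e where e: "e \<in> detour a c N (b, s)" "e \<in> detour a c N (b', s')" unfolding j by auto
    have ne': "b \<noteq> b' \<or> s \<noteq> s'" using ne j by auto
    note d = detour_mid[OF assms e(1)] detour_mid[OF assms e(2)]
    show False
    proof (cases "b = b'")
      case True
      then show False using d ne' assms by (cases "b = c"; cases s; cases s') auto
    next
      case False
      show False
      proof (cases "b = c \<or> b' = c")
        case True
        then show False using d False assms
          by (cases "a = b"; cases "a = b'"; cases s; cases s') auto
      next
        case F: False
        have "mid e $ b = 0" using d(2) F False by auto
        moreover have "mid e $ b \<noteq> 0" using d(1) F by (auto split: if_splits)
        ultimately show False by simp
      qed
    qed
  qed
qed

lemma seg_vertex:
  assumes "e \<in> seg u b k" "v \<in> e"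
  shows "\<exists>i\<le>k. v = u + axis b (int i)"
proof -
  obtain i where "i < k" "v = u + axis b (int i) \<or> v = u + axis b (int (Suc i))"
    using assms unfolding seg_def by (auto simp: add.commute)
  then have "v = u + axis b (int i) \<and> i \<le> k \<or> v = u + axis b (int (Suc i)) \<and> Suc i \<le> k"
    by auto
  then show ?thesis by blast
qed

text \<open>Two points of the slab differ by at most 3 in coordinate \<open>a\<close>, so a
  translate by \<open>p\<close> with \<open>\<bar>p $ a\<bar> \<ge> 4\<close> shares no vertex with
  the original routes. This is where the constant 4 comes from.\<close>

lemma detour_box:
  assumes "a \<noteq> c" "e \<in> detour a c N j" "v \<in> e"
  shows "- 1 \<le> v $ a \<and> v $ a \<le> 2"
proof (cases j c rule: detour_cases)
  case (side b s t)
  then have t: "\<bar>t\<bar> = 1" by simp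
  have "e = {0, axis b t} \<or> e \<in> seg (axis b t) c N \<or> e = {axis c (int N), axis c (int N) + axis b t}"
    using assms(2) side unfolding side(1) detour_side[OF side(2,3)] by auto
  then have "v = 0 \<or> v = axis b t \<or> (\<exists>i\<le>N. v = axis b t + axis c (int i)) \<or> v = axis c (int N)
      \<or> v = axis c (int N) + axis b t"
    using seg_vertex[of e "axis b t" c N] assms(3) by auto
  then show ?thesis using assms(1) t by (auto simp: axis_def abs_if split: if_splits)
next
  case straight
  then obtain i where "v = 0 + axis c (int i)"
    using seg_vertex[of e 0 c N v] assms by (auto simp: detour_straight)
  then show ?thesis using assms(1) by (auto simp: axis_def)
next
  case rear
  then have "e = {0, axis c (- 1)} \<or> e \<in> seg (axis c (- 1)) a 2 \<or> e \<in> seg (axis c (- 1) + axis a 2) c (N + 2)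
     \<or> e \<in> seg (axis c (int N + 1)) a 2 \<or> e = {axis c (int N), axis c (int N) + axis c 1}"
    using assms(2) by (auto simp: detour_back)
  then have "v = 0 \<or> v = axis c (- 1) \<or> (\<exists>i\<le>2. v = axis c (- 1) + axis a (int i))
      \<or> (\<exists>i\<le>N + 2. v = axis c (- 1) + axis a 2 + axis c (int i))
      \<or> (\<exists>i\<le>2. v = axis c (int N + 1) + axis a (int i)) \<or> v = axis c (int N) \<or> v = axis c (int N) + axis c 1"
    using assms(3) seg_vertex[of e _ _ _ v] by fast
  then show ?thesis using assms(1) by (auto simp: axis_def)
qed

text \<open>For two terms, divide by the sum: numbers in \<open>[0, 1]\<close> satisfy
  \<open>z \<le> z powr r\<close> because \<open>r \<le> 1\<close>.\<close>

lemma powr_sum_le: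
  fixes f :: "'b \<Rightarrow> real"
  assumes "finite F" "\<And>e. e \<in> F \<Longrightarrow> 0 \<le> f e" "0 < r" "r \<le> 1"
  shows "(\<Sum>e\<in>F. f e) powr r \<le> (\<Sum>e\<in>F. f e powr r)"
  using assms(1,2)
proof (induction F)
  case (insert e F)
  have two: "(x + y) powr r \<le> x powr r + y powr r" if "x \<ge> 0" "y \<ge> 0" for x y :: real
  proof (cases "x + y = 0")
    case False
    then have s: "x + y > 0" using that by linarith
    have le: "z \<le> z powr r" if "0 \<le> z" "z \<le> 1" for z :: real
      using powr_mono'[of r 1 z] that assms by simp
    have "x / (x + y) \<le> (x / (x + y)) powr r" "y / (x + y) \<le> (y / (x + y)) powr r"
      using that s by (auto intro!: le)
    then have "x / (x + y) + y / (x + y) \<le> x powr r / (x + y) powr r + y powr r / (x + y) powr r"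
      using that s by (simp add: powr_divide)
    then have "1 \<le> (x powr r + y powr r) / (x + y) powr r"
      using s by (simp add: add_divide_distrib[symmetric])
    then show ?thesis using s by (simp add: field_simps)
  qed (use that in auto)
  have "(\<Sum>e\<in>insert e F. f e) powr r = (f e + (\<Sum>e\<in>F. f e)) powr r" using insert by simp
  also have "\<dots> \<le> f e powr r + (\<Sum>e\<in>F. f e) powr r" using insert by (intro two sum_nonneg) auto
  also have "\<dots> \<le> f e powr r + (\<Sum>e\<in>F. f e powr r)" using insert by simp
  finally show ?case using insert by simp
qed simp

section \<open>Exponential bound for the connections at the endpoints\<close>

context fpp
begin

text \<open>Exponential Markov inequality. The powers \<open>\<tau> powr r\<close> are the natural
  variables: their exponential moments are finite at every \<open>a < \<alpha>\<close>, and
  independence turns the moment of the sum into a product.\<close>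

lemma sum_powr_tail:
  assumes F: "finite F" "F \<subseteq> lattice_edges"
    and C: "\<And>e. e \<in> lattice_edges \<Longrightarrow> integrable M (\<lambda>\<omega>. exp (a * \<tau> e \<omega> powr r))"
      "\<And>e. e \<in> lattice_edges \<Longrightarrow> expectation (\<lambda>\<omega>. exp (a * \<tau> e \<omega> powr r)) \<le> C"
    and a: "a > 0"
  shows "prob {\<omega> \<in> space M. s \<le> (\<Sum>e\<in>F. \<tau> e \<omega> powr r)} \<le> exp (- a * s) * C ^ card F"
proof -
  have iv: "indep_vars (\<lambda>_. borel) (\<lambda>e \<omega>. exp (a * \<tau> e \<omega> powr r)) F"
    by (rule indep_vars_compose2[OF indep_vars_subset[OF indep F(2)]]) measurable
  have int: "integrable M (\<lambda>\<omega>. \<Prod>e\<in>F. exp (a * \<tau> e \<omega> powr r))"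
    using F C by (intro indep_vars_integrable[OF _ iv]) auto
  have E: "expectation (\<lambda>\<omega>. \<Prod>e\<in>F. exp (a * \<tau> e \<omega> powr r)) = (\<Prod>e\<in>F. expectation (\<lambda>\<omega>. exp (a * \<tau> e \<omega> powr r)))"
    using F C by (intro indep_vars_lebesgue_integral[OF _ iv]) auto
  also have "\<dots> \<le> (\<Prod>e\<in>F. C)"
    using F C by (intro prod_mono conjI Bochner_Integration.integral_nonneg) auto
  finally have EC: "expectation (\<lambda>\<omega>. \<Prod>e\<in>F. exp (a * \<tau> e \<omega> powr r)) \<le> C ^ card F" by simp
  have eq: "(\<Prod>e\<in>F. exp (a * \<tau> e \<omega> powr r)) = exp (a * (\<Sum>e\<in>F. \<tau> e \<omega> powr r))" for \<omega>
    using F by (simp add: exp_sum sum_distrib_left)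
  have "prob {\<omega> \<in> space M. s \<le> (\<Sum>e\<in>F. \<tau> e \<omega> powr r)} =
      prob {\<omega> \<in> space M. exp (a * s) \<le> (\<Prod>e\<in>F. exp (a * \<tau> e \<omega> powr r))}"
    using a by (simp add: eq)
  also have "\<dots> \<le> expectation (\<lambda>\<omega>. \<Prod>e\<in>F. exp (a * \<tau> e \<omega> powr r)) / exp (a * s)"
    using integral_Markov_inequality_measure[OF int, of "space M" "exp (a * s)"]
    by (simp add: prod_nonneg)
  also have "\<dots> \<le> C ^ card F / exp (a * s)" using EC by (intro divide_right_mono) auto
  finally show ?thesis by (simp add: exp_minus field_simps)
qed

text \<open>The routes at \<open>0\<close> and their translates at \<open>p\<close> are 4d disjoint
  sets of at most \<open>N + 8\<close> edges; this is the exponent of \<open>C\<close>. A large cost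
  of a connection forces every one of its 2d routes to be expensive simultaneously.\<close>

lemma endpoint_cost:
  assumes ac: "a \<noteq> c" and p: "\<bar>p $ a\<bar> \<ge> 4" and s: "s \<ge> 0" and b: "b > 0"
    and C: "\<And>e. e \<in> lattice_edges \<Longrightarrow> integrable M (\<lambda>\<omega>. exp (b * \<tau> e \<omega> powr r))"
      "\<And>e. e \<in> lattice_edges \<Longrightarrow> expectation (\<lambda>\<omega>. exp (b * \<tau> e \<omega> powr r)) \<le> C" "C \<ge> 1"
  shows "prob {\<omega> \<in> space M. s < T \<omega> 0 (axis c (int N)) + T \<omega> (axis c (int N) + p) p} \<le>
     exp (- b * (2 * real CARD('n) * s powr r)) * C ^ (4 * CARD('n) * (N + 8))"
proof -
  define P where "P j = detour a c N j" for j
  define P' where "P' j = edge_shift p ` P j" for j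
  define F where "F = (\<Union>j\<in>UNIV. P j) \<union> (\<Union>j\<in>UNIV. P' j)"
  let ?J = "UNIV :: ('n \<times> bool) set"
  have P: "P j \<subseteq> lattice_edges" "finite (P j)" "joins (P j) 0 (axis c (int N))" for j
    unfolding P_def by (rule detour_subset, simp, rule joins_detour)
  have P': "P' j \<subseteq> lattice_edges" "finite (P' j)" "joins (P' j) (axis c (int N) + p) p" for j
  proof -
    show "P' j \<subseteq> lattice_edges" unfolding P'_def using P(1)[of j] edge_shift_lattice_edges by blast
    show "finite (P' j)" unfolding P'_def using P(2) by simp
    show "joins (P' j) (axis c (int N) + p) p"
      using joins_sym[OF joins_shift[OF P(3)[of j], of p]] unfolding P'_def by simp
  qed
  have dP: "disjoint_family P" unfolding P_def using detour_disjoint[OF ac] .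
  have dP': "disjoint_family P'"
    using dP unfolding disjoint_family_on_def P'_def
    by (metis image_Int[OF inj_edge_shift] image_empty)
  have dis: "(\<Union>j\<in>UNIV. P j) \<inter> (\<Union>j\<in>UNIV. P' j) = {}"
  proof (rule ccontr)
    assume "\<not> ?thesis"
    then obtain e j e' j' where e: "e \<in> P j" "e' \<in> P j'" "e = edge_shift p e'" unfolding P'_def by blast
    obtain u v where "e' = {u, v}" using e(2) P(1) unfolding lattice_edges_def by blast
    then have u: "u \<in> e'" "u + p \<in> e" using e(3) unfolding edge_shift_def by auto
    have "- 1 \<le> u $ a" "u $ a \<le> 2" "- 1 \<le> u $ a + p $ a" "u $ a + p $ a \<le> 2"
      using detour_box[OF ac e(2)[unfolded P_def] u(1)] detour_box[OF ac e(1)[unfolded P_def] u(2)] by auto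
    then show False using p by linarith
  qed
  have fin: "finite F" and sub: "F \<subseteq> lattice_edges"
    unfolding F_def using P(2) P'(2) by simp (intro Un_least UN_least P(1) P'(1))
  have "card F \<le> (\<Sum>j\<in>?J. card (P j)) + (\<Sum>j\<in>?J. card (P' j))"
    unfolding F_def by (intro order_trans[OF card_Un_le] add_mono card_UN_le) auto
  also have "\<dots> \<le> (\<Sum>j\<in>?J. N + 8) + (\<Sum>j\<in>?J. N + 8)"
    unfolding P'_def P_def by (intro add_mono sum_mono order_trans[OF card_image_le] card_detour) auto
  also have "\<dots> = 4 * CARD('n) * (N + 8)" by (simp add: card_prod)
  finally have cF: "card F \<le> 4 * CARD('n) * (N + 8)" .
  have key: "2 * real CARD('n) * s powr r \<le> (\<Sum>e\<in>F. \<tau> e \<omega> powr r)"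
    if w: "\<omega> \<in> space M" "s < T \<omega> 0 (axis c (int N)) + T \<omega> (axis c (int N) + p) p" for \<omega>
  proof -
    let ?U = "T \<omega> 0 (axis c (int N))" and ?V = "T \<omega> (axis c (int N) + p) p"
    have UV: "?U \<ge> 0" "?V \<ge> 0" using w(1) by (auto intro: ptime_nonneg)
    have one: "(T \<omega> u v) powr r \<le> (\<Sum>e\<in>Q. \<tau> e \<omega> powr r)"
      if "Q \<subseteq> lattice_edges" "finite Q" "joins Q u v" for Q u v
    proof -
      have "(T \<omega> u v) powr r \<le> (\<Sum>e\<in>Q. \<tau> e \<omega>) powr r"
        using T_bound[OF w(1) that(3,2,1)] pos by (intro powr_mono2) auto
      also have "\<dots> \<le> (\<Sum>e\<in>Q. \<tau> e \<omega> powr r)" using that nonneg w(1) pos by (intro powr_sum_le) auto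
      finally show ?thesis .
    qed
    \<comment> \<open>However the excess is split between the ends, the \<open>r\<close>-th powers
      of the two costs add up to at least \<open>s powr r\<close>. Each of them is paid on 2d
      disjoint routes, hence the factor 2d and not 4d.\<close>
    have "s powr r \<le> (?U + ?V) powr r" using s w(2) pos by (intro powr_mono2) auto
    also have "\<dots> \<le> ?U powr r + ?V powr r"
      using powr_sum_le[of "{True, False}" "\<lambda>b. if b then ?U else ?V" r] UV pos by simp
    finally have "2 * real CARD('n) * s powr r \<le> 2 * real CARD('n) * (?U powr r + ?V powr r)"
      by (intro mult_left_mono) auto
    also have "\<dots> = (\<Sum>j\<in>?J. ?U powr r) + (\<Sum>j\<in>?J. ?V powr r)"
      by (simp add: card_prod algebra_simps)
    also have "\<dots> \<le> (\<Sum>j\<in>?J. \<Sum>e\<in>P j. \<tau> e \<omega> powr r) + (\<Sum>j\<in>?J. \<Sum>e\<in>P' j. \<tau> e \<omega> powr r)"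
      using one P P' by (intro add_mono sum_mono) auto
    also have "\<dots> = (\<Sum>e\<in>(\<Union>j\<in>?J. P j). \<tau> e \<omega> powr r) + (\<Sum>e\<in>(\<Union>j\<in>?J. P' j). \<tau> e \<omega> powr r)"
      using P(2) P'(2) dP dP'
      by (subst (1 2) sum.UNION_disjoint) (auto simp: disjoint_family_on_def)
    also have "\<dots> = (\<Sum>e\<in>F. \<tau> e \<omega> powr r)"
      unfolding F_def using P(2) P'(2) dis by (intro sum.union_disjoint[symmetric]) auto
    finally show ?thesis .
  qed
  have "prob {\<omega> \<in> space M. s < T \<omega> 0 (axis c (int N)) + T \<omega> (axis c (int N) + p) p} \<le>
    prob {\<omega> \<in> space M. 2 * real CARD('n) * s powr r \<le> (\<Sum>e\<in>F. \<tau> e \<omega> powr r)}"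
  proof (intro finite_measure_mono)
    have [measurable]: "(\<lambda>\<omega>. \<Sum>e\<in>F. \<tau> e \<omega> powr r) \<in> borel_measurable M"
    proof (intro borel_measurable_sum)
      fix e assume "e \<in> F"
      then have [measurable]: "\<tau> e \<in> borel_measurable M" using sub by auto
      show "(\<lambda>\<omega>. \<tau> e \<omega> powr r) \<in> borel_measurable M" by measurable
    qed
    show "{\<omega> \<in> space M. 2 * real CARD('n) * s powr r \<le> (\<Sum>e\<in>F. \<tau> e \<omega> powr r)} \<in> events"
      by measurable
  qed (use key in auto)
  also have "\<dots> \<le> exp (- b * (2 * real CARD('n) * s powr r)) * C ^ card F"
    by (rule sum_powr_tail[OF fin sub C(1,2) b])
  also have "\<dots> \<le> exp (- b * (2 * real CARD('n) * s powr r)) * C ^ (4 * CARD('n) * (N + 8))"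
    using cF C(3) by (intro mult_left_mono power_increasing) auto
  finally show ?thesis .
qed

end

section \<open>Parallel tubes\<close>

text \<open>Chebyshev's inequality. In the expanded square every index has at most
  \<open>2 * R + 1\<close> partners with a nonzero mean product, so the second moment of the sum
  grows linearly in \<open>m\<close>.\<close>

lemma (in prob_space) finite_range_dependent_sum_tail:
  fixes Z :: "nat \<Rightarrow> 'a \<Rightarrow> real"
  assumes Z: "\<And>i. i < m \<Longrightarrow> Z i \<in> borel_measurable M" "\<And>i. i < m \<Longrightarrow> integrable M (\<lambda>\<omega>. (Z i \<omega>)\<^sup>2)"
    and C: "\<And>i. i < m \<Longrightarrow> expectation (\<lambda>\<omega>. (Z i \<omega>)\<^sup>2) \<le> C" "C \<ge> 0"
    and uncorrelated: "\<And>i j. i < m \<Longrightarrow> j < m \<Longrightarrow> i + R < j \<Longrightarrow> expectation (\<lambda>\<omega>. Z i \<omega> * Z j \<omega>) = 0"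
    and h: "h > 0"
  shows "prob {\<omega> \<in> space M. h < (\<Sum>i<m. Z i \<omega>)} \<le> real m * (2 * real R + 1) * C / h\<^sup>2"
proof -
  have int: "integrable M (\<lambda>\<omega>. Z i \<omega> * Z j \<omega>)" if "i < m" "j < m" for i j
  proof (rule Bochner_Integration.integrable_bound[OF Bochner_Integration.integrable_add[OF Z(2)[OF that(1)] Z(2)[OF that(2)]]])
    show "(\<lambda>\<omega>. Z i \<omega> * Z j \<omega>) \<in> borel_measurable M" using Z(1) that by simp
    have "\<bar>x * y\<bar> \<le> x\<^sup>2 + y\<^sup>2" for x y :: real
    proof -
      have "2 * \<bar>x\<bar> * \<bar>y\<bar> \<le> x\<^sup>2 + y\<^sup>2" using sum_squares_bound[of "\<bar>x\<bar>" "\<bar>y\<bar>"] by simp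
      moreover have "0 \<le> \<bar>x\<bar> * \<bar>y\<bar>" by simp
      ultimately show ?thesis unfolding abs_mult by linarith
    qed
    then show "AE \<omega> in M. norm (Z i \<omega> * Z j \<omega>) \<le> norm ((Z i \<omega>)\<^sup>2 + (Z j \<omega>)\<^sup>2)" by simp
  qed
  have bd: "expectation (\<lambda>\<omega>. Z i \<omega> * Z j \<omega>) \<le> (if i \<le> j + R \<and> j \<le> i + R then C else 0)"
    if "i < m" "j < m" for i j
  proof (cases "i \<le> j + R \<and> j \<le> i + R")
    case True
    have "expectation (\<lambda>\<omega>. Z i \<omega> * Z j \<omega>) \<le> expectation (\<lambda>\<omega>. ((Z i \<omega>)\<^sup>2 + (Z j \<omega>)\<^sup>2) / 2)"
    proof (rule integral_mono)
      show "Z i \<omega> * Z j \<omega> \<le> ((Z i \<omega>)\<^sup>2 + (Z j \<omega>)\<^sup>2) / 2" for \<omega>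
        using sum_squares_bound[of "Z i \<omega>" "Z j \<omega>"] by simp
    qed (use int Z(2) that in auto)
    also have "\<dots> \<le> (C + C) / 2" using Z(2) that C(1)[OF that(1)] C(1)[OF that(2)] by simp
    finally show ?thesis using True by simp
  next
    case False
    then have "i + R < j \<or> j + R < i" by linarith
    then show ?thesis using uncorrelated[of i j] uncorrelated[of j i] that False
      by (auto simp: mult.commute)
  qed
  have cnt: "(\<Sum>j<m. if i \<le> j + R \<and> j \<le> i + R then C else 0) \<le> (2 * real R + 1) * C" for i
  proof -
    have "(\<Sum>j<m. if i \<le> j + R \<and> j \<le> i + R then C else 0) = (\<Sum>j\<in>{j. j < m \<and> i \<le> j + R \<and> j \<le> i + R}. C)"
      by (intro sum.mono_neutral_cong_right) auto
    also have "\<dots> = real (card {j. j < m \<and> i \<le> j + R \<and> j \<le> i + R}) * C" by simp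
    also have "\<dots> \<le> real (card {i - R..i + R}) * C"
      using C by (intro mult_right_mono of_nat_mono card_mono) auto
    also have "\<dots> \<le> (2 * real R + 1) * C" using C by (intro mult_right_mono) auto
    finally show ?thesis .
  qed
  have sq: "(\<Sum>i<m. Z i \<omega>)\<^sup>2 = (\<Sum>i<m. \<Sum>j<m. Z i \<omega> * Z j \<omega>)" for \<omega>
    by (simp add: power2_eq_square sum_product)
  have isq: "integrable M (\<lambda>\<omega>. (\<Sum>i<m. Z i \<omega>)\<^sup>2)"
    unfolding sq by (intro Bochner_Integration.integrable_sum int) auto
  have "expectation (\<lambda>\<omega>. (\<Sum>i<m. Z i \<omega>)\<^sup>2) = (\<Sum>i<m. \<Sum>j<m. expectation (\<lambda>\<omega>. Z i \<omega> * Z j \<omega>))"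
  proof -
    have "expectation (\<lambda>\<omega>. (\<Sum>i<m. Z i \<omega>)\<^sup>2) = (\<Sum>i<m. expectation (\<lambda>\<omega>. \<Sum>j<m. Z i \<omega> * Z j \<omega>))"
      unfolding sq by (intro Bochner_Integration.integral_sum Bochner_Integration.integrable_sum int) auto
    also have "\<dots> = (\<Sum>i<m. \<Sum>j<m. expectation (\<lambda>\<omega>. Z i \<omega> * Z j \<omega>))"
      by (intro sum.cong refl Bochner_Integration.integral_sum int) auto
    finally show ?thesis .
  qed
  also have "\<dots> \<le> (\<Sum>i<m. \<Sum>j<m. if i \<le> j + R \<and> j \<le> i + R then C else 0)"
    using bd by (intro sum_mono) auto
  also have "\<dots> \<le> (\<Sum>i<m. (2 * real R + 1) * C)" by (intro sum_mono cnt)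
  finally have E: "expectation (\<lambda>\<omega>. (\<Sum>i<m. Z i \<omega>)\<^sup>2) \<le> real m * (2 * real R + 1) * C" by (simp add: mult.assoc)
  have "prob {\<omega> \<in> space M. h < (\<Sum>i<m. Z i \<omega>)} \<le> prob {\<omega> \<in> space M. h\<^sup>2 \<le> (\<Sum>i<m. Z i \<omega>)\<^sup>2}"
  proof (intro finite_measure_mono)
    have [measurable]: "(\<lambda>\<omega>. \<Sum>i<m. Z i \<omega>) \<in> borel_measurable M" using Z(1) by (intro borel_measurable_sum) auto
    show "{\<omega> \<in> space M. h\<^sup>2 \<le> (\<Sum>i<m. Z i \<omega>)\<^sup>2} \<in> events" by measurable
    show "{\<omega> \<in> space M. h < (\<Sum>i<m. Z i \<omega>)} \<subseteq> {\<omega> \<in> space M. h\<^sup>2 \<le> (\<Sum>i<m. Z i \<omega>)\<^sup>2}"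
      using h by (auto intro!: power_mono)
  qed
  also have "\<dots> \<le> expectation (\<lambda>\<omega>. (\<Sum>i<m. Z i \<omega>)\<^sup>2) / h\<^sup>2"
    using integral_Markov_inequality_measure[OF isq, of "space M" "h\<^sup>2"] h by simp
  also have "\<dots> \<le> real m * (2 * real R + 1) * C / h\<^sup>2" using E by (intro divide_right_mono) auto
  finally show ?thesis .
qed

text \<open>A passage time from \<open>u\<close> restricted to a finite family of paths. It reads
  finitely many edges near \<open>u\<close>, so distant blocks are exactly independent, and for a
  suitable family its mean is close to that of the full passage time.\<close>

definition block :: "(int ^ 'n) list set \<Rightarrow> int ^ 'n \<Rightarrow> ((int ^ 'n) set \<Rightarrow> real) \<Rightarrow> real" where
  "block \<Gamma> u \<sigma> = (MIN \<gamma>\<in>\<Gamma>. passage_time (\<lambda>e. \<sigma> (edge_shift u e)) \<gamma>)"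

definition support :: "(int ^ 'n) list set \<Rightarrow> int ^ 'n \<Rightarrow> (int ^ 'n) set set" where
  "support \<Gamma> u = edge_shift u ` (\<Union>\<gamma>\<in>\<Gamma>. path_edges \<gamma>)"

lemma support_subset: "\<Gamma> \<subseteq> lattice_paths 0 v \<Longrightarrow> support \<Gamma> u \<subseteq> lattice_edges"
  unfolding support_def using lattice_path_edges edge_shift_lattice_edges by blast

lemma measurable_block_PiM:
  assumes "support \<Gamma> u \<subseteq> D" "finite \<Gamma>"
  shows "block \<Gamma> u \<in> borel_measurable (PiM D (\<lambda>_. borel))"
proof -
  have "(\<lambda>\<sigma>. block \<Gamma> u \<sigma>) \<in> borel_measurable (PiM D (\<lambda>_. borel))"
    unfolding block_def passage_time_def
    using assms unfolding support_def
    by (intro borel_measurable_Min borel_measurable_sum measurable_component_singleton) blast+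
  then show ?thesis by simp
qed

lemma block_cong:
  assumes "\<And>e. e \<in> support \<Gamma> u \<Longrightarrow> \<sigma> e = \<sigma>' e"
  shows "block \<Gamma> u \<sigma> = block \<Gamma> u \<sigma>'"
  unfolding block_def passage_time_def
  using assms unfolding support_def by (intro arg_cong[where f = Min] image_cong sum.cong refl) auto

lemma block_shift: "block \<Gamma> u \<sigma> = block \<Gamma> 0 (\<lambda>e. \<sigma> (edge_shift u e))"
  unfolding block_def by simp

lemma ptime_le_block:
  assumes "nonneg_weights \<sigma>" "\<Gamma> \<subseteq> lattice_paths 0 v" "finite \<Gamma>" "\<Gamma> \<noteq> {}"
  shows "ptime \<sigma> u (u + v) \<le> block \<Gamma> u \<sigma>"
proof -
  have "nonneg_weights (\<lambda>e. \<sigma> (edge_shift u e))"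
    using assms(1) edge_shift_lattice_edges unfolding nonneg_weights_def by blast
  from ptime_le_passage_time[OF this subsetD[OF assms(2)]]
  have "ptime (\<lambda>e. \<sigma> (edge_shift u e)) 0 v \<le> block \<Gamma> u \<sigma>"
    unfolding block_def using assms(3,4) by (intro Min.boundedI) auto
  then show ?thesis using ptime_shift[of \<sigma> 0 u v] by (simp add: add.commute)
qed

lemma ptime_chain:
  assumes "nonneg_weights \<sigma>"
  shows "ptime \<sigma> (p 0) (p m) \<le> (\<Sum>j<m. ptime \<sigma> (p j) (p (Suc j)))"
proof (induction m)
  case 0
  then show ?case using ptime_le_sum[OF assms joins_refl, of "{}"] by simp
next
  case (Suc m)
  then show ?case using ptime_triangle[OF assms, of "p 0" "p (Suc m)" "p m"] by simp
qed

lemma norm1_add_le: "norm1 (u + v) \<le> norm1 u + norm1 v"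
proof -
  have "(\<Sum>i\<in>UNIV. \<bar>(u + v) $ i\<bar>) \<le> (\<Sum>i\<in>UNIV. \<bar>u $ i\<bar> + \<bar>v $ i\<bar>)" by (intro sum_mono) simp
  then have "nat (\<Sum>i\<in>UNIV. \<bar>(u + v) $ i\<bar>) \<le> nat ((\<Sum>i\<in>UNIV. \<bar>u $ i\<bar>) + (\<Sum>i\<in>UNIV. \<bar>v $ i\<bar>))"
    by (intro nat_mono) (simp only: sum.distrib)
  then show ?thesis unfolding norm1_def by (simp only: nat_add_distrib sum_nonneg abs_ge_zero)
qed

text \<open>The displacements of the blocks range over such a ball, so that constants chosen for
  each displacement can be made uniform.\<close>

lemma finite_norm1_ball: "finite {v :: int ^ 'n. norm1 v \<le> N}"
proof -
  have "v $ i \<in> {- int N..int N}" if "norm1 v \<le> N" for v :: "int ^ 'n" and i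
  proof -
    have "\<bar>v $ i\<bar> \<le> (\<Sum>i\<in>UNIV. \<bar>v $ i\<bar>)" by (rule member_le_sum) auto
    also have "\<dots> \<le> int N" using that unfolding norm1_def by simp
    finally show ?thesis by auto
  qed
  then have "($) ` {v :: int ^ 'n. norm1 v \<le> N} \<subseteq> PiE UNIV (\<lambda>_. {- int N..int N})" by auto
  then have "finite (($) ` {v :: int ^ 'n. norm1 v \<le> N})"
    by (rule finite_subset) (auto intro: finite_PiE)
  then show ?thesis by (rule finite_imageD) (auto intro: inj_onI simp: vec_eq_iff fun_eq_iff)
qed

lemma path_edge_subset_set: "e \<in> path_edges \<gamma> \<Longrightarrow> e \<subseteq> set \<gamma>"
  unfolding path_edges_def by auto

section \<open>Independence, moments and quality of blocks\<close>

context fpp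
begin

text \<open>Independence of the restricted families carries over to functions of the whole
  configuration, because \<open>cong\<close> makes \<open>G i\<close> read only the edges in
  \<open>D i\<close>.\<close>

lemma indep_vars_local:
  assumes D: "\<And>i. i \<in> L \<Longrightarrow> D i \<subseteq> lattice_edges" "disjoint_family_on D L"
    and G: "\<And>i. i \<in> L \<Longrightarrow> G i \<in> borel_measurable (PiM (D i) (\<lambda>_. borel))"
    and cong: "\<And>i \<sigma> \<sigma>'. i \<in> L \<Longrightarrow> (\<And>e. e \<in> D i \<Longrightarrow> \<sigma> e = \<sigma>' e) \<Longrightarrow> G i \<sigma> = G i \<sigma>'"
  shows "indep_vars (\<lambda>_. borel :: real measure) (\<lambda>i \<omega>. G i (\<lambda>e. \<tau> e \<omega>)) L"
proof -
  have "indep_vars (\<lambda>_. borel) (\<lambda>i \<omega>. G i (\<lambda>e\<in>D i. \<tau> e \<omega>)) L"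
    using indep_vars_compose2[OF indep_vars_restrict[OF indep D] G] .
  moreover have "G i (\<lambda>e\<in>D i. \<tau> e \<omega>) = G i (\<lambda>e. \<tau> e \<omega>)" if "i \<in> L" for i \<omega>
    by (rule cong[OF that]) simp
  ultimately show ?thesis by (subst (asm) indep_vars_cong[OF refl _ refl]) auto
qed

lemma measurable_block:
  assumes "\<Gamma> \<subseteq> lattice_paths 0 v" "finite \<Gamma>"
  shows "(\<lambda>\<omega>. block \<Gamma> u (\<lambda>e. \<tau> e \<omega>)) \<in> borel_measurable M"
  unfolding block_def passage_time_def
  using assms lattice_path_edges edge_shift_lattice_edges
  by (intro borel_measurable_Min borel_measurable_sum measurable_weight) blast+

lemma expectation_block:
  assumes "\<Gamma> \<subseteq> lattice_paths 0 v" "finite \<Gamma>"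
  shows "expectation (\<lambda>\<omega>. block \<Gamma> u (\<lambda>e. \<tau> e \<omega>)) = expectation (\<lambda>\<omega>. block \<Gamma> 0 (\<lambda>e. \<tau> e \<omega>))"
  unfolding block_shift[of \<Gamma> u]
  using assms support_subset[OF assms(1), of 0]
  by (intro expectation_shift measurable_block_PiM block_cong) auto

text \<open>Any single path of the family dominates the minimum, and its translates have the same
  number of edges; this makes the bound uniform in \<open>u\<close>.\<close>

lemma block_moment:
  assumes \<Gamma>: "\<Gamma> \<subseteq> lattice_paths 0 v" "finite \<Gamma>" "\<Gamma> \<noteq> {}"
  shows "\<exists>C\<ge>0. \<forall>u. integrable M (\<lambda>\<omega>. block \<Gamma> u (\<lambda>e. \<tau> e \<omega>)) \<and>
    integrable M (\<lambda>\<omega>. (block \<Gamma> u (\<lambda>e. \<tau> e \<omega>))\<^sup>2) \<and> expectation (\<lambda>\<omega>. (block \<Gamma> u (\<lambda>e. \<tau> e \<omega>))\<^sup>2) \<le> C"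
proof -
  obtain C where C: "C > 0" and sums: "\<And>F. finite F \<Longrightarrow> F \<subseteq> lattice_edges \<Longrightarrow>
     integrable M (\<lambda>\<omega>. \<Sum>e\<in>F. \<tau> e \<omega>) \<and> integrable M (\<lambda>\<omega>. (\<Sum>e\<in>F. \<tau> e \<omega>)\<^sup>2) \<and>
     expectation (\<lambda>\<omega>. \<Sum>e\<in>F. \<tau> e \<omega>) \<le> C * real (card F) \<and>
     expectation (\<lambda>\<omega>. (\<Sum>e\<in>F. \<tau> e \<omega>)\<^sup>2) \<le> C * (real (card F))\<^sup>2"
    using sum_moments by blast
  obtain \<gamma> where \<gamma>: "\<gamma> \<in> \<Gamma>" using \<Gamma> by auto
  define N where "N = real (card (path_edges \<gamma>))"
  have "integrable M (\<lambda>\<omega>. block \<Gamma> u (\<lambda>e. \<tau> e \<omega>)) \<and> integrable M (\<lambda>\<omega>. (block \<Gamma> u (\<lambda>e. \<tau> e \<omega>))\<^sup>2) \<and>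
    expectation (\<lambda>\<omega>. (block \<Gamma> u (\<lambda>e. \<tau> e \<omega>))\<^sup>2) \<le> C * N\<^sup>2" for u
  proof -
    define F where "F = edge_shift u ` path_edges \<gamma>"
    have F: "finite F" "F \<subseteq> lattice_edges"
      unfolding F_def using lattice_path_edges[OF subsetD[OF \<Gamma>(1) \<gamma>]] edge_shift_lattice_edges by (simp, blast)
    have cF: "real (card F) \<le> N" unfolding F_def N_def by (simp add: card_image_le)
    note m = sums[OF F] and [measurable] = measurable_block[OF \<Gamma>(1,2)]
    have le: "block \<Gamma> u (\<lambda>e. \<tau> e \<omega>) \<le> (\<Sum>e\<in>F. \<tau> e \<omega>)" for \<omega>
    proof -
      have "block \<Gamma> u (\<lambda>e. \<tau> e \<omega>) \<le> passage_time (\<lambda>e. \<tau> (edge_shift u e) \<omega>) \<gamma>"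
        unfolding block_def using \<gamma> \<Gamma> by (intro Min_le) auto
      also have "\<dots> = (\<Sum>e\<in>F. \<tau> e \<omega>)" unfolding F_def passage_time_def
        by (subst sum.reindex) (auto intro: inj_on_subset[OF inj_edge_shift])
      finally show ?thesis .
    qed
    have ge: "0 \<le> block \<Gamma> u (\<lambda>e. \<tau> e \<omega>)" if "\<omega> \<in> space M" for \<omega>
      using ptime_nonneg[of "\<lambda>e. \<tau> e \<omega>" u "u + v"] ptime_le_block[OF nonneg_weights[OF that] \<Gamma>, of u] nonneg_weights[OF that]
      by linarith
    have sq: "(block \<Gamma> u (\<lambda>e. \<tau> e \<omega>))\<^sup>2 \<le> (\<Sum>e\<in>F. \<tau> e \<omega>)\<^sup>2" if "\<omega> \<in> space M" for \<omega>
      using ge[OF that] le[of \<omega>] by (intro power_mono)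
    have i1: "integrable M (\<lambda>\<omega>. block \<Gamma> u (\<lambda>e. \<tau> e \<omega>))"
      by (rule Bochner_Integration.integrable_bound[OF m[THEN conjunct1]])
         (use ge order_trans[OF le abs_ge_self] in \<open>auto intro!: AE_I2\<close>)
    have i2: "integrable M (\<lambda>\<omega>. (block \<Gamma> u (\<lambda>e. \<tau> e \<omega>))\<^sup>2)"
      by (rule Bochner_Integration.integrable_bound[OF m[THEN conjunct2, THEN conjunct1]])
         (use sq in \<open>auto intro!: AE_I2\<close>)
    have "expectation (\<lambda>\<omega>. (block \<Gamma> u (\<lambda>e. \<tau> e \<omega>))\<^sup>2) \<le> expectation (\<lambda>\<omega>. (\<Sum>e\<in>F. \<tau> e \<omega>)\<^sup>2)"
      using i2 m sq by (intro integral_mono) auto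
    also have "\<dots> \<le> C * (real (card F))\<^sup>2" using m by blast
    also have "\<dots> \<le> C * N\<^sup>2" using C cF by (intro mult_left_mono power_mono) auto
    finally show ?thesis using i1 i2 by simp
  qed
  then show ?thesis using C by (intro exI[of _ "C * N\<^sup>2"]) auto
qed

text \<open>There are countably many paths, so minima over longer and longer initial parts of an
  enumeration decrease to the infimum. The first path dominates them all, hence the means converge.
  The additive 1 becomes negligible for long blocks.\<close>

lemma finite_path_approximation:
  "\<exists>\<Gamma>. finite \<Gamma> \<and> \<Gamma> \<noteq> {} \<and> \<Gamma> \<subseteq> lattice_paths 0 v \<and>
     expectation (\<lambda>\<omega>. block \<Gamma> 0 (\<lambda>e. \<tau> e \<omega>)) \<le> expectation (\<lambda>\<omega>. T \<omega> 0 v) + 1"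
proof -
  define g where "g = from_nat_into (lattice_paths 0 v)"
  have g: "range g = lattice_paths 0 v"
    unfolding g_def by (rule range_from_nat_into) (auto simp: lattice_paths_nonempty)
  define \<Gamma> where "\<Gamma> N = g ` {..N}" for N :: nat
  have \<Gamma>: "finite (\<Gamma> N)" "\<Gamma> N \<noteq> {}" "\<Gamma> N \<subseteq> lattice_paths 0 v" for N
    unfolding \<Gamma>_def using g by auto
  have le: "block (\<Gamma> N) 0 \<sigma> \<le> passage_time \<sigma> (g k)" if "k \<le> N" for N k \<sigma>
    unfolding block_def using that \<Gamma>(1) by (intro Min_le) (auto simp: \<Gamma>_def)
  have ge: "T \<omega> 0 v \<le> block (\<Gamma> N) 0 (\<lambda>e. \<tau> e \<omega>)" if "\<omega> \<in> space M" for N \<omega>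
    using ptime_le_block[OF nonneg_weights[OF that] \<Gamma>(3,1,2), of 0] by simp
  have T0: "0 \<le> T \<omega> 0 v" if "\<omega> \<in> space M" for \<omega> using ptime_nonneg[OF nonneg_weights[OF that]] .
  have conv: "(\<lambda>N. block (\<Gamma> N) 0 (\<lambda>e. \<tau> e \<omega>)) \<longlonglongrightarrow> T \<omega> 0 v" if w: "\<omega> \<in> space M" for \<omega>
  proof (rule tendstoI)
    fix \<delta> :: real assume "\<delta> > 0"
    then have "(INF \<gamma>\<in>lattice_paths 0 v. passage_time (\<lambda>e. \<tau> e \<omega>) \<gamma>) < T \<omega> 0 v + \<delta>"
      unfolding ptime_def by simp
    then have "\<exists>\<gamma>\<in>lattice_paths 0 v. passage_time (\<lambda>e. \<tau> e \<omega>) \<gamma> < T \<omega> 0 v + \<delta>"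
      by (subst (asm) cINF_less_iff[OF lattice_paths_nonempty bdd_below_passage_time[OF nonneg_weights[OF w]]])
    then obtain \<gamma> where \<gamma>: "\<gamma> \<in> range g" "passage_time (\<lambda>e. \<tau> e \<omega>) \<gamma> < T \<omega> 0 v + \<delta>"
      unfolding g by auto
    from \<gamma>(1) obtain k where "\<gamma> = g k" by auto
    with \<gamma> have k: "passage_time (\<lambda>e. \<tau> e \<omega>) (g k) < T \<omega> 0 v + \<delta>" by simp
    show "\<forall>\<^sub>F N in sequentially. dist (block (\<Gamma> N) 0 (\<lambda>e. \<tau> e \<omega>)) (T \<omega> 0 v) < \<delta>"
    proof (rule eventually_sequentiallyI)
      fix N assume "k \<le> N"
      then show "dist (block (\<Gamma> N) 0 (\<lambda>e. \<tau> e \<omega>)) (T \<omega> 0 v) < \<delta>"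
        using le[of k N "\<lambda>e. \<tau> e \<omega>"] ge[OF w, of N] k by (simp add: dist_real_def)
    qed
  qed
  have int: "integrable M (\<lambda>\<omega>. block (\<Gamma> 0) 0 (\<lambda>e. \<tau> e \<omega>))"
    using block_moment[OF \<Gamma>(3,1,2)[of 0]] by blast
  have mono: "block (\<Gamma> N) 0 \<sigma> \<le> block (\<Gamma> 0) 0 \<sigma>" for N \<sigma>
  proof -
    have "block (\<Gamma> 0) 0 \<sigma> = passage_time \<sigma> (g 0)" unfolding block_def \<Gamma>_def by simp
    then show ?thesis using le[of 0 N \<sigma>] by simp
  qed
  have "(\<lambda>N. expectation (\<lambda>\<omega>. block (\<Gamma> N) 0 (\<lambda>e. \<tau> e \<omega>))) \<longlonglongrightarrow> expectation (\<lambda>\<omega>. T \<omega> 0 v)"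
  proof (rule integral_dominated_convergence[OF _ _ int])
    show "AE \<omega> in M. norm (block (\<Gamma> N) 0 (\<lambda>e. \<tau> e \<omega>)) \<le> block (\<Gamma> 0) 0 (\<lambda>e. \<tau> e \<omega>)" for N
    proof (rule AE_I2)
      fix \<omega> assume "\<omega> \<in> space M"
      then show "norm (block (\<Gamma> N) 0 (\<lambda>e. \<tau> e \<omega>)) \<le> block (\<Gamma> 0) 0 (\<lambda>e. \<tau> e \<omega>)"
        using T0[of \<omega>] ge[of \<omega> N] mono[of N "\<lambda>e. \<tau> e \<omega>"] by simp
    qed
    show "(\<lambda>\<omega>. block (\<Gamma> N) 0 (\<lambda>e. \<tau> e \<omega>)) \<in> borel_measurable M" for N
      by (rule measurable_block[OF \<Gamma>(3,1)])
    show "AE \<omega> in M. (\<lambda>N. block (\<Gamma> N) 0 (\<lambda>e. \<tau> e \<omega>)) \<longlonglongrightarrow> T \<omega> 0 v"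
      using conv by (rule AE_I2)
  qed simp
  then have "\<forall>\<^sub>F N in sequentially. expectation (\<lambda>\<omega>. block (\<Gamma> N) 0 (\<lambda>e. \<tau> e \<omega>)) < expectation (\<lambda>\<omega>. T \<omega> 0 v) + 1"
    by (rule order_tendstoD) simp
  then obtain N where "expectation (\<lambda>\<omega>. block (\<Gamma> N) 0 (\<lambda>e. \<tau> e \<omega>)) < expectation (\<lambda>\<omega>. T \<omega> 0 v) + 1"
    by (auto simp: eventually_sequentially)
  then show ?thesis using \<Gamma>[of N] by (intro exI[of _ "\<Gamma> N"]) auto
qed

end

lemma support_vertex:
  assumes "\<And>\<gamma> q l. \<gamma> \<in> \<Gamma> \<Longrightarrow> q \<in> set \<gamma> \<Longrightarrow> \<bar>q $ l\<bar> \<le> b" "e \<in> support \<Gamma> u" "q \<in> e"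
  shows "\<bar>q $ l - u $ l\<bar> \<le> b"
proof -
  obtain \<gamma> e' where e': "\<gamma> \<in> \<Gamma>" "e' \<in> path_edges \<gamma>" "e = edge_shift u e'"
    using assms(2) unfolding support_def by auto
  obtain q' where "q' \<in> e'" "q = q' + u" using e'(3) assms(3) unfolding edge_shift_def by auto
  moreover have "q' \<in> set \<gamma>" using path_edge_subset_set[OF e'(2)] \<open>q' \<in> e'\<close> by auto
  ultimately show ?thesis using assms(1)[OF e'(1), of q' l] by simp
qed

lemma lattice_edges_vertex: "e \<in> lattice_edges \<Longrightarrow> \<exists>q. q \<in> e"
  unfolding lattice_edges_def by auto

text \<open>A block reads only edges within distance \<open>b\<close> of its base point in each
  coordinate. A common edge would supply a vertex close to both base points.\<close>

lemma supports_disjoint: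
  assumes "\<And>\<gamma> q l. \<gamma> \<in> \<Gamma> \<Longrightarrow> q \<in> set \<gamma> \<Longrightarrow> \<bar>q $ l\<bar> \<le> b" "\<And>\<gamma> q l. \<gamma> \<in> \<Gamma>' \<Longrightarrow> q \<in> set \<gamma> \<Longrightarrow> \<bar>q $ l\<bar> \<le> b"
    and "\<Gamma> \<subseteq> lattice_paths 0 v" "\<bar>u $ l - u' $ l\<bar> > 2 * b"
  shows "support \<Gamma> u \<inter> support \<Gamma>' u' = {}"
proof (rule ccontr)
  assume "\<not> ?thesis"
  then obtain e where e: "e \<in> support \<Gamma> u" "e \<in> support \<Gamma>' u'" by auto
  obtain q where q: "q \<in> e" using lattice_edges_vertex support_subset[OF assms(3)] e(1) by blast
  have "\<bar>q $ l - u $ l\<bar> \<le> b" "\<bar>q $ l - u' $ l\<bar> \<le> b"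
    by (rule support_vertex[OF assms(1) e(1) q], assumption+, rule support_vertex[OF assms(2) e(2) q], assumption+)
  then show False using assms(4) by linarith
qed

text \<open>Cutting n into \<open>m\<close> equal pieces of real length avoids a short remainder;
  the price is that the length is only known to lie in \<open>[k, 2k]\<close>.\<close>

lemma partition_step:
  fixes k :: real and n :: nat
  assumes "k > 0" "real n \<ge> k"
  defines "m \<equiv> nat \<lfloor>real n / k\<rfloor>"
  shows "m \<ge> 1" "real m \<le> real n / k" "real n / real m \<in> {k..2 * k}"
proof -
  have t: "real n / k \<ge> 1" using assms by (simp add: field_simps)
  have m: "real m \<le> real n / k" "real n / k < real m + 1" unfolding m_def using t by linarith+
  then have "real m > 0" using t by linarith
  then have m1: "real m \<ge> 1" by simp
  then show "m \<ge> 1" by simp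
  show "real m \<le> real n / k" by fact
  have "real n \<le> (real m + 1) * k" using m(2) assms by (simp add: field_simps)
  also have "\<dots> \<le> (2 * real m) * k" using m1 assms by (intro mult_right_mono) auto
  finally have "real n / real m \<le> 2 * k" using m1 by (simp add: field_simps)
  moreover have "k \<le> real n / real m"
  proof -
    have "real m * k \<le> real n" using m(1) pos_le_divide_eq[OF assms(1)] by blast
    then have "k * real m \<le> real n" by (simp only: mult.commute)
    then show ?thesis using m1 by (subst pos_le_divide_eq) linarith+
  qed
  ultimately show "real n / real m \<in> {k..2 * k}" by simp
qed

section \<open>Chaining blocks into independent tubes\<close>

context fpp
begin

definition good_block :: "(int ^ 'n) list set \<Rightarrow> int ^ 'n \<Rightarrow> int \<Rightarrow> real \<Rightarrow> real \<Rightarrow> bool" where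
  "good_block \<Gamma> v b C \<zeta> \<longleftrightarrow> finite \<Gamma> \<and> \<Gamma> \<noteq> {} \<and> \<Gamma> \<subseteq> lattice_paths 0 v \<and>
    (\<forall>\<gamma>\<in>\<Gamma>. \<forall>q\<in>set \<gamma>. \<forall>l. \<bar>q $ l\<bar> \<le> b) \<and>
    (\<forall>u. expectation (\<lambda>\<omega>. block \<Gamma> u (\<lambda>e. \<tau> e \<omega>)) \<le> \<zeta> \<and> integrable M (\<lambda>\<omega>. block \<Gamma> u (\<lambda>e. \<tau> e \<omega>)) \<and>
      integrable M (\<lambda>\<omega>. (block \<Gamma> u (\<lambda>e. \<tau> e \<omega>))\<^sup>2) \<and>
      expectation (\<lambda>\<omega>. (block \<Gamma> u (\<lambda>e. \<tau> e \<omega>))\<^sup>2) \<le> C)"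

text \<open>Through rounding the displacement of a block depends on its position \<open>t\<close>,
  but over all \<open>t\<close> and all lengths in \<open>[k, 2k]\<close> only finitely many values
  occur. One reach \<open>b\<close> and one second moment bound \<open>C\<close> therefore serve
  every block.\<close>

lemma good_blocks_exist:
  assumes "\<epsilon> > 0"
  shows "\<exists>k \<Gamma> b C. k \<ge> 1 \<and> b \<ge> 0 \<and> C \<ge> 0 \<and> (\<forall>s t. s \<in> {k..2 * k} \<longrightarrow>
    good_block (\<Gamma> (floor_vec ((t + s) *\<^sub>R x) - floor_vec (t *\<^sub>R x))) (floor_vec ((t + s) *\<^sub>R x) - floor_vec (t *\<^sub>R x))
      b C (s * (time_constant M \<tau> x + \<epsilon>)))"
proof -
  define \<mu> where "\<mu> = time_constant M \<tau> x"
  define d where "d = real CARD('n)"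
  obtain C1 where C1: "C1 > 0" "\<And>u v. expectation (\<lambda>\<omega>. T \<omega> u v) \<le> C1 * real (norm1 (v - u))"
    using T_moments by blast
  have "\<forall>\<^sub>F s in at_top. meanT x s / s < \<mu> + \<epsilon> / 2"
    using assms order_tendstoD(2)[OF mean_tendsto_time_constant(1)[of x], of "\<mu> + \<epsilon> / 2"] by (simp add: \<mu>_def)
  then obtain k0 where k0: "\<And>s. s \<ge> k0 \<Longrightarrow> meanT x s / s < \<mu> + \<epsilon> / 2"
    by (auto simp: eventually_at_top_linorder)
  \<comment> \<open>Beyond \<open>k0\<close> half of \<open>\<epsilon>\<close> covers the
    convergence of the mean. The other half, accumulated over the length \<open>k\<close>, pays for
    the fixed errors: \<open>C1 * d\<close> for rounding the endpoint and 1 for passing to finitely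
    many paths.\<close>
  define k where "k = max 1 (max k0 (2 * (C1 * d + 1) / \<epsilon>))"
  have k: "k \<ge> 1" "k \<ge> k0" "C1 * d + 1 \<le> k * (\<epsilon> / 2)"
  proof -
    have "2 * (C1 * d + 1) / \<epsilon> \<le> k" unfolding k_def by simp
    then show "C1 * d + 1 \<le> k * (\<epsilon> / 2)" using assms by (simp add: field_simps)
  qed (auto simp: k_def)
  \<comment> \<open>One \<open>d\<close> belongs to the floor of \<open>s *\<^sub>R x\<close>, the
    other to the rounding difference \<open>v - w\<close>.\<close>
  define N where "N = nat \<lceil>2 * d + (\<Sum>i\<in>UNIV. \<bar>x $ i\<bar>) * (2 * k)\<rceil>"
  define V where "V = {v :: int ^ 'n. norm1 v \<le> N}"
  have V: "finite V" unfolding V_def by (rule finite_norm1_ball)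
  obtain \<Gamma> where \<Gamma>: "\<And>v. finite (\<Gamma> v)" "\<And>v. \<Gamma> v \<noteq> {}" "\<And>v. \<Gamma> v \<subseteq> lattice_paths 0 v"
    "\<And>v. expectation (\<lambda>\<omega>. block (\<Gamma> v) 0 (\<lambda>e. \<tau> e \<omega>)) \<le> expectation (\<lambda>\<omega>. T \<omega> 0 v) + 1"
  proof -
    obtain \<Gamma> where "\<forall>v. finite (\<Gamma> v) \<and> \<Gamma> v \<noteq> {} \<and> \<Gamma> v \<subseteq> lattice_paths 0 v \<and>
     expectation (\<lambda>\<omega>. block (\<Gamma> v) 0 (\<lambda>e. \<tau> e \<omega>)) \<le> expectation (\<lambda>\<omega>. T \<omega> 0 v) + 1"
      using choice[OF allI[OF finite_path_approximation]] by (rule exE)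
    then show ?thesis by (intro that[of \<Gamma>]) auto
  qed
  define Q where "Q = (\<Union>v\<in>V. \<Union>\<gamma>\<in>\<Gamma> v. \<Union>q\<in>set \<gamma>. (\<lambda>l. \<bar>q $ l\<bar>) ` UNIV)"
  have Q: "finite Q" unfolding Q_def using V \<Gamma>(1) by auto
  define b where "b = Max (insert 0 Q)"
  have b: "b \<ge> 0" "\<And>v \<gamma> q l. v \<in> V \<Longrightarrow> \<gamma> \<in> \<Gamma> v \<Longrightarrow> q \<in> set \<gamma> \<Longrightarrow> \<bar>q $ l\<bar> \<le> b"
  proof -
    show "b \<ge> 0" unfolding b_def using Q by simp
    show "\<bar>q $ l\<bar> \<le> b" if "v \<in> V" "\<gamma> \<in> \<Gamma> v" "q \<in> set \<gamma>" for v \<gamma> q l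
    proof -
      have "\<bar>q $ l\<bar> \<in> Q" unfolding Q_def using that by blast
      then show ?thesis unfolding b_def using Q by simp
    qed
  qed
  have "\<forall>v. \<exists>C\<ge>0. \<forall>u. integrable M (\<lambda>\<omega>. block (\<Gamma> v) u (\<lambda>e. \<tau> e \<omega>)) \<and>
    integrable M (\<lambda>\<omega>. (block (\<Gamma> v) u (\<lambda>e. \<tau> e \<omega>))\<^sup>2) \<and> expectation (\<lambda>\<omega>. (block (\<Gamma> v) u (\<lambda>e. \<tau> e \<omega>))\<^sup>2) \<le> C"
    by (intro allI block_moment[OF \<Gamma>(3,1,2)])
  from choice[OF this] obtain C0 where C0: "\<And>v. C0 v \<ge> 0" "\<And>v u. integrable M (\<lambda>\<omega>. block (\<Gamma> v) u (\<lambda>e. \<tau> e \<omega>))"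
    "\<And>v u. integrable M (\<lambda>\<omega>. (block (\<Gamma> v) u (\<lambda>e. \<tau> e \<omega>))\<^sup>2)"
    "\<And>v u. expectation (\<lambda>\<omega>. (block (\<Gamma> v) u (\<lambda>e. \<tau> e \<omega>))\<^sup>2) \<le> C0 v"
    by auto
  define C where "C = (\<Sum>v\<in>V. C0 v)"
  have C: "C \<ge> 0" "\<And>v. v \<in> V \<Longrightarrow> C0 v \<le> C"
    unfolding C_def using C0(1) V by (auto intro: sum_nonneg member_le_sum)
  have "good_block (\<Gamma> v) v b C (s * (\<mu> + \<epsilon>))"
    if s: "s \<in> {k..2 * k}" and v: "v = floor_vec ((t + s) *\<^sub>R x) - floor_vec (t *\<^sub>R x)" for s t v
  proof -
    define w where "w = floor_vec (s *\<^sub>R x)"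
    have s0: "s \<ge> 0" using s k(1) by auto
    have vw: "real (norm1 (v - w)) \<le> d"
      using norm1_floor_vec_add[of t s x] unfolding v w_def d_def by (simp add: diff_diff_eq)
    have w: "real (norm1 w) \<le> d + (\<Sum>i\<in>UNIV. \<bar>x $ i\<bar>) * (2 * k)"
    proof -
      have "real (norm1 w) \<le> d + (\<Sum>i\<in>UNIV. \<bar>x $ i\<bar>) * s"
        using norm1_floor_vec[OF s0, of x] by (simp add: w_def d_def)
      also have "\<dots> \<le> d + (\<Sum>i\<in>UNIV. \<bar>x $ i\<bar>) * (2 * k)"
        using s by (intro add_left_mono mult_left_mono sum_nonneg) auto
      finally show ?thesis .
    qed
    have "real (norm1 v) \<le> real (norm1 w) + real (norm1 (v - w))"
      using norm1_add_le[of w "v - w"] by simp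
    also have "\<dots> \<le> 2 * d + (\<Sum>i\<in>UNIV. \<bar>x $ i\<bar>) * (2 * k)" using vw w by simp
    finally have vV: "v \<in> V" unfolding V_def N_def by simp linarith
    have "expectation (\<lambda>\<omega>. T \<omega> 0 v) \<le> meanT x s + C1 * d"
    proof -
      have "C1 * real (norm1 (v - w)) \<le> C1 * d" using vw C1(1) by (intro mult_left_mono) auto
      then show ?thesis using expectation_T_triangle[of 0 v w] C1(2)[of w v] by (simp add: w_def)
    qed
    also have "meanT x s \<le> s * (\<mu> + \<epsilon> / 2)" using k0[of s] s k by (auto simp: field_simps)
    also have "C1 * d \<le> s * (\<epsilon> / 2) - 1"
    proof -
      have "k * (\<epsilon> / 2) \<le> s * (\<epsilon> / 2)" using s assms by (intro mult_right_mono) auto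
      then show ?thesis using k(3) by simp
    qed
    finally have "expectation (\<lambda>\<omega>. T \<omega> 0 v) + 1 \<le> s * (\<mu> + \<epsilon>)" by (simp add: algebra_simps)
    then have "expectation (\<lambda>\<omega>. block (\<Gamma> v) u (\<lambda>e. \<tau> e \<omega>)) \<le> s * (\<mu> + \<epsilon>)" for u
      using \<Gamma>(4)[of v] expectation_block[OF \<Gamma>(3,1), of v u] by simp
    then show ?thesis unfolding good_block_def
      using \<Gamma>(1,2,3) b(2)[OF vV] C0(2,3) order_trans[OF C0(4) C(2)[OF vV]] by (intro conjI ballI allI)
  qed
  then show ?thesis using k(1) b(1) C(1) unfolding \<mu>_def
    by (intro exI[of _ k] exI[of _ \<Gamma>] exI[of _ b] exI[of _ C] conjI allI impI) auto
qed

text \<open>Blocks whose indices differ by more than \<open>R\<close> read disjoint edges, so after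
  centering they are uncorrelated; pairs of nearer blocks are controlled by their second
  moments.\<close>

lemma one_tube_tail:
  assumes good: "\<And>j. j < m \<Longrightarrow> good_block (\<Gamma> j) (v j) b C \<zeta>" and C: "C \<ge> 0"
    and far: "\<And>i j. i < m \<Longrightarrow> j < m \<Longrightarrow> i + R < j \<Longrightarrow> \<exists>l. \<bar>p i $ l - p j $ l\<bar> > 2 * b"
    and h: "h > 0"
  shows "prob {\<omega> \<in> space M. real m * \<zeta> + h < (\<Sum>j<m. block (\<Gamma> j) (p j) (\<lambda>e. \<tau> e \<omega>))}
     \<le> real m * (2 * real R + 1) * C / h\<^sup>2"
proof -
  define X where "X j \<omega> = block (\<Gamma> j) (p j) (\<lambda>e. \<tau> e \<omega>)" for j \<omega>
  define Z where "Z j \<omega> = X j \<omega> - expectation (X j)" for j \<omega>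
  have X: "integrable M (X j)" "integrable M (\<lambda>\<omega>. (X j \<omega>)\<^sup>2)" "expectation (\<lambda>\<omega>. (X j \<omega>)\<^sup>2) \<le> C"
    "expectation (X j) \<le> \<zeta>" if "j < m" for j
    using good[OF that] unfolding X_def good_block_def by auto
  have sub: "support (\<Gamma> j) (p j) \<subseteq> lattice_edges" if "j < m" for j
    using good[OF that] support_subset unfolding good_block_def by blast
  have iZ: "integrable M (Z j)" and EZ: "expectation (Z j) = 0" if "j < m" for j
    unfolding Z_def using X(1)[OF that] by (simp_all add: prob_space)
  have Zsq: "(Z j \<omega>)\<^sup>2 = (X j \<omega>)\<^sup>2 + (- (2 * expectation (X j)) * X j \<omega> + (expectation (X j))\<^sup>2)" for j \<omega>
    unfolding Z_def by (simp add: power2_eq_square algebra_simps)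
  have iZ2: "integrable M (\<lambda>\<omega>. (Z j \<omega>)\<^sup>2)" if "j < m" for j
    unfolding Zsq using X[OF that] by simp
  have EZ2: "expectation (\<lambda>\<omega>. (Z j \<omega>)\<^sup>2) \<le> C" if "j < m" for j
  proof -
    have "expectation (\<lambda>\<omega>. (Z j \<omega>)\<^sup>2) = expectation (\<lambda>\<omega>. (X j \<omega>)\<^sup>2) - (expectation (X j))\<^sup>2"
      unfolding Zsq using X[OF that] by (simp add: prob_space power2_eq_square)
    also have "\<dots> \<le> expectation (\<lambda>\<omega>. (X j \<omega>)\<^sup>2)" by simp
    also have "\<dots> \<le> C" using X(3)[OF that] .
    finally show ?thesis .
  qed
  have unc: "expectation (\<lambda>\<omega>. Z i \<omega> * Z j \<omega>) = 0" if ij: "i < m" "j < m" "i + R < j" for i j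
  proof -
    obtain l where l: "\<bar>p i $ l - p j $ l\<bar> > 2 * b" using far[OF ij] by blast
    note gi = good[OF ij(1), unfolded good_block_def] and gj = good[OF ij(2), unfolded good_block_def]
    have dis: "support (\<Gamma> i) (p i) \<inter> support (\<Gamma> j) (p j) = {}"
      using gi gj l by (intro supports_disjoint[where b = b and l = l]) auto
    have "indep_vars (\<lambda>_. borel :: real measure) (\<lambda>j' \<omega>. (\<lambda>\<sigma>. block (\<Gamma> j') (p j') \<sigma> - expectation (X j')) (\<lambda>e. \<tau> e \<omega>)) {i, j}"
    proof (rule indep_vars_local[where D = "\<lambda>j. support (\<Gamma> j) (p j)"])
      show "disjoint_family_on (\<lambda>j. support (\<Gamma> j) (p j)) {i, j}"
        unfolding disjoint_family_on_def using dis by auto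
    next
      fix j' and \<sigma> \<sigma>' :: "(int ^ 'n) set \<Rightarrow> real"
      assume "j' \<in> {i, j}" "\<And>e. e \<in> support (\<Gamma> j') (p j') \<Longrightarrow> \<sigma> e = \<sigma>' e"
      then show "block (\<Gamma> j') (p j') \<sigma> - expectation (X j') = block (\<Gamma> j') (p j') \<sigma>' - expectation (X j')"
        using block_cong[of "\<Gamma> j'" "p j'" \<sigma> \<sigma>'] by simp
    next
      fix j' assume j': "j' \<in> {i, j}"
      then have "j' < m" using ij by auto
      then show "support (\<Gamma> j') (p j') \<subseteq> lattice_edges" by (rule sub)
      have "finite (\<Gamma> j')" using j' gi gj by auto
      then show "(\<lambda>\<sigma>. block (\<Gamma> j') (p j') \<sigma> - expectation (X j')) \<in> borel_measurable (PiM (support (\<Gamma> j') (p j')) (\<lambda>_. borel))"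
        using measurable_block_PiM[of "\<Gamma> j'" "p j'" "support (\<Gamma> j') (p j')"] by simp
    qed
    then have iv: "indep_vars (\<lambda>_. borel) Z {i, j}" unfolding Z_def X_def by simp
    have "i \<noteq> j" using ij by simp
    then have "expectation (\<lambda>\<omega>. Z i \<omega> * Z j \<omega>) = expectation (\<lambda>\<omega>. \<Prod>j'\<in>{i, j}. Z j' \<omega>)" by simp
    also have "\<dots> = (\<Prod>j'\<in>{i, j}. expectation (Z j'))"
      using iZ ij by (intro indep_vars_lebesgue_integral[OF _ iv]) auto
    also have "\<dots> = 0" using EZ ij \<open>i \<noteq> j\<close> by simp
    finally show ?thesis .
  qed
  have sum: "(\<Sum>j<m. expectation (X j)) \<le> real m * \<zeta>"
    using sum_mono[of "{..<m}" "\<lambda>j. expectation (X j)" "\<lambda>_. \<zeta>"] X(4) by simp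
  have "prob {\<omega> \<in> space M. real m * \<zeta> + h < (\<Sum>j<m. X j \<omega>)} \<le> prob {\<omega> \<in> space M. h < (\<Sum>j<m. Z j \<omega>)}"
  proof (rule finite_measure_mono)
    have [measurable]: "(\<lambda>\<omega>. \<Sum>j<m. Z j \<omega>) \<in> borel_measurable M" using iZ by (intro borel_measurable_sum) auto
    show "{\<omega> \<in> space M. h < (\<Sum>j<m. Z j \<omega>)} \<in> events" by measurable
    show "{\<omega> \<in> space M. real m * \<zeta> + h < (\<Sum>j<m. X j \<omega>)} \<subseteq> {\<omega> \<in> space M. h < (\<Sum>j<m. Z j \<omega>)}"
      using sum unfolding Z_def sum_subtractf by auto
  qed
  also have "\<dots> \<le> real m * (2 * real R + 1) * C / h\<^sup>2"
    using iZ iZ2 EZ2 C unc h by (intro finite_range_dependent_sum_tail) auto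
  finally show ?thesis unfolding X_def .
qed

text \<open>Different tubes read disjoint sets of edges, so the probabilities multiply.\<close>

lemma many_tubes_tail:
  fixes \<Gamma> :: "nat \<Rightarrow> (int ^ 'n) list set"
  assumes good: "\<And>j. j < m \<Longrightarrow> finite (\<Gamma> j) \<and> \<Gamma> j \<subseteq> lattice_paths 0 (v j)"
    and dis: "\<And>i i' j j'. i \<noteq> i' \<Longrightarrow> j < m \<Longrightarrow> j' < m \<Longrightarrow> support (\<Gamma> j) (p i j) \<inter> support (\<Gamma> j') (p i' j') = {}"
    and one: "\<And>i. prob {\<omega> \<in> space M. \<theta> < (\<Sum>j<m. block (\<Gamma> j) (p i j) (\<lambda>e. \<tau> e \<omega>))} \<le> q"
  shows "prob {\<omega> \<in> space M. \<forall>i\<in>{1..K}. \<theta> < (\<Sum>j<m. block (\<Gamma> j) (p i j) (\<lambda>e. \<tau> e \<omega>))} \<le> q ^ K"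
proof (cases "K = 0")
  case False
  define D where "D i = (\<Union>j<m. support (\<Gamma> j) (p i j))" for i
  define S where "S i \<sigma> = (\<Sum>j<m. block (\<Gamma> j) (p i j) \<sigma>)" for i \<sigma>
  have iv: "indep_vars (\<lambda>_. borel :: real measure) (\<lambda>i \<omega>. S i (\<lambda>e. \<tau> e \<omega>)) {1..K}"
  proof (rule indep_vars_local[where D = D])
    show "D i \<subseteq> lattice_edges" for i
      unfolding D_def using good support_subset by blast
    show "disjoint_family_on D {1..K}"
      unfolding disjoint_family_on_def D_def using dis by blast
    show "S i \<in> borel_measurable (PiM (D i) (\<lambda>_. borel))" for i
    proof -
      have "(\<lambda>\<sigma>. S i \<sigma>) \<in> borel_measurable (PiM (D i) (\<lambda>_. borel))"
        unfolding S_def using good by (intro borel_measurable_sum measurable_block_PiM) (auto simp: D_def)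
      then show ?thesis by simp
    qed
    fix i and \<sigma> \<sigma>' :: "(int ^ 'n) set \<Rightarrow> real" assume "\<And>e. e \<in> D i \<Longrightarrow> \<sigma> e = \<sigma>' e"
    then show "S i \<sigma> = S i \<sigma>'"
      unfolding S_def D_def by (intro sum.cong refl block_cong) auto
  qed
  have eq: "{\<omega> \<in> space M. \<forall>i\<in>{1..K}. \<theta> < S i (\<lambda>e. \<tau> e \<omega>)} =
      (\<Inter>i\<in>{1..K}. (\<lambda>\<omega>. S i (\<lambda>e. \<tau> e \<omega>)) -` {\<theta><..} \<inter> space M)"
    using False by auto
  have "prob {\<omega> \<in> space M. \<forall>i\<in>{1..K}. \<theta> < S i (\<lambda>e. \<tau> e \<omega>)} =
      (\<Prod>i\<in>{1..K}. prob ((\<lambda>\<omega>. S i (\<lambda>e. \<tau> e \<omega>)) -` {\<theta><..} \<inter> space M))"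
    unfolding eq using False by (intro indep_varsD_finite[OF iv]) auto
  also have "\<dots> \<le> (\<Prod>i\<in>{1..K}. q)"
  proof (intro prod_mono conjI)
    fix i
    have "(\<lambda>\<omega>. S i (\<lambda>e. \<tau> e \<omega>)) -` {\<theta><..} \<inter> space M = {\<omega> \<in> space M. \<theta> < S i (\<lambda>e. \<tau> e \<omega>)}" by auto
    then show "prob ((\<lambda>\<omega>. S i (\<lambda>e. \<tau> e \<omega>)) -` {\<theta><..} \<inter> space M) \<le> q"
      using one[of i] by (simp add: S_def)
  qed simp
  finally show ?thesis unfolding S_def by simp
qed (use prob_le_1 in simp)

end

lemma floor_diff_bounds:
  fixes u v :: real
  shows "\<bar>u - v\<bar> - 1 < \<bar>real_of_int (\<lfloor>u\<rfloor> - \<lfloor>v\<rfloor>)\<bar>" "\<bar>real_of_int (\<lfloor>u\<rfloor> - \<lfloor>v\<rfloor>)\<bar> < \<bar>u - v\<bar> + 1"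
  by linarith+

context fpp
begin

text \<open>The bound is uniform in \<open>K\<close> beyond one threshold for n, since the number of
  tubes will be chosen as a function of n.\<close>

lemma parallel_tubes:
  assumes xa: "x $ a \<noteq> 0" and ac: "a \<noteq> c" and \<epsilon>: "\<epsilon> > 0"
  shows "\<exists>W q. W \<ge> (1::nat) \<and> q \<longlonglongrightarrow> 0 \<and> (\<forall>\<^sub>F n in sequentially. \<forall>K.
     prob {\<omega> \<in> space M. \<forall>i\<in>{1..K}. real n * (time_constant M \<tau> x + \<epsilon>) <
       T \<omega> (axis c (int (i * W))) (axis c (int (i * W)) + floor_vec (real n *\<^sub>R x))} \<le> q n ^ K)"
proof -
  define \<mu> where "\<mu> = time_constant M \<tau> x"
  from good_blocks_exist[OF half_gt_zero[OF \<epsilon>], of x]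
  obtain k \<Gamma> b C where kk: "k \<ge> 1 \<and> b \<ge> 0 \<and> C \<ge> 0 \<and> (\<forall>s t. s \<in> {k..2 * k} \<longrightarrow>
    good_block (\<Gamma> (floor_vec ((t + s) *\<^sub>R x) - floor_vec (t *\<^sub>R x))) (floor_vec ((t + s) *\<^sub>R x) - floor_vec (t *\<^sub>R x))
      b C (s * (\<mu> + \<epsilon> / 2)))"
    unfolding \<mu>_def by (elim exE)
  then have k: "k \<ge> 1" and b: "b \<ge> 0" and C: "C \<ge> 0" by blast+
  have good: "good_block (\<Gamma> (floor_vec ((t + s) *\<^sub>R x) - floor_vec (t *\<^sub>R x))) (floor_vec ((t + s) *\<^sub>R x) - floor_vec (t *\<^sub>R x))
      b C (s * (\<mu> + \<epsilon> / 2))" if "s \<in> {k..2 * k}" for s t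
    using kk that by blast
  \<comment> \<open>The difference in time along \<open>x\<close> after which coordinate
    \<open>a\<close> has moved by more than the combined reach \<open>2 * b\<close> of two blocks;
    the 1 allows for the floors.\<close>
  define H where "H = (2 * real_of_int b + 1) / \<bar>x $ a\<bar>"
  have H: "H \<ge> 0" "H * \<bar>x $ a\<bar> = 2 * real_of_int b + 1" using b xa by (auto simp: H_def)
  define R where "R = nat \<lceil>H\<rceil>"
  have R: "H \<le> real R" unfolding R_def by linarith
  \<comment> \<open>The spacing has to exceed the reach \<open>2 * b\<close> plus the drift
    \<open>H * \<bar>x $ c\<bar>\<close> in direction \<open>c\<close> during a time
    \<open>H\<close>, plus rounding.\<close>
  define W where "W = nat \<lceil>2 * real_of_int b + 2 + H * \<bar>x $ c\<bar>\<rceil> + 1"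
  have W: "W \<ge> 1" "2 * real_of_int b + 1 + H * \<bar>x $ c\<bar> < real W" unfolding W_def by (simp, linarith)
  \<comment> \<open>The Chebyshev bound for at most n blocks and a deviation of
    \<open>n * \<epsilon> / 2\<close>; the other half of \<open>\<epsilon>\<close> went into the
    means of the blocks.\<close>
  define q where "q n = (4 * (2 * real R + 1) * C / \<epsilon>\<^sup>2) / real n" for n :: nat
  define y where "y i = axis c (int (i * W))" for i
  have tube: "\<forall>K. prob {\<omega> \<in> space M. \<forall>i\<in>{1..K}. real n * (\<mu> + \<epsilon>) <
       T \<omega> (y i) (y i + floor_vec (real n *\<^sub>R x))} \<le> q n ^ K" if n: "real n \<ge> k" for n
  proof
    fix K
    define m where "m = nat \<lfloor>real n / k\<rfloor>"
    define s where "s = real n / real m"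
    have m: "m \<ge> 1" "real m \<le> real n / k" and s: "s \<in> {k..2 * k}"
      using partition_step[of k n] k n unfolding m_def s_def by auto
    have ms: "real m * s = real n" using m(1) by (simp add: s_def)
    have s1: "s \<ge> 1" using s k by auto
    have n1: "real n \<ge> 1" using n k by linarith
    define P where "P j = floor_vec ((real j * s) *\<^sub>R x)" for j
    define v where "v j = P (Suc j) - P j" for j
    have P0: "P 0 = 0" unfolding P_def floor_vec_def by (simp add: vec_eq_iff)
    have Pm: "P m = floor_vec (real n *\<^sub>R x)" unfolding P_def ms ..
    have gb: "good_block (\<Gamma> (v j)) (v j) b C (s * (\<mu> + \<epsilon> / 2))" for j
    proof -
      have "P (Suc j) = floor_vec ((real j * s + s) *\<^sub>R x)" unfolding P_def by (simp add: algebra_simps)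
      then show ?thesis using good[OF s, of "real j * s"] by (simp add: v_def P_def)
    qed
    note gb' = gb[unfolded good_block_def]
    have Pl: "P j $ l = \<lfloor>real j * s * x $ l\<rfloor>" for j l unfolding P_def floor_vec_def by simp
    have apart: "\<bar>P i $ a - P j $ a\<bar> > 2 * b" if "\<bar>real i * s - real j * s\<bar> > H" for i j
    proof -
      have "\<bar>real i * s - real j * s\<bar> * \<bar>x $ a\<bar> > H * \<bar>x $ a\<bar>" using that xa by simp
      then have "\<bar>real i * s * x $ a - real j * s * x $ a\<bar> > 2 * real_of_int b + 1"
        unfolding H(2) abs_mult[symmetric] by (simp add: algebra_simps)
      then have "real_of_int \<bar>P i $ a - P j $ a\<bar> > real_of_int (2 * b)"
        using floor_diff_bounds(1)[of "real i * s * x $ a" "real j * s * x $ a"] unfolding Pl by simp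
      then show ?thesis by (simp only: of_int_less_iff)
    qed
    \<comment> \<open>Every piece has length \<open>s \<ge> 1\<close>, so an index gap above
      \<open>R\<close> is a time gap above \<open>H\<close>.\<close>
    have far: "\<exists>l. \<bar>(u + P i) $ l - (u + P j) $ l\<bar> > 2 * b" if "i + R < j" for i j u
    proof -
      have "H < real j - real i" using that R by linarith
      also have "\<dots> \<le> (real j - real i) * s"
        using s1 that mult_left_mono[of 1 s "real j - real i"] by simp
      finally have "\<bar>real i * s - real j * s\<bar> > H" by (simp add: algebra_simps)
      from apart[OF this] show ?thesis by (intro exI[of _ a]) simp
    qed
    \<comment> \<open>If the times of the two blocks differ by more than \<open>H\<close>,
      coordinate \<open>a\<close> separates them, as the shift along \<open>c\<close> does not
      affect it. Otherwise the drift along \<open>c\<close> is too small to make up for the spacing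
      \<open>W\<close>.\<close>
    have dis: "support (\<Gamma> (v j)) (y i + P j) \<inter> support (\<Gamma> (v j')) (y i' + P j') = {}" if "i \<noteq> i'" for i i' j j'
    proof -
      have "\<exists>l. \<bar>(y i + P j) $ l - (y i' + P j') $ l\<bar> > 2 * b"
      proof (cases "\<bar>real j * s - real j' * s\<bar> > H")
        case True
        from apart[OF this] show ?thesis using ac by (intro exI[of _ a]) (simp add: y_def axis_def)
      next
        case False
        then have "\<bar>real j * s - real j' * s\<bar> * \<bar>x $ c\<bar> \<le> H * \<bar>x $ c\<bar>" by (intro mult_right_mono) auto
        then have "\<bar>real j * s * x $ c - real j' * s * x $ c\<bar> \<le> H * \<bar>x $ c\<bar>"
          unfolding abs_mult[symmetric] by (simp add: algebra_simps)
        then have le: "\<bar>real_of_int (P j $ c - P j' $ c)\<bar> < H * \<bar>x $ c\<bar> + 1"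
          using floor_diff_bounds(2)[of "real j * s * x $ c" "real j' * s * x $ c"] unfolding Pl by simp
        have "\<bar>real i - real i'\<bar> \<ge> 1" using that by linarith
        then have "1 * real W \<le> \<bar>real i - real i'\<bar> * real W" by (intro mult_right_mono) auto
        also have "\<dots> = \<bar>real i * real W - real i' * real W\<bar>"
          by (simp add: left_diff_distrib[symmetric] abs_mult)
        finally have "2 * real_of_int b < \<bar>(real i * real W - real i' * real W) + real_of_int (P j $ c - P j' $ c)\<bar>"
          using le W(2) by linarith
        also have "\<dots> = real_of_int \<bar>(y i + P j) $ c - (y i' + P j') $ c\<bar>"
          by (simp add: y_def axis_def algebra_simps)
        finally have "real_of_int (2 * b) < real_of_int \<bar>(y i + P j) $ c - (y i' + P j') $ c\<bar>" by simp
        then show ?thesis by (intro exI[of _ c]) (simp only: of_int_less_iff)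
      qed
      then obtain l where l: "\<bar>(y i + P j) $ l - (y i' + P j') $ l\<bar> > 2 * b" by blast
      show ?thesis
        by (rule supports_disjoint[where b = b and l = l and v = "v j", OF _ _ _ l])
           (use gb'[of j] gb'[of j'] in auto)
    qed
    define \<theta> where "\<theta> = real n * (\<mu> + \<epsilon>)"
    have one: "prob {\<omega> \<in> space M. \<theta> < (\<Sum>j<m. block (\<Gamma> (v j)) (y i + P j) (\<lambda>e. \<tau> e \<omega>))} \<le> q n" for i
    proof -
      have h: "real n * (\<epsilon> / 2) > 0" using n1 \<epsilon> by simp
      have \<theta>': "\<theta> = real m * (s * (\<mu> + \<epsilon> / 2)) + real n * (\<epsilon> / 2)"
        unfolding \<theta>_def mult.assoc[symmetric] ms by (simp add: algebra_simps)
      have "prob {\<omega> \<in> space M. \<theta> < (\<Sum>j<m. block (\<Gamma> (v j)) (y i + P j) (\<lambda>e. \<tau> e \<omega>))}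
        \<le> real m * (2 * real R + 1) * C / (real n * (\<epsilon> / 2))\<^sup>2"
        unfolding \<theta>' by (rule one_tube_tail[OF gb C _ h]) (rule far)
      also have "\<dots> \<le> real n * (2 * real R + 1) * C / (real n * (\<epsilon> / 2))\<^sup>2"
      proof (intro divide_right_mono mult_right_mono C)
        have "real n / k \<le> real n / 1" using k by (intro divide_left_mono) auto
        then show "real m \<le> real n" using m(2) by simp
      qed auto
      also have "\<dots> = q n" unfolding q_def using n1 \<epsilon> by (simp add: field_simps power2_eq_square)
      finally show ?thesis .
    qed
    have "prob {\<omega> \<in> space M. \<forall>i\<in>{1..K}. real n * (\<mu> + \<epsilon>) < T \<omega> (y i) (y i + floor_vec (real n *\<^sub>R x))}
       \<le> prob {\<omega> \<in> space M. \<forall>i\<in>{1..K}. \<theta> < (\<Sum>j<m. block (\<Gamma> (v j)) (y i + P j) (\<lambda>e. \<tau> e \<omega>))}"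
    proof (rule finite_measure_mono)
      have [measurable]: "(\<lambda>\<omega>. block (\<Gamma> (v j)) u (\<lambda>e. \<tau> e \<omega>)) \<in> borel_measurable M" for j u
        using gb'[of j] by (intro measurable_block[where v = "v j"]) auto
      show "{\<omega> \<in> space M. \<forall>i\<in>{1..K}. \<theta> < (\<Sum>j<m. block (\<Gamma> (v j)) (y i + P j) (\<lambda>e. \<tau> e \<omega>))} \<in> events"
        by measurable
      have le: "T \<omega> (y i) (y i + floor_vec (real n *\<^sub>R x)) \<le> (\<Sum>j<m. block (\<Gamma> (v j)) (y i + P j) (\<lambda>e. \<tau> e \<omega>))"
        if w: "\<omega> \<in> space M" for \<omega> i
      proof -
        note nw = nonneg_weights[OF w]
        have "T \<omega> (y i + P 0) (y i + P m) \<le> (\<Sum>j<m. T \<omega> (y i + P j) (y i + P (Suc j)))"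
          by (rule ptime_chain[OF nw, of "\<lambda>j. y i + P j"])
        also have "\<dots> \<le> (\<Sum>j<m. block (\<Gamma> (v j)) (y i + P j) (\<lambda>e. \<tau> e \<omega>))"
        proof (rule sum_mono)
          fix j
          have step: "y i + P (Suc j) = (y i + P j) + v j" by (simp add: v_def)
          show "T \<omega> (y i + P j) (y i + P (Suc j)) \<le> block (\<Gamma> (v j)) (y i + P j) (\<lambda>e. \<tau> e \<omega>)"
            unfolding step using gb'[of j] by (intro ptime_le_block[OF nw]) auto
        qed
        finally show ?thesis unfolding P0 Pm by simp
      qed
      show "{\<omega> \<in> space M. \<forall>i\<in>{1..K}. real n * (\<mu> + \<epsilon>) < T \<omega> (y i) (y i + floor_vec (real n *\<^sub>R x))}
        \<subseteq> {\<omega> \<in> space M. \<forall>i\<in>{1..K}. \<theta> < (\<Sum>j<m. block (\<Gamma> (v j)) (y i + P j) (\<lambda>e. \<tau> e \<omega>))}"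
        unfolding \<theta>_def using less_le_trans[OF _ le] by blast
    qed
    also have "\<dots> \<le> q n ^ K"
      using gb' dis one by (intro many_tubes_tail[where v = v]) auto
    finally show "prob {\<omega> \<in> space M. \<forall>i\<in>{1..K}. real n * (\<mu> + \<epsilon>) < T \<omega> (y i) (y i + floor_vec (real n *\<^sub>R x))}
       \<le> q n ^ K" .
  qed
  have ev: "\<forall>\<^sub>F n in sequentially. real n \<ge> k"
    using filterlim_real_sequentially by (simp add: filterlim_at_top)
  have "q \<longlonglongrightarrow> 0" unfolding q_def by (intro real_tendsto_divide_at_top[OF tendsto_const] filterlim_real_sequentially)
  moreover have "\<forall>\<^sub>F n in sequentially. \<forall>K. prob {\<omega> \<in> space M. \<forall>i\<in>{1..K}. real n * (\<mu> + \<epsilon>) <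
       T \<omega> (y i) (y i + floor_vec (real n *\<^sub>R x))} \<le> q n ^ K"
    using ev by (rule eventually_mono) (rule tube)
  ultimately show ?thesis using W(1) unfolding \<mu>_def y_def by (intro exI[of _ W] exI[of _ q] conjI)
qed

section \<open>Upper bound\<close>

text \<open>The loss \<open>\<eta>\<close> in the rate is spent as follows: a quarter on moving
  \<open>\<alpha>\<close> and \<open>\<xi>\<close> by \<open>t\<close>, a quarter on the exponential
  moments along the connections, and half on the union over the tubes and bounded factors.\<close>

lemma upper_tail_le:
  assumes d: "CARD('n) \<ge> 2" and x: "x \<noteq> 0" and \<xi>: "\<xi> > 0" and \<eta>: "\<eta> > 0"
  shows "\<forall>\<^sub>F n in sequentially.
    prob {\<omega> \<in> space M. T \<omega> 0 (floor_vec (real n *\<^sub>R x)) > real n * (time_constant M \<tau> x + \<xi>)} \<le>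
    exp (- (2 * real CARD('n) * \<alpha> * \<xi> powr r - \<eta>) * real n powr r)"
proof -
  define \<mu> where "\<mu> = time_constant M \<tau> x"
  define p where "p n = floor_vec (real n *\<^sub>R x)" for n :: nat
  define D where "D = real CARD('n)"
  define A where "A = 2 * D * \<alpha> * \<xi> powr r"
  have D: "D \<ge> 2" using d by (simp add: D_def)
  have A: "A > 0" using D pos \<xi> by (simp add: A_def)
  obtain a where xa: "x $ a \<noteq> 0" using x by (auto simp: vec_eq_iff)
  \<comment> \<open>A second axis exists because d is at least 2. The tubes are stacked along
    \<open>c\<close>, while progress towards the target is visible along \<open>a\<close>.\<close>
  obtain c where ac: "a \<noteq> c"
  proof (rule ccontr)
    assume "\<not> thesis"
    then have "c = a" for c using that[of c] by metis
    then have "UNIV = {a}" by auto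
    then have "CARD('n) = card {a}" by simp
    then show False using d by simp
  qed
  \<comment> \<open>A single small \<open>t\<close> serves as the gap to \<open>\<alpha>\<close> in
    the exponential moment, as the gap to \<open>\<xi>\<close> in the cost of the connections, and
    as the slack of the tubes.\<close>
  have "((\<lambda>t. 2 * D * (\<alpha> - t) * (\<xi> - t) powr r) \<longlongrightarrow> 2 * D * (\<alpha> - 0) * (\<xi> - 0) powr r) (at_right 0)"
    using \<xi> by (intro tendsto_intros) auto
  then have "\<forall>\<^sub>F t in at_right 0. A - \<eta> / 4 < 2 * D * (\<alpha> - t) * (\<xi> - t) powr r"
    using \<eta> by (intro order_tendstoD) (auto simp: A_def)
  moreover have "\<forall>\<^sub>F t in at_right 0. t \<in> {0<..<min \<alpha> \<xi>}"
    using pos \<xi> by (intro eventually_at_right_real) simp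
  ultimately have "\<forall>\<^sub>F t in at_right 0. A - \<eta> / 4 < 2 * D * (\<alpha> - t) * (\<xi> - t) powr r \<and> t \<in> {0<..<min \<alpha> \<xi>}"
    by (rule eventually_conj)
  then obtain t where t: "A - \<eta> / 4 < 2 * D * (\<alpha> - t) * (\<xi> - t) powr r" "0 < t" "t < \<alpha>" "t < \<xi>"
    using eventually_happens'[of "at_right (0::real)"] by (auto simp: trivial_limit_at_right_real)
  define b where "b = \<alpha> - t"
  have b: "0 < b" "b < \<alpha>" using t by (auto simp: b_def)
  obtain C where C: "C \<ge> 1" "\<And>e. e \<in> lattice_edges \<Longrightarrow> integrable M (\<lambda>\<omega>. exp (b * \<tau> e \<omega> powr r))"
    "\<And>e. e \<in> lattice_edges \<Longrightarrow> expectation (\<lambda>\<omega>. exp (b * \<tau> e \<omega> powr r)) \<le> C"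
    using exp_moment[OF b] by blast
  define L where "L = ln C"
  have L: "L \<ge> 0" "C = exp L" using C(1) by (auto simp: L_def)
  from parallel_tubes[OF xa ac t(2)]
  obtain W q where WQ: "W \<ge> (1::nat) \<and> q \<longlonglongrightarrow> 0 \<and> (\<forall>\<^sub>F n in sequentially. \<forall>K.
     prob {\<omega> \<in> space M. \<forall>i\<in>{1..K}. real n * (\<mu> + t) <
       T \<omega> (axis c (int (i * W))) (axis c (int (i * W)) + p n)} \<le> q n ^ K)"
    unfolding \<mu>_def p_def by (elim exE)
  note W = WQ[THEN conjunct1] and q = WQ[THEN conjunct2, THEN conjunct1]
    and tubes = WQ[THEN conjunct2, THEN conjunct2]
  \<comment> \<open>Chosen so that the growing part of the exponent of \<open>C\<close>, that is
    \<open>4 * D * L * W * \<delta>\<close> per unit of \<open>n powr r\<close>, is at most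
    \<open>\<eta> / 4\<close>. The denominator has \<open>L + 1\<close> because \<open>L\<close>
    vanishes when \<open>C = 1\<close>.\<close>
  define \<delta> where "\<delta> = \<eta> / (16 * D * real W * (L + 1))"
  have \<delta>: "\<delta> > 0" using \<eta> D W L by (simp add: \<delta>_def)
  have \<delta>': "4 * D * L * real W * \<delta> \<le> \<eta> / 4"
  proof -
    have "4 * D * L * real W * \<delta> = (\<eta> / 4) * (L / (L + 1))"
    proof -
      have "4 * D * L * w * (\<eta> / (16 * D * w * z)) = (\<eta> / 4) * (L / z)" if "w \<noteq> 0" "z \<noteq> 0" for w z
        using that D by (simp add: field_simps)
      then show ?thesis unfolding \<delta>_def using W L by simp
    qed
    also have "\<dots> \<le> (\<eta> / 4) * 1" using L \<eta> by (intro mult_left_mono) auto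
    finally show ?thesis by simp
  qed
  \<comment> \<open>The part of the endpoint factor that does not grow with n: \<open>W\<close>
    comes from rounding \<open>K\<close> up, 8 from the turns of the routes.\<close>
  define E0 where "E0 = exp (4 * D * L * (real W + 8))"
  have ylim: "filterlim (\<lambda>n. real n powr r) at_top sequentially"
    using pos by real_asymp
  have "((\<lambda>y. (\<delta> * y + 1) * E0 * exp (- (\<eta> / 2) * y)) \<longlongrightarrow> 0) at_top"
    using \<eta> \<delta> by real_asymp
  then have "\<forall>\<^sub>F y in at_top. (\<delta> * y + 1) * E0 * exp (- (\<eta> / 2) * y) < 1 / 2"
    by (rule order_tendstoD) simp
  from eventually_compose_filterlim[OF this ylim]
  have ev1: "\<forall>\<^sub>F n in sequentially. (\<delta> * real n powr r + 1) * E0 * exp (- (\<eta> / 2) * real n powr r) < 1 / 2" .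
  \<comment> \<open>Raised to a power of at least \<open>\<delta> * n powr r\<close> this gives
    \<open>exp (- (A + 1) * n powr r)\<close>. The 1 leaves a factor
    \<open>exp (- n powr r)\<close>, which is at most 1/2 once
    \<open>n powr r \<ge> 1\<close>.\<close>
  have ev2: "\<forall>\<^sub>F n in sequentially. \<bar>q n\<bar> < exp (- (A + 1) / \<delta>)"
    using order_tendstoD(2)[OF tendsto_rabs_zero[OF q], of "exp (- (A + 1) / \<delta>)"] by simp
  have ev3: "\<forall>\<^sub>F n in sequentially. \<bar>p n $ a\<bar> \<ge> 4"
    using eventually_floor_vec_nonzero[OF xa, of 4] unfolding p_def .
  have ev4: "\<forall>\<^sub>F n in sequentially. real n powr r \<ge> 1"
    using ylim by (simp add: filterlim_at_top)
  have "\<forall>\<^sub>F n in sequentially. prob {\<omega> \<in> space M. T \<omega> 0 (p n) > real n * (\<mu> + \<xi>)} \<le>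
    exp (- (A - \<eta>) * real n powr r)"
    using tubes ev1 ev2 ev3 ev4
  proof eventually_elim
    case (elim n)
    define y where "y = real n powr r"
    define K where "K = nat \<lceil>\<delta> * y\<rceil>"
    \<comment> \<open>What the two connections together must exceed when the total is above
      \<open>n * (\<mu> + \<xi>)\<close> although the tube itself takes at most
      \<open>n * (\<mu> + t)\<close>.\<close>
    define s where "s = real n * (\<xi> - t)"
    have y1: "y \<ge> 1" using elim by (simp add: y_def)
    have K: "\<delta> * y \<le> real K" "real K \<le> \<delta> * y + 1" 
    proof -
      have "\<delta> * y \<ge> 0" using \<delta> y1 by simp
      then show "\<delta> * y \<le> real K" "real K \<le> \<delta> * y + 1" unfolding K_def by linarith+
    qed
    have s: "s \<ge> 0" using t by (simp add: s_def)
    define U where "U i \<omega> = T \<omega> 0 (axis c (int (i * W))) + T \<omega> (axis c (int (i * W)) + p n) (p n)" for i \<omega>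
    let ?E = "{\<omega> \<in> space M. T \<omega> 0 (p n) > real n * (\<mu> + \<xi>)}"
    let ?A = "{\<omega> \<in> space M. \<forall>i\<in>{1..K}. real n * (\<mu> + t) <
       T \<omega> (axis c (int (i * W))) (axis c (int (i * W)) + p n)}"
    let ?B = "\<lambda>i. {\<omega> \<in> space M. s < U i \<omega>}"
    have [measurable]: "U i \<in> borel_measurable M" for i unfolding U_def by measurable
    have sub: "?E \<subseteq> ?A \<union> (\<Union>i\<in>{1..K}. ?B i)"
    proof
      fix \<omega> assume w: "\<omega> \<in> ?E"
      show "\<omega> \<in> ?A \<union> (\<Union>i\<in>{1..K}. ?B i)"
      proof (cases "\<omega> \<in> ?A")
        case False
        then obtain i where i: "i \<in> {1..K}"
          "T \<omega> (axis c (int (i * W))) (axis c (int (i * W)) + p n) \<le> real n * (\<mu> + t)"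
          using w by force
        let ?y = "axis c (int (i * W)) :: int ^ 'n"
        have nw: "nonneg_weights (\<lambda>e. \<tau> e \<omega>)" using w by simp
        have "real n * (\<mu> + \<xi>) < T \<omega> 0 ?y + (T \<omega> ?y (?y + p n) + T \<omega> (?y + p n) (p n))"
          using w ptime_triangle[OF nw, of 0 "p n" ?y] ptime_triangle[OF nw, of ?y "p n" "?y + p n"] by auto
        moreover have "real n * (\<mu> + \<xi>) = real n * (\<mu> + t) + s" by (simp add: s_def algebra_simps)
        ultimately have "s < U i \<omega>" using i(2) unfolding U_def by linarith
        then show ?thesis using i(1) w by auto
      qed simp
    qed
    have "prob ?E \<le> prob (?A \<union> (\<Union>i\<in>{1..K}. ?B i))"
      by (rule finite_measure_mono[OF sub]) measurable
    also have "\<dots> \<le> prob ?A + prob (\<Union>i\<in>{1..K}. ?B i)"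
      by (rule measure_Un_le) measurable
    also have "prob (\<Union>i\<in>{1..K}. ?B i) \<le> (\<Sum>i\<in>{1..K}. prob (?B i))"
      by (rule finite_measure_subadditive_finite) auto
    also have "prob ?A \<le> exp (- (A - \<eta>) * y) / 2"
    proof -
      have "prob ?A \<le> q n ^ K" using elim(1) by blast
      also have "\<dots> \<le> \<bar>q n\<bar> ^ K" by (simp add: power_abs[symmetric])
      also have "\<dots> \<le> exp (- (A + 1) / \<delta>) ^ K" using elim(3) by (intro power_mono) auto
      also have "\<dots> = exp (- ((A + 1) / \<delta> * real K))" 
        using \<delta> by (simp add: exp_of_nat_mult[symmetric] field_simps)
      also have "\<dots> \<le> exp (- ((A + 1) / \<delta> * (\<delta> * y)))" 
        unfolding exp_le_cancel_iff neg_le_iff_le using A \<delta> K by (intro mult_left_mono) auto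
      also have "\<dots> = exp (- A * y) * exp (- y)" using \<delta> by (simp add: exp_add[symmetric] field_simps)
      also have "\<dots> \<le> exp (- (A - \<eta>) * y) * (1 / 2)"
      proof (intro mult_mono)
        show "exp (- A * y) \<le> exp (- (A - \<eta>) * y)" using \<eta> y1 by (simp add: algebra_simps)
        have "2 \<le> exp y" using exp_ge_add_one_self[of y] y1 by linarith
        then show "exp (- y) \<le> 1 / 2" by (simp add: exp_minus field_simps)
      qed auto
      finally show ?thesis by simp
    qed
    also have "(\<Sum>i\<in>{1..K}. prob (?B i)) \<le> exp (- (A - \<eta>) * y) / 2"
    proof -
      have "prob (?B i) \<le> exp (- (A - \<eta> / 2) * y) * E0" if i: "i \<in> {1..K}" for i
      proof -
        have "prob (?B i) \<le> exp (- b * (2 * real CARD('n) * s powr r)) * C ^ (4 * CARD('n) * (i * W + 8))"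
          unfolding U_def by (rule endpoint_cost[OF ac elim(4) s b(1) C(2,3,1)])
        also have "C ^ (4 * CARD('n) * (i * W + 8)) = exp (4 * D * L * (real i * real W + 8))"
          unfolding L(2) by (simp add: exp_of_nat_mult[symmetric] D_def algebra_simps)
        also have "\<dots> \<le> exp (\<eta> / 4 * y + 4 * D * L * (real W + 8))"
        proof -
          have "real i \<le> \<delta> * y + 1" using i K(2) by simp
          then have "4 * D * L * (real i * real W + 8) \<le> 4 * D * L * ((\<delta> * y + 1) * real W + 8)"
            using D L by (intro mult_left_mono add_right_mono mult_right_mono) auto
          also have "\<dots> = (4 * D * L * real W * \<delta>) * y + 4 * D * L * (real W + 8)" by (simp add: algebra_simps)
          also have "\<dots> \<le> \<eta> / 4 * y + 4 * D * L * (real W + 8)"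
            using \<delta>' y1 by (intro add_right_mono mult_right_mono) auto
          finally show ?thesis by simp
        qed
        also have "exp (- b * (2 * real CARD('n) * s powr r)) \<le> exp (- (A - \<eta> / 4) * y)"
        proof -
          have "s powr r = y * (\<xi> - t) powr r" unfolding s_def y_def using t by (intro powr_mult)
          then have "b * (2 * real CARD('n) * s powr r) = (2 * D * (\<alpha> - t) * (\<xi> - t) powr r) * y"
            by (simp add: b_def D_def)
          also have "\<dots> \<ge> (A - \<eta> / 4) * y" using t(1) y1 by (intro mult_right_mono) auto
          finally have "(A - \<eta> / 4) * y \<le> b * (2 * real CARD('n) * s powr r)" .
          then have "- b * (2 * real CARD('n) * s powr r) \<le> - (A - \<eta> / 4) * y" by linarith
          then show ?thesis by (rule exp_le_cancel_iff[THEN iffD2])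
        qed
        finally have "prob (?B i) \<le> exp (- (A - \<eta> / 4) * y) * exp (\<eta> / 4 * y + 4 * D * L * (real W + 8))" by simp
        also have "\<dots> = exp (- (A - \<eta> / 2) * y) * E0"
          unfolding E0_def exp_add[symmetric] by (simp add: algebra_simps)
        finally show ?thesis .
      qed
      then have "(\<Sum>i\<in>{1..K}. prob (?B i)) \<le> (\<Sum>i\<in>{1..K}. exp (- (A - \<eta> / 2) * y) * E0)"
        by (intro sum_mono)
      also have "\<dots> = real K * (exp (- (A - \<eta> / 2) * y) * E0)" by simp
      also have "\<dots> \<le> (\<delta> * y + 1) * (exp (- (A - \<eta> / 2) * y) * E0)"
        using K by (intro mult_right_mono) (auto simp: E0_def)
      also have "exp (- (A - \<eta> / 2) * y) = exp (- (A - \<eta>) * y) * exp (- (\<eta> / 2) * y)"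
        by (simp add: exp_add[symmetric] algebra_simps)
      also have "(\<delta> * y + 1) * (exp (- (A - \<eta>) * y) * exp (- (\<eta> / 2) * y) * E0)
          = exp (- (A - \<eta>) * y) * ((\<delta> * y + 1) * E0 * exp (- (\<eta> / 2) * y))" by simp
      also have "\<dots> \<le> exp (- (A - \<eta>) * y) * (1 / 2)"
        using elim(2) unfolding y_def by (intro mult_left_mono) auto
      finally show ?thesis by simp
    qed
    finally show ?case unfolding y_def by simp
  qed
  then show ?thesis unfolding p_def \<mu>_def A_def D_def .
qed

end

section \<open>The two bounds combined on the logarithmic scale\<close>

theorem theorem1p1:
  fixes M :: "'a measure"
    and \<tau> :: "(int ^ 'n) set \<Rightarrow> 'a \<Rightarrow> real"
    and \<beta>\<^sub>1 \<beta>\<^sub>2 \<alpha> r \<xi> :: real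
    and x :: "real ^ 'n"
  assumes "prob_space M"
    and "CARD('n) \<ge> 2"
    and nonneg: "\<And>e \<omega>. e \<in> lattice_edges \<Longrightarrow> \<omega> \<in> space M \<Longrightarrow> 0 \<le> \<tau> e \<omega>"
    and indep: "prob_space.indep_vars M (\<lambda>_. borel) \<tau> lattice_edges"
    and ident: "\<And>e f. e \<in> lattice_edges \<Longrightarrow> f \<in> lattice_edges \<Longrightarrow>
      distr M borel (\<tau> e) = distr M borel (\<tau> f)"
    and "\<beta>\<^sub>1 > 0" "\<beta>\<^sub>2 > 0" "\<alpha> > 0" "0 < r" "r \<le> 1"
    and lower: "\<And>e t. e \<in> lattice_edges \<Longrightarrow> t \<ge> 0 \<Longrightarrow>
      \<beta>\<^sub>1 * exp (- \<alpha> * t powr r) \<le> measure M {\<omega> \<in> space M. \<tau> e \<omega> > t}"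
    and upper: "\<And>e t. e \<in> lattice_edges \<Longrightarrow> t \<ge> 0 \<Longrightarrow>
      measure M {\<omega> \<in> space M. \<tau> e \<omega> > t} \<le> \<beta>\<^sub>2 * exp (- \<alpha> * t powr r)"
    and "\<xi> > 0" "x \<noteq> 0"
  shows "(\<lambda>n::nat. 1 / real n powr r *
      ln (measure M {\<omega> \<in> space M.
        first_passage_time (\<lambda>e. \<tau> e \<omega>) 0 (real n *\<^sub>R x)
          > real n * (time_constant M \<tau> x + \<xi>)}))
    \<longlonglongrightarrow> - 2 * real CARD('n) * \<alpha> * \<xi> powr r"
proof -
  interpret fpp M \<tau> \<beta>\<^sub>2 \<alpha> r
    by (intro fpp.intro fpp_axioms.intro assms)
  define A where "A = 2 * real CARD('n) * \<alpha> * \<xi> powr r"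
  define pr where "pr n = prob {\<omega> \<in> space M. T \<omega> 0 (floor_vec (real n *\<^sub>R x)) > real n * (time_constant M \<tau> x + \<xi>)}"
    for n :: nat
  have "floor_vec (0 :: real ^ 'n) = 0" by (simp add: floor_vec_def vec_eq_iff)
  then have eq: "measure M {\<omega> \<in> space M. first_passage_time (\<lambda>e. \<tau> e \<omega>) 0 (real n *\<^sub>R x)
          > real n * (time_constant M \<tau> x + \<xi>)} = pr n" for n
    by (simp add: pr_def first_passage_time_eq_ptime)
  have ylim: "filterlim (\<lambda>n. real n powr r) at_top sequentially"
    using \<open>0 < r\<close> by real_asymp
  have "(\<lambda>n. 1 / real n powr r * ln (pr n)) \<longlonglongrightarrow> - A"
  proof (rule tendstoI)
    fix \<eta> :: real assume \<eta>: "\<eta> > 0"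
    have up: "\<forall>\<^sub>F n in sequentially. pr n \<le> exp (- (A - \<eta> / 2) * real n powr r)"
      using upper_tail_le[OF \<open>CARD('n) \<ge> 2\<close> \<open>x \<noteq> 0\<close> \<open>\<xi> > 0\<close>, of "\<eta> / 2"] \<eta> unfolding pr_def A_def by simp
    have "((\<lambda>t. 2 * real CARD('n) * \<alpha> * (\<xi> + t) powr r) \<longlongrightarrow> 2 * real CARD('n) * \<alpha> * (\<xi> + 0) powr r) (at_right 0)"
      using \<open>\<xi> > 0\<close> by (intro tendsto_intros) auto
    then have "\<forall>\<^sub>F t in at_right 0. 2 * real CARD('n) * \<alpha> * (\<xi> + t) powr r < A + \<eta> / 2"
      using \<eta> by (intro order_tendstoD) (auto simp: A_def)
    then have "\<forall>\<^sub>F t in at_right 0. 2 * real CARD('n) * \<alpha> * (\<xi> + t) powr r < A + \<eta> / 2 \<and> t > 0"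
      by (rule eventually_conj[OF _ eventually_at_right_less])
    then obtain t where t: "2 * real CARD('n) * \<alpha> * (\<xi> + t) powr r < A + \<eta> / 2" "t > 0"
      using eventually_happens'[of "at_right (0::real)"] by (auto simp: trivial_limit_at_right_real)
    obtain c where c: "c > 0" "\<forall>\<^sub>F n in sequentially.
       c * exp (- 2 * real CARD('n) * \<alpha> * (\<xi> + t) powr r * real n powr r) \<le> pr n"
      using upper_tail_ge[OF lower \<open>\<beta>\<^sub>1 > 0\<close> \<open>x \<noteq> 0\<close> \<open>\<xi> > 0\<close> t(2)] unfolding pr_def by blast
    \<comment> \<open>The constant factor \<open>c\<close> of the lower bound then costs less than
      \<open>\<eta> / 2\<close> on the scale \<open>n powr r\<close>.\<close>
    have big: "\<forall>\<^sub>F n in sequentially. real n powr r > max 0 (2 * \<bar>ln c\<bar> / \<eta>)"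
      using ylim unfolding filterlim_at_top_dense by blast
    show "\<forall>\<^sub>F n in sequentially. dist (1 / real n powr r * ln (pr n)) (- A) < \<eta>"
      using up c(2) big
    proof eventually_elim
      case (elim n)
      define y where "y = real n powr r"
      have y: "y > 0" "y > 2 * \<bar>ln c\<bar> / \<eta>" using elim by (auto simp: y_def)
      define B where "B = 2 * real CARD('n) * \<alpha> * (\<xi> + t) powr r"
      have lo: "c * exp (- B * y) \<le> pr n" using elim(2) by (simp add: B_def y_def)
      have "0 < c * exp (- B * y)" using c by simp
      \<comment> \<open>Positivity has to come from the lower bound before any logarithm is
        compared, since \<open>ln\<close> at 0 is merely a default value.\<close>
      then have pn: "pr n > 0" using lo by linarith
      have "ln (pr n) \<le> ln (exp (- (A - \<eta> / 2) * y))"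
        using elim(1) pn unfolding y_def by (subst ln_le_cancel_iff) auto
      then have 1: "ln (pr n) \<le> - (A - \<eta> / 2) * y" by simp
      have "ln (c * exp (- B * y)) \<le> ln (pr n)" using lo pn c by (subst ln_le_cancel_iff) auto
      then have "ln c - B * y \<le> ln (pr n)" using c by (simp add: ln_mult)
      moreover have "B * y \<le> (A + \<eta> / 2) * y" using t(1) y(1) unfolding B_def by (intro mult_right_mono) auto
      moreover have "- (\<eta> / 2 * y) < ln c"
      proof -
        have "2 * \<bar>ln c\<bar> < y * \<eta>" using y(2) \<eta> by (simp add: field_simps)
        then have "\<bar>ln c\<bar> < \<eta> / 2 * y" by (simp add: algebra_simps)
        then show ?thesis by linarith
      qed
      ultimately have 2: "ln (pr n) > - (A + \<eta>) * y" by (simp add: algebra_simps)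
      have "- (A + \<eta>) < ln (pr n) / y" using 2 y(1) by (simp add: pos_less_divide_eq)
      moreover have "ln (pr n) / y \<le> - (A - \<eta> / 2)" using 1 y(1) by (simp add: pos_divide_le_eq)
      ultimately show ?case using \<eta> unfolding y_def[symmetric] dist_real_def by (simp add: abs_less_iff)
    qed
  qed
  then show ?thesis unfolding eq A_def by simp
qed

end
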